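(* Let $k$ be a PAC field of characteristic $p\geq 0$. If $n\geq 2$ is an integer such that $p$ does not divide $n(n-1)$, then every extension $E/k$ of degree $n$ can be realized by a trinomial $Y^n-Y+b\in k[Y]$ for some $b\in k$. Furthermore, if $p\neq 2$, the separable closure $k^{\mathrm{sep}}$ is generated over $k$ by all elements $y\in k^{\mathrm{sep}}$ such that $y^n-y\in k$ for some integer $n\geq 2$.
   Context: A field $k$ is PAC if every non-empty geometrically irreducible $k$-variety has a Zariski-dense set of $k$-rational points. A field extension $E/k$ is realized by a polynomial $Q(Y)\in k[Y]$ if $Q(Y)$ is the irreducible polynomial over $k$ of some primitive element of $E/k$. In characteristic $p=0$ the condition that $p$ does not divide $n(n-1)$ holds for every $n\ge 2$. *)

theory Defs
  imports
    "HOL-Algebra.Algebraic_Closure_Type"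
    "HOL-Analysis.Abstract_Topology"
    "HOL-Library.FuncSet"
    "HOL-Library.Poly_Mapping"
begin

text \<open>
  The base field is the type \<open>'k\<close>; its algebraic closure is the type \<open>'k alg_closure\<close>, and
  \<open>range to_ac\<close> is the copy of \<open>'k\<close> inside it.
\<close>

section \<open>Multivariate polynomials and affine space\<close>

type_synonym 'a mpoly = "(nat \<Rightarrow>\<^sub>0 nat) \<Rightarrow>\<^sub>0 'a"

definition mpolys :: "'a::comm_ring_1 set \<Rightarrow> nat \<Rightarrow> 'a mpoly set" where
  "mpolys A m = {p. (\<forall>e. Poly_Mapping.lookup p e \<in> A) \<and>
                    (\<forall>e\<in>Poly_Mapping.keys p. Poly_Mapping.keys e \<subseteq> {..<m})}"

definition eval_mpoly :: "'a::comm_ring_1 mpoly \<Rightarrow> (nat \<Rightarrow> 'a) \<Rightarrow> 'a" where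
  "eval_mpoly p x = (\<Sum>e\<in>Poly_Mapping.keys p.
     Poly_Mapping.lookup p e * (\<Prod>i\<in>Poly_Mapping.keys e. x i ^ Poly_Mapping.lookup e i))"

definition affine_space :: "nat \<Rightarrow> (nat \<Rightarrow> 'a) set" where
  "affine_space m = {..<m} \<rightarrow>\<^sub>E UNIV"

definition zero_locus :: "nat \<Rightarrow> 'a::comm_ring_1 mpoly set \<Rightarrow> (nat \<Rightarrow> 'a) set" where
  "zero_locus m F = {x \<in> affine_space m. \<forall>f\<in>F. eval_mpoly f x = 0}"

definition vanishing_ideal :: "nat \<Rightarrow> (nat \<Rightarrow> 'a::comm_ring_1) set \<Rightarrow> 'a mpoly set" where
  "vanishing_ideal m V = {g \<in> mpolys UNIV m. \<forall>x\<in>V. eval_mpoly g x = 0}"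

definition generated_ideal :: "nat \<Rightarrow> 'a::comm_ring_1 mpoly set \<Rightarrow> 'a mpoly set" where
  "generated_ideal m F =
     {\<Sum>f\<in>S. c f * f | S c. finite S \<and> S \<subseteq> F \<and> c ` S \<subseteq> mpolys UNIV m}"

text \<open>
  The Zariski topology on affine \<open>m\<close>-space whose closed sets are the zero loci of polynomials
  with coefficients in the subring \<open>A\<close>: for \<open>A = UNIV\<close> this is the geometric Zariski topology
  over the algebraic closure, for \<open>A = range to_ac\<close> the Zariski topology over the base field.
\<close>

definition zariski_topology :: "'a::comm_ring_1 set \<Rightarrow> nat \<Rightarrow> (nat \<Rightarrow> 'a) topology" where
  "zariski_topology A m =
     topology_generated_by {{x \<in> affine_space m. eval_mpoly p x \<noteq> 0} | p. p \<in> mpolys A m}"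

definition irreducible_subspace :: "'x topology \<Rightarrow> 'x set \<Rightarrow> bool" where
  "irreducible_subspace T S \<longleftrightarrow> S \<subseteq> topspace T \<and> S \<noteq> {} \<and>
     (\<forall>C D. closedin T C \<and> closedin T D \<and> S \<subseteq> C \<union> D \<longrightarrow> S \<subseteq> C \<or> S \<subseteq> D)"


section \<open>PAC fields\<close>

text \<open>
  A variety over \<open>'k\<close> is represented by its set \<open>V\<close> of points over the algebraic closure. It has
  to be defined over \<open>'k\<close>, which means more than being cut out by polynomials over \<open>'k\<close>: the full
  vanishing ideal of \<open>V\<close> over the algebraic closure is generated by polynomials over \<open>'k\<close>
  (geometric reducedness). Over an imperfect field the two notions differ: if \<open>a\<close> is not a
  \<open>p\<close>-th power, the zero locus of \<open>T^p - a\<close> is a single geometric point without rational points,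
  so without this requirement PAC fields would be perfect by definition, and separably closed
  fields would not all be PAC.
\<close>

definition affine_variety_over_base :: "nat \<Rightarrow> (nat \<Rightarrow> 'k::field alg_closure) set \<Rightarrow> bool" where
  "affine_variety_over_base m V \<longleftrightarrow>
     (\<exists>F \<subseteq> mpolys (range to_ac) m. V = zero_locus m F \<and> vanishing_ideal m V = generated_ideal m F)"

definition geometrically_irreducible :: "nat \<Rightarrow> (nat \<Rightarrow> 'k::field alg_closure) set \<Rightarrow> bool" where
  "geometrically_irreducible m V \<longleftrightarrow> irreducible_subspace (zariski_topology UNIV m) V"

definition rational_points :: "nat \<Rightarrow> (nat \<Rightarrow> 'k::field alg_closure) set \<Rightarrow> (nat \<Rightarrow> 'k alg_closure) set" where
  "rational_points m V = {x \<in> V. \<forall>i<m. x i \<in> range to_ac}"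

text \<open>
  Only affine varieties are quantified over. Since every variety is covered by affine open
  subvarieties, which inherit geometric irreducibility, this is no restriction.
\<close>

definition pac_field :: "'k::field itself \<Rightarrow> bool" where
  "pac_field _ \<longleftrightarrow>
     (\<forall>m (V :: (nat \<Rightarrow> 'k alg_closure) set).
        affine_variety_over_base m V \<and> V \<noteq> {} \<and> geometrically_irreducible m V \<longrightarrow>
        Abstract_Topology.closure_of (zariski_topology (range to_ac) m) (rational_points m V) = V)"


section \<open>Field extensions\<close>

definition is_subfield :: "'a::field set \<Rightarrow> bool" where
  "is_subfield K \<longleftrightarrow> 1 \<in> K \<and> (\<forall>x\<in>K. \<forall>y\<in>K. x - y \<in> K \<and> x * y \<in> K) \<and> (\<forall>x\<in>K. inverse x \<in> K)"

text \<open>An extension \<open>E/k\<close> is given by a homomorphism \<open>h\<close> from \<open>'k\<close> to a field \<open>'e\<close>.\<close>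

definition field_extension :: "('k::field \<Rightarrow> 'e::field) \<Rightarrow> bool" where
  "field_extension h \<longleftrightarrow>
     h 1 = 1 \<and> (\<forall>x y. h (x + y) = h x + h y) \<and> (\<forall>x y. h (x * y) = h x * h y)"

text \<open>The dimension is \<open>0\<close> for infinite extensions.\<close>

definition extension_degree :: "('k::field \<Rightarrow> 'e::field) \<Rightarrow> nat" where
  "extension_degree h = vector_space.dim (\<lambda>c x. h c * x) (UNIV :: 'e set)"

definition primitive_element :: "('k::field \<Rightarrow> 'e::field) \<Rightarrow> 'e \<Rightarrow> bool" where
  "primitive_element h y \<longleftrightarrow> is_subfield hull (insert y (range h)) = UNIV"

definition irreducible_polynomial_of :: "('k::field \<Rightarrow> 'e::field) \<Rightarrow> 'e \<Rightarrow> 'k poly \<Rightarrow> bool" where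
  "irreducible_polynomial_of h y Q \<longleftrightarrow>
     lead_coeff Q = 1 \<and> Factorial_Ring.irreducible Q \<and> poly (map_poly h Q) y = 0"

definition realized_by :: "('k::field \<Rightarrow> 'e::field) \<Rightarrow> 'k poly \<Rightarrow> bool" where
  "realized_by h Q \<longleftrightarrow> (\<exists>y. primitive_element h y \<and> irreducible_polynomial_of h y Q)"

definition trinomial :: "nat \<Rightarrow> 'k::field \<Rightarrow> 'k poly" where
  "trinomial n b = [:0, 1:] ^ n - [:0, 1:] + [:b:]"

definition separable_closure :: "'k::field alg_closure set" where
  "separable_closure =
     {x. \<exists>Q :: 'k poly. irreducible_polynomial_of to_ac x Q \<and> rsquarefree (map_poly to_ac Q)}"

end

theory Submission
  imports Defs "Jordan_Normal_Form.Char_Poly" "HOL-Computational_Algebra.Formal_Power_Series" "HOL-Combinatorics.Permutations"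
begin

text \<open>
  Let \<open>f\<close> be a squarefree polynomial of degree \<open>n\<close> over \<open>k\<close> with roots \<open>x i\<close>. A tuple \<open>c\<close> of
  coefficients stands for the element \<open>\<Sum>j. c j * x^j\<close> of \<open>k[x]/(f)\<close>, and requiring its characteristic
  polynomial to be a trinomial \<open>X^n - X + b\<close> defines an affine curve over \<open>k\<close>. After the
  base change that replaces \<open>c\<close> by the conjugates \<open>y i = \<Sum>j. c j * x i^j\<close>, this is the curve of ordered
  root tuples of \<open>X^n - X + b\<close> with \<open>b\<close> varying. That curve is geometrically irreducible because
  the trinomial with a transcendental constant term has the full symmetric Galois group when
  the characteristic does not divide \<open>n * (n - 1)\<close>: at a critical value exactly two roots collide, which yields a
  transposition, and the group is doubly transitive up to the scalings by \<open>(n - 1)\<close>-th roots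
  of unity. Over a PAC field the curve therefore has a rational point
  at which the trinomial is separable, and this point is a \<open>g \<in> k[X]\<close> for which \<open>g (x i)\<close>
  are the distinct roots of a trinomial.

  If \<open>E/k\<close> has degree \<open>n\<close>, it is separable since \<open>p\<close> does not divide \<open>n\<close>. Taking for \<open>f\<close> the minimal
  polynomial of a primitive element \<open>\<theta>\<close>, the element \<open>g \<theta>\<close> is a primitive element with minimal polynomial
  \<open>X^n - X + b\<close>. For the separable closure, the minimal polynomial of a separable element is
  multiplied by linear factors over \<open>k\<close> until the degree \<open>n\<close> satisfies the divisibility
  condition, which is possible when \<open>p \<noteq> 2\<close>; the element then lies in the field generated by its image under \<open>g\<close>.
\<close>

section \<open>Evaluation of multivariate polynomials\<close>

text \<open>The definition of a PAC field asks for more than an irreducible set of points: equations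
  over \<open>k\<close> have to generate the whole vanishing ideal over the algebraic closure. So
  radicality and primality are both proved for one explicit ideal. The means is a normal form: for
  \<open>j \<ge> 1\<close>, variable \<open>j\<close> satisfies modulo the ideal a monic equation of
  degree \<open>n - j\<close> over the earlier variables, and swapping coordinates produces
  \<open>n - j\<close> points in a fibre, enough to force a reduced form to vanish. No Galois group
  is formed. Its place is taken by the symmetries that preserve the ideal of a single point with
  power series coordinates, the roots near a critical value. Primality holds because the ideal is
  the kernel of evaluation at that point.\<close>

definition mono_eval :: "(nat \<Rightarrow> 'b::comm_ring_1) \<Rightarrow> (nat \<Rightarrow>\<^sub>0 nat) \<Rightarrow> 'b" where
  "mono_eval x e = (\<Prod>i\<in>Poly_Mapping.keys e. x i ^ Poly_Mapping.lookup e i)"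

text \<open>The coefficient map \<open>h\<close> lets one notion serve three purposes: evaluation at
  points (identity), at power series (\<open>fps_const\<close>), and substitution of polynomials for
  the variables (\<open>Const\<close>).\<close>

definition ev :: "('a::comm_ring_1 \<Rightarrow> 'b::comm_ring_1) \<Rightarrow> (nat \<Rightarrow> 'b) \<Rightarrow> 'a mpoly \<Rightarrow> 'b" where
  "ev h x p = (\<Sum>e\<in>Poly_Mapping.keys p. h (Poly_Mapping.lookup p e) * mono_eval x e)"

definition Const :: "'a::comm_ring_1 \<Rightarrow> 'a mpoly" where
  "Const c = Poly_Mapping.single 0 c"

definition Var :: "nat \<Rightarrow> 'a::comm_ring_1 mpoly" where
  "Var i = Poly_Mapping.single (Poly_Mapping.single i 1) 1"

lemma eval_mpoly_conv_ev: "eval_mpoly p x = ev (\<lambda>c. c) x p"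
  by (simp add: eval_mpoly_def ev_def mono_eval_def)

lemma mono_eval_superset:
  assumes "finite A" "Poly_Mapping.keys e \<subseteq> A"
  shows "mono_eval x e = (\<Prod>i\<in>A. x i ^ Poly_Mapping.lookup e i)"
  unfolding mono_eval_def
  by (rule prod.mono_neutral_left) (use assms in \<open>auto simp: in_keys_iff\<close>)

lemma mono_eval_0 [simp]: "mono_eval x 0 = 1"
  by (simp add: mono_eval_def)

lemma mono_eval_single [simp]: "mono_eval x (Poly_Mapping.single i k) = x i ^ k"
  by (subst mono_eval_superset[of "{i}"]) auto

lemma mono_eval_add: "mono_eval x (e + e') = mono_eval x e * mono_eval x e'"
proof -
  let ?A = "Poly_Mapping.keys e \<union> Poly_Mapping.keys e'"
  have "Poly_Mapping.keys (e + e') \<subseteq> ?A" by (rule keys_add)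
  then show ?thesis
    by (simp add: mono_eval_superset[of ?A] lookup_add power_add prod.distrib)
qed

lemma mpoly_eq_sum_monomials:
  "p = (\<Sum>e\<in>Poly_Mapping.keys p. Poly_Mapping.single e (Poly_Mapping.lookup p e))"
  by (rule poly_mapping_eqI)
    (simp add: lookup_sum lookup_single when_def sum.delta in_keys_iff)

context comm_ring_hom
begin

lemma ev_superset:
  assumes "finite A" "Poly_Mapping.keys p \<subseteq> A"
  shows "ev hom x p = (\<Sum>e\<in>A. hom (Poly_Mapping.lookup p e) * mono_eval x e)"
  unfolding ev_def
proof (rule sum.mono_neutral_left[OF assms], rule ballI)
  fix e assume "e \<in> A - Poly_Mapping.keys p"
  then have "Poly_Mapping.lookup p e = 0" by (simp add: in_keys_iff)
  then show "hom (Poly_Mapping.lookup p e) * mono_eval x e = 0" by simp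
qed

lemma ev_single: "ev hom x (Poly_Mapping.single e c) = hom c * mono_eval x e"
  by (subst ev_superset[of "{e}"]) auto

lemma ev_add: "ev hom x (p + q) = ev hom x p + ev hom x q"
proof -
  let ?A = "Poly_Mapping.keys p \<union> Poly_Mapping.keys q"
  have "Poly_Mapping.keys (p + q) \<subseteq> ?A" by (rule keys_add)
  then show ?thesis
    by (simp add: ev_superset[of ?A] lookup_add hom_add sum.distrib algebra_simps)
qed

lemma ev_0: "ev hom x 0 = 0"
  by (simp add: ev_def)

lemma ev_sum: "ev hom x (\<Sum>a\<in>A. f a) = (\<Sum>a\<in>A. ev hom x (f a))"
  by (induction A rule: infinite_finite_induct) (simp_all add: ev_0 ev_add)

lemma ev_mult: "ev hom x (p * q) = ev hom x p * ev hom x q"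
proof -
  let ?s = "\<lambda>r e. Poly_Mapping.single e (Poly_Mapping.lookup r e)"
  have "p * q = (\<Sum>e\<in>Poly_Mapping.keys p. ?s p e) * (\<Sum>e\<in>Poly_Mapping.keys q. ?s q e)"
    using mpoly_eq_sum_monomials[of p] mpoly_eq_sum_monomials[of q] by simp
  also have "ev hom x \<dots> = (\<Sum>e\<in>Poly_Mapping.keys p. \<Sum>e'\<in>Poly_Mapping.keys q.
      ev hom x (?s p e) * ev hom x (?s q e'))"
    by (simp add: sum_product ev_sum mult_single ev_single mono_eval_add hom_mult mult_ac)
  also have "\<dots> = ev hom x p * ev hom x q"
    unfolding sum_product[symmetric] ev_single by (simp add: ev_def)
  finally show ?thesis .
qed

lemma ev_Const: "ev hom x (Const c) = hom c"
  by (simp add: Const_def ev_single)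

lemma ev_Var: "ev hom x (Var i) = x i"
  by (simp add: Var_def ev_single)

lemma comm_ring_hom_ev: "comm_ring_hom (ev hom x)"
  by unfold_locales
    (simp_all add: ev_add ev_mult ev_0 ev_Const[of x 1, unfolded Const_def, simplified])

end

lemma comm_ring_hom_id: "comm_ring_hom (\<lambda>c::'a::comm_ring_1. c)"
  by unfold_locales auto

lemma comm_ring_hom_Const: "comm_ring_hom (Const :: 'a::comm_ring_1 \<Rightarrow> _)"
  by unfold_locales (simp_all add: Const_def single_add mult_single)

global_interpretation Const: comm_ring_hom Const
  by (rule comm_ring_hom_Const)

section \<open>Subrings and the polynomials over them\<close>

definition subring_set :: "'a::comm_ring_1 set \<Rightarrow> bool" where
  "subring_set A \<longleftrightarrow> 1 \<in> A \<and> (\<forall>x\<in>A. \<forall>y\<in>A. x - y \<in> A \<and> x * y \<in> A)"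

lemma subring_setD:
  assumes "subring_set A"
  shows "1 \<in> A" "0 \<in> A" "x \<in> A \<Longrightarrow> y \<in> A \<Longrightarrow> x - y \<in> A" "x \<in> A \<Longrightarrow> y \<in> A \<Longrightarrow> x * y \<in> A"
    "x \<in> A \<Longrightarrow> - x \<in> A" "x \<in> A \<Longrightarrow> y \<in> A \<Longrightarrow> x + y \<in> A"
proof -
  show 1: "1 \<in> A" using assms by (simp add: subring_set_def)
  show d: "x - y \<in> A" if "x \<in> A" "y \<in> A" for x y
    using assms that by (auto simp: subring_set_def)
  show 0: "0 \<in> A" using d[OF 1 1] assms by (auto simp: subring_set_def)
  show m: "- x \<in> A" if "x \<in> A" for x using d[OF 0 that] by simp
  show "x * y \<in> A" if "x \<in> A" "y \<in> A" using assms that by (auto simp: subring_set_def)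
  show "x + y \<in> A" if "x \<in> A" "y \<in> A" for x y using d[OF that(1) m[OF that(2)]] by simp
qed

lemma subring_set_sum: "subring_set A \<Longrightarrow> (\<And>i. i \<in> I \<Longrightarrow> f i \<in> A) \<Longrightarrow> sum f I \<in> A"
  by (induction I rule: infinite_finite_induct) (auto intro: subring_setD)

lemma subring_set_prod: "subring_set A \<Longrightarrow> (\<And>i. i \<in> I \<Longrightarrow> f i \<in> A) \<Longrightarrow> prod f I \<in> A"
  by (induction I rule: infinite_finite_induct) (auto intro: subring_setD)

lemma subring_set_power: "subring_set A \<Longrightarrow> x \<in> A \<Longrightarrow> x ^ k \<in> A"
  by (induction k) (auto intro: subring_setD)

lemma subring_set_UNIV [simp]: "subring_set UNIV"
  by (simp add: subring_set_def)

lemma subring_set_range: "comm_ring_hom h \<Longrightarrow> subring_set (range h)"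
proof -
  assume "comm_ring_hom h"
  then interpret comm_ring_hom h .
  show ?thesis unfolding subring_set_def
    by (auto simp flip: hom_minus hom_mult hom_one)
qed

lemma single_in_mpolys:
  assumes "0 \<in> A" "c \<in> A" "Poly_Mapping.keys e \<subseteq> {..<n}"
  shows "Poly_Mapping.single e c \<in> mpolys A n"
  using assms by (auto simp: mpolys_def lookup_single when_def)

lemma subring_set_mpolys:
  assumes "subring_set A"
  shows "subring_set (mpolys A n)"
proof -
  note A = subring_setD[OF assms]
  have diff: "p - q \<in> mpolys A n" if "p \<in> mpolys A n" "q \<in> mpolys A n" for p q
  proof -
    have "\<forall>e\<in>Poly_Mapping.keys (p - q). Poly_Mapping.keys e \<subseteq> {..<n}"
      using that keys_diff[of p q] unfolding mpolys_def by blast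
    then show ?thesis using that unfolding mpolys_def by (simp add: lookup_minus A(3))
  qed
  have zero: "0 \<in> mpolys A n" using A by (simp add: mpolys_def)
  have add: "p + q \<in> mpolys A n" if "p \<in> mpolys A n" "q \<in> mpolys A n" for p q
  proof -
    have "\<forall>e\<in>Poly_Mapping.keys (p + q). Poly_Mapping.keys e \<subseteq> {..<n}"
      using that keys_add[of p q] unfolding mpolys_def by blast
    then show ?thesis using that unfolding mpolys_def by (simp add: lookup_add A(6))
  qed
  have sum: "sum f I \<in> mpolys A n" if "\<And>i. i \<in> I \<Longrightarrow> f i \<in> mpolys A n" for f and I :: "(nat \<Rightarrow>\<^sub>0 nat) set"
    using that by (induction I rule: infinite_finite_induct) (auto intro: add zero)
  have mult: "p * q \<in> mpolys A n" if p: "p \<in> mpolys A n" and q: "q \<in> mpolys A n" for p q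
  proof -
    let ?s = "\<lambda>r e. Poly_Mapping.single e (Poly_Mapping.lookup r e)"
    have "p * q = (\<Sum>e\<in>Poly_Mapping.keys p. ?s p e) * (\<Sum>e\<in>Poly_Mapping.keys q. ?s q e)"
      using mpoly_eq_sum_monomials[of p] mpoly_eq_sum_monomials[of q] by simp
    also have "\<dots> = (\<Sum>e\<in>Poly_Mapping.keys p. \<Sum>e'\<in>Poly_Mapping.keys q. ?s p e * ?s q e')"
      by (simp add: sum_product)
    also have "\<dots> \<in> mpolys A n"
    proof (intro sum)
      fix e e' assume e: "e \<in> Poly_Mapping.keys p" "e' \<in> Poly_Mapping.keys q"
      have "Poly_Mapping.keys (e + e') \<subseteq> {..<n}"
        using e p q keys_add[of e e'] by (fastforce simp: mpolys_def)
      moreover have "Poly_Mapping.lookup p e * Poly_Mapping.lookup q e' \<in> A"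
        using p q A by (simp add: mpolys_def)
      ultimately show "?s p e * ?s q e' \<in> mpolys A n"
        using A by (simp add: mult_single single_in_mpolys)
    qed
    finally show ?thesis .
  qed
  have "1 \<in> mpolys A n"
    using A single_in_mpolys[of A 1 0 n] by simp
  with diff mult show ?thesis by (simp add: subring_set_def)
qed

lemma Const_in_mpolys: "subring_set A \<Longrightarrow> c \<in> A \<Longrightarrow> Const c \<in> mpolys A n"
  unfolding Const_def by (rule single_in_mpolys) (auto intro: subring_setD)

lemma Var_in_mpolys: "subring_set A \<Longrightarrow> i < n \<Longrightarrow> Var i \<in> mpolys A n"
  unfolding Var_def by (rule single_in_mpolys) (auto intro: subring_setD)

lemma mpolys_mono: "A \<subseteq> B \<Longrightarrow> m \<le> n \<Longrightarrow> mpolys A m \<subseteq> mpolys B n"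
  by (fastforce simp: mpolys_def)

lemma mono_eval_Var: "mono_eval Var e = (Poly_Mapping.single e 1 :: 'a::comm_ring_1 mpoly)"
proof -
  have pow: "Poly_Mapping.single f 1 ^ k = (Poly_Mapping.single (\<Sum>_<k. f) 1 :: 'a mpoly)" for f k
    by (induction k) (simp_all add: mult_single add.commute del: sum_constant)
  have smult: "(\<Sum>_<k. Poly_Mapping.single i 1) = Poly_Mapping.single i (k::nat)" for i :: nat and k
    by (induction k) (simp_all add: add.commute flip: single_add del: sum_constant)
  have sprod: "(\<Prod>i\<in>I. Poly_Mapping.single (g i) (1::'a)) = Poly_Mapping.single (\<Sum>i\<in>I. g i) 1"
    for g :: "nat \<Rightarrow> nat \<Rightarrow>\<^sub>0 nat" and I
    by (induction I rule: infinite_finite_induct) (simp_all add: mult_single)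
  have "mono_eval Var e = (\<Prod>i\<in>Poly_Mapping.keys e.
      (Poly_Mapping.single (Poly_Mapping.single i (Poly_Mapping.lookup e i)) 1 :: 'a mpoly))"
    unfolding mono_eval_def Var_def pow smult ..
  also have "\<dots> = Poly_Mapping.single
      (\<Sum>i\<in>Poly_Mapping.keys e. Poly_Mapping.single i (Poly_Mapping.lookup e i)) 1"
    by (rule sprod)
  also have "(\<Sum>i\<in>Poly_Mapping.keys e. Poly_Mapping.single i (Poly_Mapping.lookup e i)) = e"
    by (rule poly_mapping_eqI) (simp add: lookup_sum lookup_single when_def sum.delta in_keys_iff)
  finally show ?thesis .
qed

text \<open>By \<open>mono_eval_Var\<close> every polynomial is a sum of products of constants and
  variables. Compatibility statements about evaluation thus reduce to generators, while the
  coefficient ring and the number of variables stay under control.\<close>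

lemma mpolys_induct [consumes 2, case_names Const Var add mult]:
  assumes p: "p \<in> mpolys A n" and A: "subring_set A"
    and C: "\<And>c. c \<in> A \<Longrightarrow> P (Const c)" and V: "\<And>i. i < n \<Longrightarrow> P (Var i)"
    and add: "\<And>p q. p \<in> mpolys A n \<Longrightarrow> q \<in> mpolys A n \<Longrightarrow> P p \<Longrightarrow> P q \<Longrightarrow> P (p + q)"
    and mult: "\<And>p q. p \<in> mpolys A n \<Longrightarrow> q \<in> mpolys A n \<Longrightarrow> P p \<Longrightarrow> P q \<Longrightarrow> P (p * q)"
  shows "P p"
proof -
  note ring = subring_set_mpolys[OF A, of n]
  let ?Q = "\<lambda>p. p \<in> mpolys A n \<and> P p"
  have QC: "?Q (Const c)" if "c \<in> A" for c using that C A by (simp add: Const_in_mpolys)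
  have QV: "?Q (Var i)" if "i < n" for i using that V A by (simp add: Var_in_mpolys)
  have Q0: "?Q 0" using QC[of 0] A by (simp add: subring_setD)
  have Q1: "?Q 1" using QC[of 1] A by (simp add: subring_setD)
  have Qadd: "?Q (p + q)" if "?Q p" "?Q q" for p q
    using that add ring by (auto intro: subring_setD)
  have Qmult: "?Q (p * q)" if "?Q p" "?Q q" for p q
    using that mult ring by (auto intro: subring_setD)
  have Qpow: "?Q (p ^ k)" if "?Q p" for p k
  proof (induction k)
    case (Suc k)
    show ?case using Qmult[OF that Suc] by simp
  qed (use Q1 in simp)
  have Qprod: "?Q (prod f I)" if "\<And>i. i \<in> I \<Longrightarrow> ?Q (f i)" for f and I :: "nat set"
    using that
  proof (induction I rule: infinite_finite_induct)
    case (insert i I)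
    then show ?case using Qmult[of "f i" "prod f I"] by simp
  qed (use Q1 in simp_all)
  have Qsum: "?Q (sum f I)" if "\<And>i. i \<in> I \<Longrightarrow> ?Q (f i)" for f and I :: "(nat \<Rightarrow>\<^sub>0 nat) set"
    using that
  proof (induction I rule: infinite_finite_induct)
    case (insert i I)
    then show ?case using Qadd[of "f i" "sum f I"] by simp
  qed (use Q0 in simp_all)
  have mono: "?Q (mono_eval Var e)" if "Poly_Mapping.keys e \<subseteq> {..<n}" for e
    unfolding mono_eval_def by (intro Qprod Qpow QV) (use that in auto)
  have "?Q (\<Sum>e\<in>Poly_Mapping.keys p. Poly_Mapping.single e (Poly_Mapping.lookup p e))"
  proof (rule Qsum)
    fix e assume "e \<in> Poly_Mapping.keys p"
    then have "?Q (Const (Poly_Mapping.lookup p e) * mono_eval Var e)"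
      using p by (intro Qmult QC mono) (auto simp: mpolys_def)
    then show "?Q (Poly_Mapping.single e (Poly_Mapping.lookup p e))"
      by (simp add: mono_eval_Var Const_def mult_single)
  qed
  then show ?thesis using mpoly_eq_sum_monomials[of p] by simp
qed

lemma ev_in_subring:
  assumes "comm_ring_hom h" "subring_set B" "subring_set A" "p \<in> mpolys A n"
    "\<And>c. c \<in> A \<Longrightarrow> h c \<in> B" "\<And>i. i < n \<Longrightarrow> x i \<in> B"
  shows "ev h x p \<in> B"
proof -
  interpret comm_ring_hom h by fact
  from assms(4,3) show ?thesis
    by (induction rule: mpolys_induct)
      (auto simp: ev_Const ev_Var ev_add ev_mult assms intro: subring_setD[OF assms(2)])
qed

lemma ev_cong:
  assumes "comm_ring_hom h" "p \<in> mpolys UNIV n" "\<And>i. i < n \<Longrightarrow> x i = y i"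
  shows "ev h x p = ev h y p"
proof -
  interpret comm_ring_hom h by fact
  from assms(2) subring_set_UNIV show ?thesis
    by (induction rule: mpolys_induct) (simp_all add: ev_Const ev_Var ev_add ev_mult assms(3))
qed

lemma hom_ev:
  assumes "comm_ring_hom h" "comm_ring_hom g" "p \<in> mpolys UNIV n"
  shows "g (ev h x p) = ev (\<lambda>c. g (h c)) (\<lambda>i. g (x i)) p"
proof -
  interpret h: comm_ring_hom h by fact
  interpret g: comm_ring_hom g by fact
  interpret gh: comm_ring_hom "\<lambda>c. g (h c)"
    by unfold_locales (simp_all add: h.hom_add h.hom_mult g.hom_add g.hom_mult)
  from assms(3) subring_set_UNIV show ?thesis
    by (induction rule: mpolys_induct)
      (simp_all add: h.ev_Const h.ev_Var h.ev_add h.ev_mult gh.ev_Const gh.ev_Var gh.ev_add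
        gh.ev_mult g.hom_add g.hom_mult)
qed

abbreviation msubst :: "(nat \<Rightarrow> 'a::comm_ring_1 mpoly) \<Rightarrow> 'a mpoly \<Rightarrow> 'a mpoly" where
  "msubst w \<equiv> ev Const w"

lemma ev_msubst:
  assumes "comm_ring_hom h" "p \<in> mpolys UNIV n"
  shows "ev h x (msubst w p) = ev h (\<lambda>i. ev h x (w i)) p"
proof -
  interpret comm_ring_hom h by fact
  show ?thesis
    using hom_ev[OF comm_ring_hom_Const comm_ring_hom_ev assms(2)] by (simp add: ev_Const)
qed

lemma msubst_in_mpolys:
  assumes "p \<in> mpolys UNIV n" "\<And>i. i < n \<Longrightarrow> w i \<in> mpolys UNIV m"
  shows "msubst w p \<in> mpolys UNIV m"
  by (rule ev_in_subring[OF comm_ring_hom_Const _ _ assms(1)])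
    (auto simp: assms subring_set_mpolys Const_in_mpolys)

lemma msubst_Var:
  assumes "p \<in> mpolys UNIV n"
  shows "msubst Var p = p"
  using assms subring_set_UNIV
  by (induction p rule: mpolys_induct)
    (auto simp: Const.ev_Const Const.ev_Var Const.ev_add Const.ev_mult)

section \<open>The ideal of the curve of root tuples\<close>

lemma generated_idealI:
  assumes "finite S" "S \<subseteq> F" "c ` S \<subseteq> mpolys UNIV n" "p = (\<Sum>f\<in>S. c f * f)"
  shows "p \<in> generated_ideal n F"
  unfolding generated_ideal_def
  by (rule CollectI, rule exI[of _ S], rule exI[of _ c]) (use assms in simp)

lemma generated_ideal_0: "0 \<in> generated_ideal n F"
  unfolding generated_ideal_def
  by (rule CollectI, rule exI[of _ "{}"], rule exI[of _ "\<lambda>_. 0"]) simp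

lemma generated_ideal_base: "f \<in> F \<Longrightarrow> f \<in> generated_ideal n F"
  unfolding generated_ideal_def
  by (rule CollectI, rule exI[of _ "{f}"], rule exI[of _ "\<lambda>_. 1"])
    (simp add: subring_setD subring_set_mpolys)

lemma generated_ideal_mult:
  assumes "a \<in> mpolys UNIV n" "p \<in> generated_ideal n F"
  shows "a * p \<in> generated_ideal n F"
proof -
  from assms(2) obtain S c where S: "finite S" "S \<subseteq> F" "c ` S \<subseteq> mpolys UNIV n"
    and p: "p = (\<Sum>f\<in>S. c f * f)" unfolding generated_ideal_def by blast
  have "a * p = (\<Sum>f\<in>S. (a * c f) * f)" by (simp add: p sum_distrib_left mult.assoc)
  moreover have "(\<lambda>f. a * c f) ` S \<subseteq> mpolys UNIV n"
    using S(3) assms(1) subring_setD(4)[OF subring_set_mpolys[OF subring_set_UNIV, of n]] by blast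
  ultimately show ?thesis using generated_idealI[OF S(1,2)] by blast
qed

lemma generated_ideal_add:
  assumes "p \<in> generated_ideal n F" "q \<in> generated_ideal n F"
  shows "p + q \<in> generated_ideal n F"
proof -
  note ring = subring_setD[OF subring_set_mpolys[OF subring_set_UNIV, of n]]
  from assms obtain S c T d where S: "finite S" "S \<subseteq> F" "c ` S \<subseteq> mpolys UNIV n"
    and p: "p = (\<Sum>f\<in>S. c f * f)"
    and T: "finite T" "T \<subseteq> F" "d ` T \<subseteq> mpolys UNIV n"
    and q: "q = (\<Sum>f\<in>T. d f * f)" unfolding generated_ideal_def by blast
  define e where "e f = (if f \<in> S then c f else 0) + (if f \<in> T then d f else 0)" for f
  have "p = (\<Sum>f\<in>S\<union>T. (if f \<in> S then c f else 0) * f)"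
    unfolding p by (rule sum.mono_neutral_cong_left) (use S T in auto)
  moreover have "q = (\<Sum>f\<in>S\<union>T. (if f \<in> T then d f else 0) * f)"
    unfolding q by (rule sum.mono_neutral_cong_left) (use S T in auto)
  ultimately have "p + q = (\<Sum>f\<in>S\<union>T. e f * f)"
    by (simp add: e_def sum.distrib distrib_right)
  moreover have "e ` (S \<union> T) \<subseteq> mpolys UNIV n"
  proof
    fix y assume "y \<in> e ` (S \<union> T)"
    then obtain f where y: "y = e f" by blast
    have "(if f \<in> S then c f else 0) \<in> mpolys UNIV n" using S(3) ring(2) by auto
    moreover have "(if f \<in> T then d f else 0) \<in> mpolys UNIV n" using T(3) ring(2) by auto
    ultimately show "y \<in> mpolys UNIV n" unfolding y e_def by (rule ring(6))
  qed
  ultimately show ?thesis using generated_idealI[of "S \<union> T" F e n] S T by blast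
qed

lemma generated_ideal_uminus: "p \<in> generated_ideal n F \<Longrightarrow> - p \<in> generated_ideal n F"
  using generated_ideal_mult[of "-1" n p F]
  by (simp add: subring_setD subring_set_mpolys)

lemma generated_ideal_diff:
  "p \<in> generated_ideal n F \<Longrightarrow> q \<in> generated_ideal n F \<Longrightarrow> p - q \<in> generated_ideal n F"
  using generated_ideal_add[of p n F "- q"] generated_ideal_uminus[of q n F] by simp

lemma generated_ideal_sum:
  "(\<And>i. i \<in> I \<Longrightarrow> f i \<in> generated_ideal n F) \<Longrightarrow> sum f I \<in> generated_ideal n F"
  by (induction I rule: infinite_finite_induct)
    (simp_all add: generated_ideal_0 generated_ideal_add)

lemma generated_ideal_induct [consumes 1, case_names zero add mult]:
  assumes "p \<in> generated_ideal n F" "P 0" "\<And>p q. P p \<Longrightarrow> P q \<Longrightarrow> P (p + q)"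
    "\<And>a f. a \<in> mpolys UNIV n \<Longrightarrow> f \<in> F \<Longrightarrow> P (a * f)"
  shows "P p"
proof -
  from assms(1) obtain S c where S: "finite S" "S \<subseteq> F" "c ` S \<subseteq> mpolys UNIV n"
    and p: "p = (\<Sum>f\<in>S. c f * f)" unfolding generated_ideal_def by blast
  from S show ?thesis unfolding p
    by (induction S rule: finite_induct) (auto intro!: assms(2,3,4))
qed

lemma ev_generated_ideal:
  assumes "comm_ring_hom h" "p \<in> generated_ideal n F" "\<And>f. f \<in> F \<Longrightarrow> ev h x f = 0"
  shows "ev h x p = 0"
proof -
  interpret comm_ring_hom h by fact
  from assms(2) show ?thesis
    by (induction rule: generated_ideal_induct) (simp_all add: ev_0 ev_add ev_mult assms(3))
qed

section \<open>Univariate polynomials with coefficients in a given set\<close>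

definition coeffs_in :: "'a::zero set \<Rightarrow> 'a poly \<Rightarrow> bool" where
  "coeffs_in A p \<longleftrightarrow> (\<forall>i. Polynomial.coeff p i \<in> A)"

lemma coeffs_in_pCons: "a \<in> A \<Longrightarrow> coeffs_in A p \<Longrightarrow> coeffs_in A (pCons a p)"
  by (auto simp: coeffs_in_def coeff_pCons split: nat.split)

lemma coeffs_in_pConsD: "coeffs_in A (pCons a p) \<Longrightarrow> a \<in> A \<and> coeffs_in A p"
  unfolding coeffs_in_def by (metis coeff_pCons_0 coeff_pCons_Suc)

lemma coeffs_in_mono: "A \<subseteq> B \<Longrightarrow> coeffs_in A p \<Longrightarrow> coeffs_in B p"
  by (auto simp: coeffs_in_def)

context
  fixes A :: "'a::comm_ring_1 set"
  assumes A: "subring_set A"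
begin

lemma coeffs_in_0: "coeffs_in A 0"
  using subring_setD[OF A] by (simp add: coeffs_in_def)

lemma coeffs_in_add: "coeffs_in A p \<Longrightarrow> coeffs_in A q \<Longrightarrow> coeffs_in A (p + q)"
  using subring_setD[OF A] by (simp add: coeffs_in_def)

lemma coeffs_in_diff: "coeffs_in A p \<Longrightarrow> coeffs_in A q \<Longrightarrow> coeffs_in A (p - q)"
  using subring_setD[OF A] by (simp add: coeffs_in_def)

lemma coeffs_in_smult: "a \<in> A \<Longrightarrow> coeffs_in A q \<Longrightarrow> coeffs_in A (Polynomial.smult a q)"
  using subring_setD[OF A] by (simp add: coeffs_in_def)

lemma coeffs_in_mult: "coeffs_in A p \<Longrightarrow> coeffs_in A q \<Longrightarrow> coeffs_in A (p * q)"
  using subring_setD[OF A] by (simp add: coeffs_in_def coeff_mult subring_set_sum[OF A])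

lemma coeffs_in_poly: "coeffs_in A p \<Longrightarrow> x \<in> A \<Longrightarrow> poly p x \<in> A"
  using subring_setD[OF A]
  by (simp add: poly_altdef coeffs_in_def subring_set_sum[OF A] subring_set_power[OF A])

lemma coeffs_in_synthetic_div:
  "coeffs_in A p \<Longrightarrow> x \<in> A \<Longrightarrow> coeffs_in A (synthetic_div p x)"
proof (induction p)
  case 0
  then show ?case by (simp add: coeffs_in_0)
next
  case (pCons a p)
  then have "coeffs_in A p" by (blast dest: coeffs_in_pConsD)
  with pCons show ?case by (simp add: coeffs_in_pCons coeffs_in_poly)
qed

text \<open>Because the leading coefficient is 1, long division never leaves the subring. In
  applications \<open>A\<close> is the ring of polynomials in the earlier variables, or a
  subfield.\<close>

lemma monic_division:
  assumes "coeffs_in A d" "lead_coeff d = 1" "Polynomial.degree d > 0" "coeffs_in A q"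
  shows "\<exists>s r. coeffs_in A s \<and> coeffs_in A r \<and> q = d * s + r \<and>
    Polynomial.degree r < Polynomial.degree d"
  using assms(4)
proof (induction q)
  case 0
  show ?case by (rule exI[of _ 0], rule exI[of _ 0]) (use assms(3) in \<open>simp add: coeffs_in_0\<close>)
next
  case (pCons a q)
  then have a: "a \<in> A" and q: "coeffs_in A q" by (auto dest: coeffs_in_pConsD)
  from pCons.IH[OF q] obtain s r where sr: "coeffs_in A s" "coeffs_in A r" "q = d * s + r"
    "Polynomial.degree r < Polynomial.degree d" by blast
  \<comment> \<open>Passing from \<open>q\<close> to \<open>pCons a q\<close> shifts the remainder
    up by one degree; \<open>c\<close> is the coefficient that may overflow into the degree of
    \<open>d\<close> and is cancelled against \<open>d\<close>.\<close>
  define c where "c = Polynomial.coeff (pCons a r) (Polynomial.degree d)"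
  define r' where "r' = pCons a r - Polynomial.smult c d"
  have t: "coeffs_in A (pCons a r)" using a sr by (simp add: coeffs_in_pCons)
  then have c: "c \<in> A" by (simp add: c_def coeffs_in_def)
  have "pCons a q = d * (pCons 0 s + [:c:]) + r'"
    by (simp add: r'_def sr(3) algebra_simps)
  moreover have "coeffs_in A (pCons 0 s + [:c:])"
    by (intro coeffs_in_add coeffs_in_pCons coeffs_in_0 sr c subring_setD(2)[OF A])
  moreover have "coeffs_in A r'"
    unfolding r'_def by (intro coeffs_in_diff coeffs_in_smult t c assms(1))
  moreover have "Polynomial.degree r' < Polynomial.degree d"
  proof -
    have "Polynomial.degree r' \<le> Polynomial.degree d"
      unfolding r'_def using sr(4)
      by (intro degree_diff_le) (auto simp: degree_pCons_eq_if intro: degree_smult_le)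
    moreover have "Polynomial.coeff r' (Polynomial.degree d) = 0"
      by (simp add: r'_def c_def assms(2))
    ultimately show ?thesis
      using assms(3) by (metis le_neq_implies_less leading_coeff_0_iff degree_0)
  qed
  ultimately show ?case by blast
qed

end

text \<open>Recursive view of the polynomial ring, with the last variable as the main one.\<close>

lemma mpolys_Suc_as_poly:
  assumes "g \<in> mpolys A (Suc j)" "subring_set A"
  shows "\<exists>q. coeffs_in (mpolys A j) q \<and> g = poly q (Var j)"
  using assms
proof (induction rule: mpolys_induct)
  case (Const c)
  then have "coeffs_in (mpolys A j) [:Const c:]"
    by (intro coeffs_in_pCons coeffs_in_0 subring_set_mpolys Const_in_mpolys assms)
  then show ?case by (intro exI[of _ "[:Const c:]"]) simp
next
  case (Var i)
  note ring = subring_setD[OF subring_set_mpolys[OF assms(2), of j]]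
  show ?case
  proof (cases "i = j")
    case True
    have "coeffs_in (mpolys A j) [:0, 1:]"
      by (intro coeffs_in_pCons coeffs_in_0 subring_set_mpolys ring assms)
    then show ?thesis using True by (intro exI[of _ "[:0, 1:]"]) simp
  next
    case False
    then have "coeffs_in (mpolys A j) [:Var i:]" using Var
      by (intro coeffs_in_pCons coeffs_in_0 subring_set_mpolys Var_in_mpolys assms) auto
    then show ?thesis by (intro exI[of _ "[:Var i:]"]) simp
  qed
next
  case (add p q)
  then show ?case using coeffs_in_add[OF subring_set_mpolys[OF assms(2)]] by (metis poly_add)
next
  case (mult p q)
  then show ?case using coeffs_in_mult[OF subring_set_mpolys[OF assms(2)]] by (metis poly_mult)
qed

section \<open>The trinomial ideal and normal forms modulo it\<close>

definition trinomial_relation :: "nat \<Rightarrow> 'a::comm_ring_1 mpoly poly" where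
  "trinomial_relation n = (\<Prod>i<n. [:- Var i, 1:]) - (Polynomial.monom 1 n - [:0, 1:])"

text \<open>The ideal of the curve of ordered root tuples of the trinomials \<open>X^n - X + b\<close>.\<close>

definition trinomial_ideal :: "nat \<Rightarrow> 'a::comm_ring_1 mpoly set" where
  "trinomial_ideal n = generated_ideal n (Polynomial.coeff (trinomial_relation n) ` {1..<n})"

lemma linear_prod:
  fixes a :: "'i \<Rightarrow> 'a::idom"
  assumes "finite I"
  shows "Polynomial.degree (\<Prod>i\<in>I. [:- a i, 1:]) = card I" "lead_coeff (\<Prod>i\<in>I. [:- a i, 1:]) = 1"
proof -
  have "Polynomial.degree (\<Prod>i\<in>I. [:- a i, 1:]) = card I \<and> lead_coeff (\<Prod>i\<in>I. [:- a i, 1:]) = 1"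
    using assms
  proof (induction I rule: finite_induct)
    case (insert i I)
    have ne: "(\<Prod>i\<in>I. [:- a i, 1:]) \<noteq> 0" using insert by auto
    have "Polynomial.degree ([:- a i, 1:] * (\<Prod>i\<in>I. [:- a i, 1:])) = Suc (card I)"
      using ne insert by (subst degree_mult_eq) auto
    moreover have "lead_coeff ([:- a i, 1:] * (\<Prod>i\<in>I. [:- a i, 1:])) = 1"
      using insert by (subst lead_coeff_mult) auto
    ultimately show ?case using insert by (simp del: mult_pCons_left)
  qed simp
  then show "Polynomial.degree (\<Prod>i\<in>I. [:- a i, 1:]) = card I" "lead_coeff (\<Prod>i\<in>I. [:- a i, 1:]) = 1"
    by auto
qed

text \<open>Coefficient 0 is left out because it is the free parameter \<open>b\<close>. From
  \<open>n\<close> on the coefficients vanish outright, since two monic polynomials of degree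
  \<open>n\<close> are subtracted.\<close>

lemma coeff_trinomial_relation:
  assumes "n \<ge> 2" "k \<ge> 1"
  shows "Polynomial.coeff (trinomial_relation n :: 'a::idom mpoly poly) k \<in> trinomial_ideal n"
proof (cases "k < n")
  case True
  then show ?thesis using assms by (auto simp: trinomial_ideal_def intro: generated_ideal_base)
next
  case False
  let ?P = "\<Prod>i<n. [:- Var i, 1:] :: 'a mpoly poly"
  note P = linear_prod[of "{..<n}" "Var :: nat \<Rightarrow> 'a mpoly", simplified]
  have "Polynomial.coeff ?P k = (if k = n then 1 else 0)"
    using P False by (auto intro: coeff_eq_0)
  then have "Polynomial.coeff (trinomial_relation n :: 'a mpoly poly) k = 0"
    using False assms by (auto simp: trinomial_relation_def coeff_pCons split: nat.split)
  then show ?thesis by (simp add: trinomial_ideal_def generated_ideal_0)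
qed

context
  fixes n :: nat and I :: "'a::idom mpoly set"
  assumes n: "n \<ge> 2"
  defines "I \<equiv> trinomial_ideal n"
begin

lemma trinomial_ideal_closed:
  "0 \<in> I" "p \<in> I \<Longrightarrow> q \<in> I \<Longrightarrow> p + q \<in> I" "p \<in> I \<Longrightarrow> - p \<in> I"
  "a \<in> mpolys UNIV n \<Longrightarrow> p \<in> I \<Longrightarrow> a * p \<in> I" "p \<in> I \<Longrightarrow> q \<in> I \<Longrightarrow> p - q \<in> I"
  "(\<And>i. i \<in> A \<Longrightarrow> f i \<in> I) \<Longrightarrow> sum f A \<in> I"
  unfolding I_def trinomial_ideal_def
  by (fact generated_ideal_0 generated_ideal_add generated_ideal_uminus generated_ideal_mult
    generated_ideal_diff generated_ideal_sum)+

text \<open>A monic linear factor is no zero divisor modulo the ideal: coefficient \<open>i\<close>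
  of \<open>p\<close> is determined by the product and by coefficient \<open>i + 1\<close> of
  \<open>p\<close>. The induction counts down from one above the degree.\<close>

lemma coeffs_in_ideal_cancel:
  assumes "coeffs_in I ([:- v, 1:] * p)" "v \<in> mpolys UNIV n"
  shows "coeffs_in I p"
proof -
  have step: "Polynomial.coeff p i \<in> I" if "Polynomial.coeff p (Suc i) \<in> I" for i
  proof -
    have "Polynomial.coeff p i = Polynomial.coeff ([:- v, 1:] * p) (Suc i) + v * Polynomial.coeff p (Suc i)"
      by (simp add: coeff_pCons)
    also have "\<dots> \<in> I"
    proof -
      have "Polynomial.coeff ([:- v, 1:] * p) (Suc i) \<in> I" using assms(1) by (simp only: coeffs_in_def)
      then show ?thesis
        using assms(2) that by (intro trinomial_ideal_closed)
    qed
    finally show ?thesis .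
  qed
  have top: "Polynomial.coeff p i \<in> I" if "i > Polynomial.degree p" for i
    using that by (simp add: coeff_eq_0 trinomial_ideal_closed)
  have "Polynomial.coeff p (Suc (Polynomial.degree p) - k) \<in> I" for k
  proof (induction k)
    case (Suc k)
    show ?case
    proof (cases "k \<le> Polynomial.degree p")
      case True
      then have "Suc (Suc (Polynomial.degree p) - Suc k) = Suc (Polynomial.degree p) - k" by simp
      then show ?thesis using step Suc by metis
    next
      case False
      then show ?thesis using Suc by simp
    qed
  qed (simp add: top)
  then have "Polynomial.coeff p i \<in> I" for i
    using top by (metis diff_diff_cancel le_Suc_eq not_less)
  then show ?thesis by (simp add: coeffs_in_def)
qed

lemma coeffs_in_ideal_poly:
  assumes "coeffs_in I p" "v \<in> mpolys UNIV n"
  shows "poly p v \<in> I"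
proof -
  note ring = subring_set_mpolys[OF subring_set_UNIV, of n]
  have "Polynomial.coeff p i * v ^ i \<in> I" for i
    using assms trinomial_ideal_closed(4)[of "v ^ i" "Polynomial.coeff p i"] subring_set_power[OF ring assms(2), of i]
    unfolding coeffs_in_def by (simp add: mult.commute)
  then show ?thesis
    unfolding poly_altdef by (intro trinomial_ideal_closed(6)) auto
qed

lemma coeffs_in_ideal_pCons: "a \<in> I \<Longrightarrow> coeffs_in I p \<Longrightarrow> coeffs_in I (pCons a p)"
  by (rule coeffs_in_pCons)

lemma coeffs_in_ideal_add: "coeffs_in I p \<Longrightarrow> coeffs_in I q \<Longrightarrow> coeffs_in I (p + q)"
  by (simp add: coeffs_in_def trinomial_ideal_closed)

lemma coeffs_in_ideal_0: "coeffs_in I 0"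
  by (simp add: coeffs_in_def trinomial_ideal_closed)

text \<open>\<open>D\<close> is the polynomial with the roots \<open>Var j\<close>, ...,
  \<open>Var (n - 1)\<close>, rewritten modulo the ideal in terms of the first \<open>j\<close>
  variables by dividing the trinomial successively by \<open>X - Var 0\<close>, ...,
  \<open>X - Var (j - 1)\<close>. The bound \<open>max 1 j\<close> is due to the constant term,
  which uses \<open>Var 0\<close> from the start.\<close>

lemma remaining_roots_poly:
  assumes "j \<le> n"
  shows "\<exists>D. coeffs_in (mpolys UNIV (max 1 j)) D \<and> Polynomial.degree D = n - j \<and> lead_coeff D = 1 \<and>
    coeffs_in I ((\<Prod>i\<in>{j..<n}. [:- Var i, 1:]) - D)"
  using assms
proof (induction j)
  case 0
  let ?P = "\<Prod>i<n. [:- Var i, 1:] :: 'a mpoly poly"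
  let ?v = "Var 0 :: 'a mpoly"
  let ?T = "Polynomial.monom 1 n - [:0, 1:] :: 'a mpoly poly"
  \<comment> \<open>The free constant term is eliminated here: as \<open>Var 0\<close> is a root
    modulo the ideal, \<open>b\<close> is congruent to \<open>Var 0 - Var 0 ^ n\<close>.\<close>
  define D where "D = ?T + [:- (?v ^ n - ?v):]"
  define t where "t = Polynomial.coeff (trinomial_relation n :: 'a mpoly poly) 0"
  note ring = subring_set_mpolys[OF subring_set_UNIV, where 'a = 'a and n = 1]
  note R = subring_setD[OF ring]
  have ringn: "subring_set (mpolys UNIV n)" by (simp add: subring_set_mpolys)
  have v: "?v \<in> mpolys UNIV 1" by (simp add: Var_in_mpolys)
  have v': "?v \<in> mpolys UNIV n" using n by (simp add: Var_in_mpolys)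
  have rel: "coeffs_in I (trinomial_relation n - [:t:])"
    unfolding coeffs_in_def
  proof
    fix i show "Polynomial.coeff (trinomial_relation n - [:t:]) i \<in> I"
    proof (cases i)
      case 0
      then show ?thesis by (simp add: t_def trinomial_ideal_closed)
    next
      case (Suc k)
      then show ?thesis using coeff_trinomial_relation[OF n, of i] by (simp add: I_def)
    qed
  qed
  have "poly ?P ?v = 0" using n by (simp add: poly_prod prod_zero_iff) (metis less_le_trans zero_less_numeral finite_lessThan lessThan_iff add.inverse_inverse)
  then have "poly (trinomial_relation n - [:t:]) ?v = - (?v ^ n - ?v) - t"
    by (simp add: trinomial_relation_def poly_monom)
  with coeffs_in_ideal_poly[OF rel v'] have "- (?v ^ n - ?v) - t \<in> I" by simp
  then have "- (- (?v ^ n - ?v) - t) \<in> I" by (rule trinomial_ideal_closed)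
  then have "(?v ^ n - ?v) + t \<in> I" by (simp add: algebra_simps)
  then have "coeffs_in I (trinomial_relation n - [:t:] + [:(?v ^ n - ?v) + t:])"
    by (intro coeffs_in_ideal_add rel coeffs_in_ideal_pCons coeffs_in_ideal_0)
  also have "trinomial_relation n - [:t:] + [:(?v ^ n - ?v) + t:] = ?P - D"
    by (simp add: trinomial_relation_def D_def)
  finally have 1: "coeffs_in I (?P - D)" .
  have 2: "coeffs_in (mpolys UNIV 1) D"
  proof -
    have "coeffs_in (mpolys UNIV 1) (Polynomial.monom 1 n :: 'a mpoly poly)"
      unfolding coeffs_in_def coeff_monom using R(1,2) by metis
    then show ?thesis unfolding D_def
      by (intro coeffs_in_add[OF ring] coeffs_in_diff[OF ring] coeffs_in_pCons coeffs_in_0[OF ring] R v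
        subring_set_power[OF ring])
  qed
  have co: "Polynomial.coeff D i = 0" if "i > n" for i
    using n that by (simp add: D_def coeff_pCons split: nat.split)
  have cn: "Polynomial.coeff D n = 1" using n by (simp add: D_def coeff_pCons split: nat.split)
  have "Polynomial.degree D = n"
    using co cn by (intro antisym degree_le le_degree) auto
  then show ?case using 1 2 cn by (intro exI[of _ D]) (simp add: lessThan_atLeast0)
next
  case (Suc j)
  then obtain D where D: "coeffs_in (mpolys UNIV (max 1 j)) D" "Polynomial.degree D = n - j"
    "lead_coeff D = 1" "coeffs_in I ((\<Prod>i\<in>{j..<n}. [:- Var i, 1:]) - D)" by auto
  let ?v = "Var j :: 'a mpoly"
  let ?P = "\<Prod>i\<in>{Suc j..<n}. [:- Var i, 1:] :: 'a mpoly poly"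
  define S where "S = synthetic_div D ?v"
  have v: "?v \<in> mpolys UNIV n" "?v \<in> mpolys UNIV (Suc j)" using Suc.prems by (auto simp: Var_in_mpolys)
  have split: "(\<Prod>i\<in>{j..<n}. [:- Var i, 1:]) = [:- ?v, 1:] * ?P"
    using Suc.prems by (simp add: prod.atLeast_Suc_lessThan del: mult_pCons_left)
  have DS: "D = [:- ?v, 1:] * S + [:poly D ?v:]"
    unfolding S_def by (rule synthetic_div_correct'[symmetric])
  have "poly ((\<Prod>i\<in>{j..<n}. [:- Var i, 1:]) - D) ?v \<in> I"
    by (rule coeffs_in_ideal_poly[OF D(4) v(1)])
  then have "- poly D ?v \<in> I" unfolding split by simp
  then have Dv: "poly D ?v \<in> I"
    using trinomial_ideal_closed(3) by fastforce
  have "coeffs_in I ((\<Prod>i\<in>{j..<n}. [:- Var i, 1:]) - D + [:poly D ?v:])"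
    by (intro coeffs_in_ideal_add D coeffs_in_ideal_pCons coeffs_in_ideal_0 Dv)
  also have "(\<Prod>i\<in>{j..<n}. [:- Var i, 1:]) - D + [:poly D ?v:] = [:- ?v, 1:] * (?P - S)"
  proof -
    have "a * p - d + c = a * (p - q)" if "d = a * q + c" for a p c d q :: "'a mpoly poly"
      using that by (simp add: algebra_simps)
    from this[OF DS] show ?thesis unfolding split .
  qed
  finally have 1: "coeffs_in I (?P - S)" by (rule coeffs_in_ideal_cancel) (rule v)
  have 2: "coeffs_in (mpolys UNIV (max 1 (Suc j))) S"
    unfolding S_def
    by (rule coeffs_in_synthetic_div[OF subring_set_mpolys[OF subring_set_UNIV]
      coeffs_in_mono[OF mpolys_mono D(1)]]) (use v in auto)
  have 3: "Polynomial.degree S = n - Suc j" by (simp add: S_def degree_synthetic_div D(2))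
  have S0: "S \<noteq> 0"
    using Suc.prems D(2) by (auto simp: S_def synthetic_div_eq_0_iff)
  have "lead_coeff S = 1"
  proof -
    have "Polynomial.coeff D (Suc (n - Suc j)) = Polynomial.coeff S (n - Suc j)"
      using S0 3 by (subst DS) (simp add: coeff_pCons coeff_eq_0 split: nat.split)
    then show ?thesis using D(2,3) 3 Suc.prems by (simp add: Suc_diff_Suc)
  qed
  with 1 2 3 show ?case by blast
qed

text \<open>Modulo the ideal, \<open>Var j\<close> is a root of the monic \<open>D\<close> of degree
  \<open>n - j\<close>, so division by \<open>D\<close> yields a normal form in \<open>Var j\<close>
  over the earlier variables.\<close>

lemma reduce_last_variable:
  assumes "1 \<le> j" "j < n" "g \<in> mpolys UNIV (Suc j)"
  shows "\<exists>r. coeffs_in (mpolys UNIV j) r \<and> Polynomial.degree r < n - j \<and> g - poly r (Var j) \<in> I"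
proof -
  let ?v = "Var j :: 'a mpoly"
  note ring = subring_set_mpolys[OF subring_set_UNIV, of j]
  have v: "?v \<in> mpolys UNIV n" using assms by (auto simp: Var_in_mpolys)
  obtain D where D: "coeffs_in (mpolys UNIV (max 1 j)) D" "Polynomial.degree D = n - j"
    "lead_coeff D = 1" "coeffs_in I ((\<Prod>i\<in>{j..<n}. [:- Var i, 1:]) - D)"
    using remaining_roots_poly[of j] assms by auto
  have D1: "coeffs_in (mpolys UNIV j) D" using D(1) assms by (simp add: max_def split: if_splits)
  have split: "(\<Prod>i\<in>{j..<n}. [:- Var i, 1:]) = [:- ?v, 1:] * (\<Prod>i\<in>{Suc j..<n}. [:- Var i, 1:])"
    using assms by (simp add: prod.atLeast_Suc_lessThan del: mult_pCons_left)
  have "poly ((\<Prod>i\<in>{j..<n}. [:- Var i, 1:]) - D) ?v \<in> I"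
    by (rule coeffs_in_ideal_poly[OF D(4) v])
  then have "- poly D ?v \<in> I" unfolding split by simp
  then have Dv: "poly D ?v \<in> I"
    using trinomial_ideal_closed(3) by fastforce
  obtain q where q: "coeffs_in (mpolys UNIV j) q" "g = poly q ?v"
    using mpolys_Suc_as_poly[OF assms(3)] by auto
  obtain s r where sr: "coeffs_in (mpolys UNIV j) s" "coeffs_in (mpolys UNIV j) r" "q = D * s + r"
    "Polynomial.degree r < Polynomial.degree D"
    using monic_division[OF ring D1 D(3) _ q(1)] D(2) assms by auto
  have "poly s ?v \<in> mpolys UNIV n"
    by (rule coeffs_in_poly[OF subring_set_mpolys[OF subring_set_UNIV] coeffs_in_mono[OF mpolys_mono sr(1)] v])
      (use assms in auto)
  then have "poly s ?v * poly D ?v \<in> I"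
    using Dv by (rule trinomial_ideal_closed)
  moreover have "g - poly r ?v = poly s ?v * poly D ?v" by (simp add: q(2) sr(3))
  ultimately show ?thesis using sr D(2) by auto
qed

end

text \<open>The same argument is applied to several sets \<open>P\<close>: root tuples in the field
  itself and conjugates of a power series point. What it takes is a domain, distinct coordinates,
  and closure under swaps, which keep the first \<open>j\<close> coordinates while coordinate
  \<open>j\<close> runs through \<open>n - j\<close> values.\<close>

locale trinomial_points = comm_ring_hom h for h :: "'a::idom \<Rightarrow> 'b::idom" +
  fixes n :: nat and P :: "(nat \<Rightarrow> 'b) set"
  assumes n: "n \<ge> 2"
    and kills: "\<And>x g. x \<in> P \<Longrightarrow> g \<in> trinomial_ideal n \<Longrightarrow> ev h x g = 0"
    and distinct: "\<And>x. x \<in> P \<Longrightarrow> inj_on x {..<n}"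
    and swap: "\<And>x i j. x \<in> P \<Longrightarrow> i < n \<Longrightarrow> j < n \<Longrightarrow> x \<circ> transpose i j \<in> P"
begin

lemma ev_diff: "ev h x (p - q) = ev h x p - ev h x q"
proof -
  interpret e: comm_ring_hom "ev h x" by (rule comm_ring_hom_ev)
  show ?thesis by (rule e.hom_minus)
qed

text \<open>The \<open>n - j\<close> points obtained by swapping coordinate \<open>j\<close> with a later one
  are too many zeros for the reduced form of \<open>g\<close>, a polynomial in the \<open>j\<close>-th variable of
  degree below \<open>n - j\<close>.\<close>

lemma coeffs_of_constant_on_fibre:
  assumes j: "1 \<le> j" "j < n" and x: "x \<in> P"
    and r: "coeffs_in (mpolys UNIV j) r" "Polynomial.degree r < n - j"
      "g - poly r (Var j) \<in> trinomial_ideal n"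
    and g: "\<And>l. l \<in> {j..<n} \<Longrightarrow> ev h (x \<circ> transpose j l) g = c"
  shows "ev h x (Polynomial.coeff r i) = (if i = 0 then c else 0)"
proof -
  interpret e: comm_ring_hom "ev h x" by (rule comm_ring_hom_ev)
  define R where "R = map_poly (ev h x) r"
  have R: "poly R (x l) = c" if l: "l \<in> {j..<n}" for l
  proof -
    let ?x = "x \<circ> transpose j l"
    interpret e': comm_ring_hom "ev h ?x" by (rule comm_ring_hom_ev)
    have xP: "?x \<in> P" using swap[OF x] l j by simp
    have "ev h ?x (poly r (Var j)) = c"
      using kills[OF xP r(3)] g[OF l] by (simp add: ev_diff)
    moreover have "ev h ?x (poly r (Var j)) = poly (map_poly (ev h ?x) r) (x l)"
      by (subst e'.poly_map_poly[symmetric]) (simp add: ev_Var)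
    \<comment> \<open>The swap does not touch the first \<open>j\<close> coordinates, so the
      coefficients of \<open>r\<close> evaluate to the same \<open>R\<close> for every
      \<open>l\<close>.\<close>
    moreover have "map_poly (ev h ?x) r = R"
      unfolding R_def
    proof (rule map_poly_cong, rule ev_cong[OF comm_ring_hom_axioms])
      fix a assume "a \<in> set (Polynomial.coeffs r)"
      then show "a \<in> mpolys UNIV j" using r(1) by (auto simp: coeffs_in_def Polynomial.coeffs_def split: if_splits)
      fix i assume "i < j"
      then show "?x i = x i" using l by (simp add: transpose_apply_other)
    qed
    ultimately show ?thesis by simp
  qed
  have "R = [:c:]"
  proof (rule poly_eqI_degree[of "x ` {j..<n}"])
    have "inj_on x {j..<n}" using distinct[OF x] by (rule inj_on_subset) auto
    then have card: "card (x ` {j..<n}) = n - j" by (simp add: card_image)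
    show "card (x ` {j..<n}) > Polynomial.degree R"
      unfolding card R_def using r(2) degree_map_poly_le[of "ev h x" r] by simp
    show "card (x ` {j..<n}) > Polynomial.degree [:c:]" unfolding card using j by simp
  qed (use R in auto)
  then have "Polynomial.coeff R i = (if i = 0 then c else 0)"
    by (simp add: coeff_pCons split: nat.split)
  then show ?thesis by (simp add: R_def)
qed

text \<open>Induction on the number of variables: if \<open>g\<close> vanishes on \<open>P\<close>,
  so do the coefficients of its normal form, which involve one variable fewer. Only the one-variable
  case depends on the choice of \<open>P\<close>.\<close>

lemma vanishing_imp_in_ideal:
  assumes base: "\<And>g. g \<in> mpolys UNIV 1 \<Longrightarrow> (\<And>x. x \<in> P \<Longrightarrow> ev h x g = 0) \<Longrightarrow> g = 0"
    and g: "g \<in> mpolys UNIV n" "\<And>x. x \<in> P \<Longrightarrow> ev h x g = 0"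
  shows "g \<in> trinomial_ideal n"
proof -
  note closed = trinomial_ideal_closed[OF n]
  have "\<forall>g. g \<in> mpolys UNIV j \<longrightarrow> (\<forall>x\<in>P. ev h x g = 0) \<longrightarrow> g \<in> trinomial_ideal n"
    if "1 \<le> j" "j \<le> n" for j
    using that
  proof (induction j rule: dec_induct)
    case base
    then show ?case using assms(1) closed(1) by metis
  next
    case (step j)
    show ?case
    proof (intro allI impI)
      fix g assume g: "g \<in> mpolys UNIV (Suc j)" "\<forall>x\<in>P. ev h x g = 0"
      have j: "1 \<le> j" "j < n" using step by auto
      obtain r where r: "coeffs_in (mpolys UNIV j) r" "Polynomial.degree r < n - j"
        "g - poly r (Var j) \<in> trinomial_ideal n"
        using reduce_last_variable[OF n j g(1)] by blast
      have "ev h x (Polynomial.coeff r i) = 0" if x: "x \<in> P" for x i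
      proof -
        have "ev h (x \<circ> transpose j l) g = 0" if "l \<in> {j..<n}" for l
          using g(2) swap[OF x] j that by simp
        from coeffs_of_constant_on_fibre[OF j x r this] show ?thesis by simp
      qed
      then have "coeffs_in (trinomial_ideal n) r"
        using step r(1) by (simp add: coeffs_in_def)
      then have "poly r (Var j) \<in> trinomial_ideal n"
        by (rule coeffs_in_ideal_poly[OF n]) (simp add: Var_in_mpolys j)
      from closed(2)[OF r(3) this] show "g \<in> trinomial_ideal n" by simp
    qed
  qed
  from this[of n] n g show ?thesis by auto
qed

text \<open>Variables are removed from the top. Invariance makes the normal form constant along each
  fibre, so its constant coefficient can replace it; this stops at index 2, where the invariance
  ends.\<close>

lemma invariant_eq_polynomial_in_two:
  assumes N: "N \<in> mpolys UNIV n"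
    and inv: "\<And>x i l. x \<in> P \<Longrightarrow> 2 \<le> i \<Longrightarrow> i < n \<Longrightarrow> 2 \<le> l \<Longrightarrow> l < n \<Longrightarrow>
      ev h (x \<circ> transpose i l) N = ev h x N"
  shows "\<exists>q\<in>mpolys UNIV 2. \<forall>x\<in>P. ev h x q = ev h x N"
proof -
  have "\<exists>q\<in>mpolys UNIV j. \<forall>x\<in>P. ev h x q = ev h x N" if "2 \<le> j" "j \<le> n" for j
    using that(2,1)
  proof (induction j rule: inc_induct)
    case base
    then show ?case using N by auto
  next
    case (step j)
    then obtain q where q: "q \<in> mpolys UNIV (Suc j)" "\<forall>x\<in>P. ev h x q = ev h x N" by auto
    have j: "1 \<le> j" "j < n" using step by auto
    obtain r where r: "coeffs_in (mpolys UNIV j) r" "Polynomial.degree r < n - j"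
      "q - poly r (Var j) \<in> trinomial_ideal n"
      using reduce_last_variable[OF n j q(1)] by blast
    have "ev h x (Polynomial.coeff r 0) = ev h x N" if x: "x \<in> P" for x
    proof -
      have "ev h (x \<circ> transpose j l) q = ev h x N" if "l \<in> {j..<n}" for l
        using q(2) swap[OF x] j that inv[OF x] step by simp
      from coeffs_of_constant_on_fibre[OF j x r this] show ?thesis by simp
    qed
    moreover have "Polynomial.coeff r 0 \<in> mpolys UNIV j" using r(1) by (simp add: coeffs_in_def)
    ultimately show ?case by blast
  qed
  from this[of 2] n show ?thesis by auto
qed

end

lemma ev_trinomial_ideal:
  assumes "comm_ring_hom h" and rel: "(\<Prod>i<n. [:- x i, 1:]) = Polynomial.monom 1 n - [:0, 1:] + [:t:]"
    and g: "g \<in> trinomial_ideal n"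
  shows "ev h x g = 0"
proof -
  interpret comm_ring_hom h by fact
  interpret e: comm_ring_hom "ev h x" by (rule comm_ring_hom_ev)
  interpret m: map_poly_comm_ring_hom "ev h x" ..
  have "map_poly (ev h x) (trinomial_relation n) = [:t:]"
    using rel by (simp add: trinomial_relation_def m.hom_minus m.hom_prod ev_Var e.hom_uminus map_poly_monom map_poly_pCons)
  then have "ev h x (Polynomial.coeff (trinomial_relation n) k) = 0" if "k \<ge> 1" for k
    using that by (metis coeff_map_poly e.hom_zero coeff_pCons_Suc not_one_le_zero not0_implies_Suc coeff_0)
  then show ?thesis
    using ev_generated_ideal[OF assms(1) g[unfolded trinomial_ideal_def], of x] by force
qed

section \<open>Power series parametrization at a critical value\<close>

no_notation vec_index (infixl "$" 100)

lemma trinomial_poly: "poly (Polynomial.monom 1 n - [:0, 1:] + [:t:]) x = x ^ n - x + (t::'a::comm_ring_1)"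
  by (simp add: poly_monom)

lemma linear_prod_dvd:
  fixes p :: "'a::idom poly"
  assumes "finite R" "\<And>r. r \<in> R \<Longrightarrow> poly p r = 0"
  shows "(\<Prod>r\<in>R. [:- r, 1:]) dvd p"
  using assms
proof (induction R arbitrary: p rule: finite_induct)
  case (insert r R)
  obtain q where q: "p = [:- r, 1:] * q"
    using insert.prems by (metis insertI1 poly_eq_0_iff_dvd dvdE)
  have "poly q s = 0" if "s \<in> R" for s
  proof -
    have "poly p s = 0" "s \<noteq> r" using insert that by auto
    then show ?thesis unfolding q by simp
  qed
  then have "(\<Prod>r\<in>R. [:- r, 1:]) dvd q" by (rule insert.IH)
  then show ?case using insert.hyps unfolding q by (simp del: mult_pCons_left)
qed simp

lemma degree_trinomial:
  assumes "n \<ge> 2"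
  shows "Polynomial.degree (Polynomial.monom 1 n - [:0, 1:] + [:t:] :: 'a::comm_ring_1 poly) = n"
    "lead_coeff (Polynomial.monom 1 n - [:0, 1:] + [:t:] :: 'a::comm_ring_1 poly) = 1"
proof -
  let ?p = "Polynomial.monom 1 n - [:0, 1:] + [:t:] :: 'a poly"
  have co: "Polynomial.coeff ?p i = 0" if "i > n" for i
    using assms that by (simp add: coeff_pCons split: nat.split)
  have cn: "Polynomial.coeff ?p n = 1" using assms by (simp add: coeff_pCons split: nat.split)
  show deg: "Polynomial.degree ?p = n"
    using co cn by (intro antisym degree_le le_degree) auto
  then show "lead_coeff ?p = 1" using cn by simp
qed

lemma pderiv_trinomial:
  "poly (pderiv (Polynomial.monom 1 n - [:0, 1:] + [:t:])) x = of_nat n * x ^ (n - 1) - (1::'a::idom)"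
  by (simp add: pderiv_diff pderiv_add pderiv_monom poly_monom pderiv_pCons)

lemma poly_pderiv_square:
  fixes s :: "'a::idom poly"
  shows "poly (pderiv ([:- a, 1:] * [:- a, 1:] * s)) a = 0"
  by (simp add: pderiv_mult pderiv_pCons del: mult_pCons_left mult_pCons_right)

lemma split_into_distinct_linear_factors:
  fixes f :: "'a::alg_closed_field poly"
  assumes "lead_coeff f = 1" "\<And>a. \<not> [:- a, 1:] * [:- a, 1:] dvd f"
  shows "\<exists>x. inj_on x {..<Polynomial.degree f} \<and> f = (\<Prod>i<Polynomial.degree f. [:- x i, 1:])"
  using assms
proof (induction "Polynomial.degree f" arbitrary: f)
  case 0
  have d: "Polynomial.degree f = 0" using 0(1) by (rule sym)
  then have "f = 1" using monic_degree_0[OF 0(2)] by blast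
  then show ?case using d by simp
next
  case (Suc m)
  obtain a where "poly f a = 0" using alg_closed_imp_poly_has_root[of f] Suc by auto
  then obtain g where g: "f = [:- a, 1:] * g" by (metis poly_eq_0_iff_dvd dvdE)
  have g0: "g \<noteq> 0" using Suc g by auto
  have m: "m = Polynomial.degree g"
    using Suc.hyps(2) g0 unfolding g by (simp add: degree_mult_eq del: mult_pCons_left)
  have lg: "lead_coeff g = 1"
    using Suc.prems(1) unfolding g by (simp add: lead_coeff_mult del: mult_pCons_left)
  have sq: "\<not> [:- u, 1:] * [:- u, 1:] dvd g" for u
    using Suc.prems(2)[of u] unfolding g by (meson dvd_mult)
  obtain x where x: "inj_on x {..<m}" "g = (\<Prod>i<m. [:- x i, 1:])"
    using Suc.hyps(1)[OF m lg sq, folded m] by blast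
  have ga: "poly g a \<noteq> 0"
  proof
    assume "poly g a = 0"
    then have "[:- a, 1:] dvd g" by (simp only: poly_eq_0_iff_dvd)
    then have "[:- a, 1:] * [:- a, 1:] dvd f" unfolding g by (rule mult_dvd_mono[OF dvd_refl])
    then show False using Suc.prems(2) by blast
  qed
  have ax: "x i \<noteq> a" if "i < m" for i
    using ga that unfolding x(2) by (auto simp: poly_prod)
  have "inj_on (x(m := a)) {..<Suc m}"
    unfolding lessThan_Suc inj_on_insert
    using x(1) ax by (auto simp: inj_on_def)
  moreover have "f = (\<Prod>i<Suc m. [:- (x(m := a)) i, 1:])"
    unfolding g x(2) by (simp add: lessThan_Suc del: mult_pCons_left)
  ultimately show ?case using Suc.hyps(2) by metis
qed

text \<open>At a critical value the trinomial has exactly one double root: if \<open>n * w^(n - 1) = 1\<close>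
  then \<open>w - w^n = w * (n - 1) / n\<close> determines \<open>w\<close>.\<close>

lemma critical_trinomial:
  fixes w :: "'a::alg_closed_field"
  assumes n: "n \<ge> 2" and char: "of_nat n \<noteq> (0::'a)" "of_nat (n - 1) \<noteq> (0::'a)"
    and w: "of_nat n * w ^ (n - 1) = 1"
  obtains z where "inj_on z {2..<n}" "\<And>i. i \<in> {2..<n} \<Longrightarrow> z i \<noteq> w \<and> z i \<noteq> 0 \<and>
      (z i) ^ n - z i + (w - w ^ n) = 0 \<and> of_nat n * z i ^ (n - 1) \<noteq> 1"
    "Polynomial.monom 1 n - [:0, 1:] + [:w - w ^ n:] =
      [:- w, 1:] * [:- w, 1:] * (\<Prod>i\<in>{2..<n}. [:- z i, 1:])"
proof -
  define f where "f = Polynomial.monom 1 n - [:0, 1:] + [:w - w ^ n:]"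
  note deg = degree_trinomial[OF n, of "w - w ^ n", folded f_def]
  have w0: "w \<noteq> 0" using w n by (cases "n - 1") auto
  have pow: "u ^ n = u ^ (n - 1) * u" for u :: 'a
    using n by (metis Suc_diff_1 power_Suc2 less_le_trans zero_less_numeral)
  have n1: "of_nat n = 1 + (of_nat (n - 1) :: 'a)" using n by (metis of_nat_Suc Suc_diff_1 less_le_trans zero_less_numeral)
  have uniq: "u = w" if "poly f u = 0" "poly (pderiv f) u = 0" for u
  proof -
    have d: "of_nat n * u ^ (n - 1) = 1" using that(2) by (simp add: f_def pderiv_trinomial)
    have "of_nat n * poly f u = (of_nat n * u ^ (n - 1)) * u - of_nat n * u + of_nat n * w
        - (of_nat n * w ^ (n - 1)) * w"
      by (simp add: f_def poly_monom pow algebra_simps)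
    then have "0 = of_nat (n - 1) * (w - u)"
      unfolding d w that(1) by (simp add: n1 algebra_simps)
    then show ?thesis using char by simp
  qed
  have "poly f w = 0" by (simp add: f_def poly_monom)
  then obtain q where q: "f = [:- w, 1:] * q" by (metis poly_eq_0_iff_dvd dvdE)
  have "poly (pderiv f) w = 0" using w by (simp add: f_def pderiv_trinomial)
  moreover have "poly (pderiv f) w = poly q w"
    unfolding q by (simp add: pderiv_mult pderiv_pCons del: mult_pCons_left)
  ultimately obtain s where s: "q = [:- w, 1:] * s" by (metis poly_eq_0_iff_dvd dvdE)
  have fs: "f = [:- w, 1:] * [:- w, 1:] * s" using q s by (simp only: mult.assoc)
  have s0: "s \<noteq> 0" using deg n fs by auto
  have degs: "Polynomial.degree s = n - 2"
  proof -
    have "Polynomial.degree f = 2 + Polynomial.degree s"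
      unfolding fs using s0 by (subst degree_mult_eq) (auto simp: degree_mult_eq simp del: mult_pCons_left)
    then show ?thesis using deg by simp
  qed
  have lcs: "lead_coeff s = 1"
    using deg(2) unfolding fs by (simp add: lead_coeff_mult del: mult_pCons_left)
  \<comment> \<open>A triple root would be a zero of the second derivative
    \<open>n * (n - 1) * X^(n - 2)\<close>.\<close>
  have sw: "poly s w \<noteq> 0"
  proof
    assume "poly s w = 0"
    then obtain v where "s = [:- w, 1:] * v" by (metis poly_eq_0_iff_dvd dvdE)
    then have "f = [:- w, 1:] * [:- w, 1:] * ([:- w, 1:] * v)" using fs by simp
    then have "poly (pderiv (pderiv f)) w = 0"
      by (simp add: pderiv_mult pderiv_pCons pderiv_add del: mult_pCons_left mult_pCons_right)
    moreover have "pderiv (pderiv f) = Polynomial.monom (of_nat (n - 1) * of_nat n) (n - 2)"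
      using n by (simp add: f_def pderiv_diff pderiv_add pderiv_monom pderiv_pCons numeral_2_eq_2)
    ultimately have "of_nat (n - 1) * of_nat n * w ^ (n - 2) = 0" by (simp add: poly_monom)
    then show False using char w0 by simp
  qed
  have sq: "\<not> [:- x, 1:] * [:- x, 1:] dvd s" for x
  proof
    assume "[:- x, 1:] * [:- x, 1:] dvd s"
    then obtain v where s': "s = [:- x, 1:] * [:- x, 1:] * v" by (elim dvdE)
    then have f': "f = [:- x, 1:] * [:- x, 1:] * ([:- w, 1:] * [:- w, 1:] * v)"
      using fs by (simp only: mult_ac)
    have "poly f x = 0" unfolding f' by simp
    moreover have "poly (pderiv f) x = 0" unfolding f' by (rule poly_pderiv_square)
    ultimately have "x = w" by (rule uniq)
    then show False using sw s' by simp
  qed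
  obtain e where e: "inj_on e {..<n - 2}" "s = (\<Prod>i<n - 2. [:- e i, 1:])"
    using split_into_distinct_linear_factors[OF lcs sq] unfolding degs by blast
  define z where "z = (\<lambda>i. e (i - 2))"
  have b: "bij_betw (\<lambda>i. i - 2) {2..<n} {..<n - 2}"
    by (rule bij_betw_byWitness[where f' = "\<lambda>i. i + 2"]) auto
  have z: "inj_on z {2..<n}"
    using comp_inj_on[OF bij_betw_imp_inj_on[OF b]] e(1) bij_betw_imp_surj_on[OF b]
    by (simp add: z_def comp_def)
  have sz: "s = (\<Prod>i\<in>{2..<n}. [:- z i, 1:])"
    unfolding e(2) z_def by (rule prod.reindex_bij_betw[OF b, symmetric])
  show ?thesis
  proof
    show "inj_on z {2..<n}" by (rule z)
    show "Polynomial.monom 1 n - [:0, 1:] + [:w - w ^ n:] =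
      [:- w, 1:] * [:- w, 1:] * (\<Prod>i\<in>{2..<n}. [:- z i, 1:])"
      using fs unfolding f_def sz .
    fix i assume i: "i \<in> {2..<n}"
    have r: "poly s (z i) = 0" unfolding sz using i by (auto simp: poly_prod)
    then have ne: "z i \<noteq> w" using sw by auto
    have fz: "poly f (z i) = 0" unfolding fs using r by simp
    have dz: "poly (pderiv f) (z i) \<noteq> 0" using uniq fz ne by blast
    \<comment> \<open>A root 0 would force \<open>w = w^n\<close>, hence \<open>n * w = w\<close>,
      against \<open>n - 1 \<noteq> 0\<close>. Nonzero roots become units as power series, so that
      ratios of roots make sense.\<close>
    have "z i \<noteq> 0"
    proof
      assume "z i = 0"
      then have "w - w ^ n = 0" using fz n by (simp add: f_def poly_monom power_0_left)
      then have "of_nat n * w - (of_nat n * w ^ (n - 1)) * w = 0"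
        by (simp add: pow mult.assoc flip: right_diff_distrib)
      then have "of_nat (n - 1) * w = 0" unfolding w by (simp add: n1 algebra_simps)
      then show False using char w0 by simp
    qed
    with ne fz dz show "z i \<noteq> w \<and> z i \<noteq> 0 \<and>
      (z i) ^ n - z i + (w - w ^ n) = 0 \<and> of_nat n * z i ^ (n - 1) \<noteq> 1"
      by (simp add: f_def pderiv_trinomial poly_monom)
  qed
qed

section \<open>Roots in the ring of power series\<close>

lemma comm_ring_hom_fps_nth_0: "comm_ring_hom (\<lambda>a::'a::comm_ring_1 fps. a $ 0)"
  by unfold_locales auto

lemma comm_ring_hom_fps_const: "comm_ring_hom (fps_const :: 'a::comm_ring_1 \<Rightarrow> 'a fps)"
  by unfold_locales auto

lemma comm_ring_hom_fps_compose: "c $ 0 = 0 \<Longrightarrow> comm_ring_hom (\<lambda>a::'a::idom fps. a oo c)"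
  by unfold_locales (auto simp: fps_compose_add_distrib fps_compose_mult_distrib)

text \<open>Hensel lifting by inversion under composition: the increment \<open>d\<close> over
  \<open>u\<close> has to solve \<open>F oo d = T $ 0 - T\<close>, and \<open>F\<close> has no
  constant term and a nonzero linear one because the root is simple.\<close>

lemma simple_root_lifts_to_fps:
  fixes u :: "'a::field"
  assumes root: "u ^ n - u + T $ 0 = 0" and simple: "of_nat n * u ^ (n - 1) \<noteq> 1"
  obtains y where "y $ 0 = u" "y ^ n - y + T = 0"
proof -
  define F where "F = (fps_const u + fps_X) ^ n - (fps_const u + fps_X) + fps_const (T $ 0)"
  define d where "d = fps_inv F oo (fps_const (T $ 0) - T)"
  have F0: "F $ 0 = 0" using root by (simp add: F_def fps_power_zeroth)
  have F1: "F $ 1 \<noteq> 0" using simple by (simp add: F_def fps_power_first del: One_nat_def)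
  have t0: "(fps_const (T $ 0) - T) $ 0 = 0" by simp
  have i0: "fps_inv F $ 0 = 0" by (simp add: fps_inv_def)
  have d0: "d $ 0 = 0" by (simp add: d_def i0)
  have "F oo d = (F oo fps_inv F) oo (fps_const (T $ 0) - T)"
    unfolding d_def by (rule fps_compose_assoc[OF t0 i0])
  then have "F oo d = fps_const (T $ 0) - T"
    using fps_inv_right[OF F0 F1] t0 by simp
  moreover have "F oo d = (fps_const u + d) ^ n - (fps_const u + d) + fps_const (T $ 0)"
    using d0 by (simp add: F_def fps_compose_add_distrib fps_compose_sub_distrib fps_compose_power[symmetric])
  ultimately have "(fps_const u + d) ^ n - (fps_const u + d) + fps_const (T $ 0) = fps_const (T $ 0) - T"
    by simp
  moreover have "a + b = 0" if "a + c = c - b" for a b c :: "'a fps"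
    using arg_cong[OF that, of "\<lambda>x. x - c"] by simp
  ultimately have "(fps_const u + d) ^ n - (fps_const u + d) + T = 0" by blast
  moreover have "(fps_const u + d) $ 0 = u" using d0 by simp
  ultimately show ?thesis using that by blast
qed

text \<open>The roots of \<open>X^n - X + T\<close> around a critical value, in the local parameter \<open>y 0 - w\<close>
  where \<open>w\<close> is the double root. Composition with \<open>y 1 - w\<close> is the inertia automorphism: it
  swaps the two roots that collide.\<close>

lemma fps_root_tuple:
  assumes n: "n \<ge> 2"
    and char: "of_nat n \<noteq> (0::'a::alg_closed_field)" "of_nat (n - 1) \<noteq> (0::'a::alg_closed_field)"
  obtains y :: "nat \<Rightarrow> 'a::alg_closed_field fps" and T c where
    "(\<Prod>i<n. [:- y i, 1:]) = Polynomial.monom 1 n - [:0, 1:] + [:T:]"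
    "inj_on y {..<n}" "y 0 $ 0 = y 1 $ 0" "\<And>i. i < n \<Longrightarrow> y i $ 0 \<noteq> 0" "\<And>a. y 0 \<noteq> fps_const a"
    "c $ 0 = 0" "y 0 oo c = y 1" "y 1 oo c = y 0" "\<And>i. i \<in> {2..<n} \<Longrightarrow> y i oo c = y i"
proof -
  obtain w :: 'a where w: "w ^ (n - 1) = 1 / of_nat n"
    using nth_root_exists[of "n - 1" "1 / of_nat n"] n by auto
  then have w: "of_nat n * w ^ (n - 1) = 1" using char by simp
  have w0: "w \<noteq> 0" using w n by (cases "n - 1") auto
  obtain z where z: "inj_on z {2..<n}" "\<And>i. i \<in> {2..<n} \<Longrightarrow> z i \<noteq> w \<and> z i \<noteq> 0 \<and>
      (z i) ^ n - z i + (w - w ^ n) = 0 \<and> of_nat n * z i ^ (n - 1) \<noteq> 1"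
    "Polynomial.monom 1 n - [:0, 1:] + [:w - w ^ n:] =
      [:- w, 1:] * [:- w, 1:] * (\<Prod>i\<in>{2..<n}. [:- z i, 1:])"
    using critical_trinomial[OF n char w] by blast
  \<comment> \<open>The double root itself is the parameter, and \<open>T\<close> is chosen to fit
    it. \<open>T\<close> would be no parameter: at a critical point its linear coefficient
    \<open>1 - n * w^(n - 1)\<close> vanishes.\<close>
  define y0 where "y0 = fps_const w + fps_X"
  define T where "T = y0 - y0 ^ n"
  define f where "f = Polynomial.monom 1 n - [:0, 1:] + [:T:]"
  have T0: "T $ 0 = w - w ^ n" by (simp add: T_def y0_def fps_power_zeroth)
  have "\<forall>i\<in>{2..<n}. \<exists>a. a $ 0 = z i \<and> a ^ n - a + T = 0"
    using simple_root_lifts_to_fps[of _ n T] z(2) T0 by metis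
  then obtain v where v: "\<And>i. i \<in> {2..<n} \<Longrightarrow> v i $ 0 = z i \<and> v i ^ n - v i + T = 0"
    by metis
  have vinj: "inj_on v {2..<n}" using z(1) v by (metis inj_on_def)
  have y0v: "y0 \<noteq> v i" if "i \<in> {2..<n}" for i
  proof
    assume "y0 = v i"
    then have "y0 $ 0 = v i $ 0" by simp
    then show False using v[OF that] z(2)[OF that] by (simp add: y0_def)
  qed
  let ?W = "\<Prod>i\<in>{2..<n}. [:- v i, 1:]"
  have "(\<Prod>r\<in>insert y0 (v ` {2..<n}). [:- r, 1:]) dvd f"
    by (rule linear_prod_dvd) (auto simp: f_def poly_monom v, simp add: T_def)
  moreover have "y0 \<notin> v ` {2..<n}" using y0v by blast
  then have "(\<Prod>r\<in>insert y0 (v ` {2..<n}). [:- r, 1:]) = [:- y0, 1:] * ?W"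
    using vinj by (simp add: prod.reindex del: mult_pCons_left)
  ultimately obtain s where s: "f = [:- y0, 1:] * ?W * s" by (metis dvdE)
  note deg = degree_trinomial[OF n, of T, folded f_def]
  note W = linear_prod[of "{2..<n}" v, simplified]
  have W0: "?W \<noteq> 0" using W(2) by auto
  have s0: "s \<noteq> 0" using s deg n by auto
  have "n = 1 + (n - 2) + Polynomial.degree s"
    using deg(1) unfolding s using s0 W0 W(1)
    by (simp add: degree_mult_eq del: mult_pCons_left)
  then have ds: "Polynomial.degree s = 1" using n by simp
  have ls: "lead_coeff s = 1" using deg(2) W(2) unfolding s
    by (simp add: lead_coeff_mult del: mult_pCons_left)
  \<comment> \<open>Lifting is impossible at the double root. The second root over \<open>w\<close>
    is read off from the linear cofactor that remains after dividing out all the others.\<close>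
  define y1 where "y1 = - Polynomial.coeff s 0"
  have s1: "s = [:- y1, 1:]"
    using ds ls by (intro poly_eqI) (auto simp: y1_def coeff_pCons coeff_eq_0 split: nat.split)
  define y where "y = (\<lambda>i. if i = 0 then y0 else if i = 1 then y1 else v i)"
  have split: "{..<n} = insert 0 (insert 1 {2..<n})" using n by auto
  have prodsplit: "(\<Prod>i<n. g i) = g 0 * (g 1 * (\<Prod>i\<in>{2..<n}. g i))" for g :: "nat \<Rightarrow> 'b::comm_monoid_mult"
    unfolding split by simp
  have yW: "(\<Prod>i\<in>{2..<n}. [:- y i, 1:]) = ?W" by (rule prod.cong) (auto simp: y_def)
  have prod: "(\<Prod>i<n. [:- y i, 1:]) = f"
    unfolding prodsplit yW using s s1 by (simp add: y_def mult_ac del: mult_pCons_left mult_pCons_right)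
  interpret e: comm_ring_hom "\<lambda>a::'a fps. a $ 0" by (rule comm_ring_hom_fps_nth_0)
  interpret me: map_poly_comm_ring_hom "\<lambda>a::'a fps. a $ 0" ..
  \<comment> \<open>On constant terms the factors of \<open>f\<close> have to match those at the
    critical value, and only \<open>w\<close> is left for \<open>y1\<close>.\<close>
  have y10: "y1 $ 0 = w"
  proof -
    have "map_poly (\<lambda>a. a $ 0) f = Polynomial.monom 1 n - [:0, 1:] + [:w - w ^ n:]"
      by (simp add: f_def me.hom_add me.hom_minus map_poly_monom e.map_poly_pCons_hom T0)
    moreover have "map_poly (\<lambda>a. a $ 0) ?W = (\<Prod>i\<in>{2..<n}. [:- z i, 1:])"
      by (simp add: me.hom_prod e.map_poly_pCons_hom v)
    moreover have "map_poly (\<lambda>a. a $ 0) f = [:- w, 1:] * map_poly (\<lambda>a. a $ 0) ?W * [:- (y1 $ 0), 1:]"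
      unfolding s s1 by (simp add: me.hom_mult e.map_poly_pCons_hom y0_def del: mult_pCons_left mult_pCons_right)
    ultimately have "[:- w, 1:] * ((\<Prod>i\<in>{2..<n}. [:- z i, 1:]) * [:- w, 1:]) =
        [:- w, 1:] * ((\<Prod>i\<in>{2..<n}. [:- z i, 1:]) * [:- (y1 $ 0), 1:])"
      using z(3) by (simp only: mult_ac)
    moreover have "(\<Prod>i\<in>{2..<n}. [:- z i, 1:]) \<noteq> 0" by simp
    ultimately show ?thesis by (simp only: mult_cancel_left) simp
  qed
  \<comment> \<open>A double root \<open>y0\<close> would satisfy \<open>n * y0^(n - 1) = 1\<close>,
    but the linear coefficient of the left side is \<open>n * (n - 1) * w^(n - 2)\<close>, which is
    not zero.\<close>
  have y01: "y0 \<noteq> y1"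
  proof
    assume "y0 = y1"
    then have "f = [:- y0, 1:] * [:- y0, 1:] * ?W" using s s1 by (simp only: mult_ac)
    then have "poly (pderiv f) y0 = 0" by (simp only: poly_pderiv_square)
    then have "of_nat n * y0 ^ (n - 1) = 1" by (simp add: f_def pderiv_trinomial)
    then have "(fps_const (of_nat n) * y0 ^ (n - 1)) $ 1 = (1 :: 'a fps) $ 1" by (simp add: fps_of_nat)
    then have "of_nat n * (of_nat (n - 1) * w ^ (n - 1 - 1)) = 0"
      by (simp add: fps_power_first y0_def del: One_nat_def) 
    then show False using char w0 by simp
  qed
  have yinj: "inj_on y {..<n}"
    using y01 y0v vinj v z(2) y10 unfolding split y_def
    by (auto simp: inj_on_def) (metis z(2) atLeastLessThan_iff)+
  define c where "c = y1 - fps_const w"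
  have c0: "c $ 0 = 0" by (simp add: c_def y10)
  interpret C: comm_ring_hom "\<lambda>a::'a fps. a oo c" by (rule comm_ring_hom_fps_compose[OF c0])
  interpret mC: map_poly_comm_ring_hom "\<lambda>a::'a fps. a oo c" ..
  have c_y0: "y0 oo c = y1" using c0 by (simp add: y0_def fps_compose_add_distrib) (simp add: c_def)
  have fr: "poly f (y i) = 0" if "i < n" for i
    unfolding prod[symmetric] using that by (auto simp: poly_prod)
  \<comment> \<open>\<open>T\<close> is the same expression in \<open>y1\<close> as in
    \<open>y0\<close>, so composition with \<open>c\<close> fixes \<open>T\<close> and therefore
    maps roots of \<open>f\<close> to roots of \<open>f\<close>.\<close>
  have "y1 ^ n - y1 + T = 0" using fr[of 1] n by (simp add: f_def poly_monom y_def)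
  from minus_unique[OF this] have "T = y1 - y1 ^ n" by simp
  moreover have "T oo c = y1 - y1 ^ n"
    unfolding T_def fps_compose_sub_distrib fps_compose_power[OF c0, symmetric] c_y0 ..
  ultimately have T1: "T oo c = T" by simp
  have Cf: "map_poly (\<lambda>a. a oo c) f = f"
    by (simp add: f_def mC.hom_add mC.hom_minus map_poly_monom C.map_poly_pCons_hom T1)
  \<comment> \<open>The image is again a root and keeps the constant term \<open>z i\<close>, which
    no other root shares.\<close>
  have c_v: "v i oo c = v i" if i: "i \<in> {2..<n}" for i
  proof -
    have "poly f (v i oo c) = (poly f (v i)) oo c"
      using C.poly_map_poly[of f "v i"] Cf by simp
    also have "\<dots> = 0" using v[OF i] by (simp add: f_def poly_monom)
    finally have "poly (\<Prod>i<n. [:- y i, 1:]) (v i oo c) = 0" by (simp add: prod)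
    then obtain l where l: "l < n" "v i oo c = y l" by (auto simp: poly_prod)
    then have "y l $ 0 = z i" using v[OF i] by (metis fps_compose_nth_0)
    then have l2: "l \<in> {2..<n}" "v l $ 0 = z i"
      using z(2)[OF i] l(1) y10 by (auto simp: y_def y0_def split: if_splits)
    then have "z l = z i" using v by metis
    then have "l = i" using z(1) i l2 by (auto dest: inj_onD)
    then show ?thesis using l l2 by (auto simp: y_def)
  qed
  \<comment> \<open>Composition fixes \<open>f\<close> and the factors of the \<open>v i\<close> and
    sends the factor of \<open>y0\<close> to that of \<open>y1\<close>; cancelling these leaves the
    factor of \<open>y0\<close> as the image of that of \<open>y1\<close>.\<close>
  have c_y1: "y1 oo c = y0"
  proof -
    have "map_poly (\<lambda>a. a oo c) f = [:- y1, 1:] * ?W * [:- (y1 oo c), 1:]"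
    proof -
      have "map_poly (\<lambda>a. a oo c) ?W = ?W" by (simp add: mC.hom_prod C.map_poly_pCons_hom fps_compose_uminus c_v)
      then show ?thesis unfolding s s1
        by (simp add: mC.hom_mult C.map_poly_pCons_hom c_y0 fps_compose_uminus del: mult_pCons_left mult_pCons_right)
    qed
    then have "([:- y1, 1:] * ?W) * [:- (y1 oo c), 1:] = ([:- y1, 1:] * ?W) * [:- y0, 1:]"
      using Cf s s1 by (simp only: mult_ac)
    moreover have "[:- y1, 1:] * ?W \<noteq> 0" using W0 unfolding mult_eq_0_iff by simp
    ultimately show ?thesis by (simp only: mult_cancel_left) simp
  qed
  show ?thesis
  proof
    show "(\<Prod>i<n. [:- y i, 1:]) = Polynomial.monom 1 n - [:0, 1:] + [:T:]"
      using prod by (simp add: f_def)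
    show "y 0 $ 0 = y 1 $ 0" using y10 by (simp add: y_def y0_def)
    show "y i $ 0 \<noteq> 0" if "i < n" for i
      using y10 w0 v[of i] z(2)[of i] that by (auto simp: y_def y0_def)
    show "y 0 \<noteq> fps_const a" for a
    proof
      assume "y 0 = fps_const a"
      then have "y 0 $ 1 = fps_const a $ 1" by simp
      then show False by (simp add: y_def y0_def)
    qed
    show "y 0 oo c = y 1" "y 1 oo c = y 0" using c_y0 c_y1 by (simp_all add: y_def)
    show "y i oo c = y i" if "i \<in> {2..<n}" for i using c_v[OF that] that by (simp add: y_def)
  qed (rule yinj c0)+
qed

section \<open>Points over an algebraically closed field and radicality\<close>

lemma infinite_UNIV_alg_closed: "infinite (UNIV :: 'a::alg_closed_field set)"
proof
  assume fin: "finite (UNIV :: 'a set)"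
  define p where "p = (\<Prod>a\<in>(UNIV::'a set). [:- a, 1:]) + 1"
  have "Polynomial.degree (\<Prod>a\<in>(UNIV::'a set). [:- a, 1:]) > 0"
    using linear_prod(1)[OF fin, of "\<lambda>a. a"] fin by (simp add: card_gt_0_iff)
  then have "Polynomial.degree p > 0" unfolding p_def by (subst degree_add_eq_left) auto
  then obtain x where "poly p x = 0" using alg_closed_imp_poly_has_root by blast
  moreover have "poly p x = 1" using fin by (simp add: p_def poly_prod prod_zero_iff)
  ultimately show False by simp
qed

text \<open>\<open>r\<close> depends neither on \<open>h\<close> nor on the point, so vanishing at
  points over a larger ring is read off from a single univariate polynomial over the coefficient
  ring.\<close>

lemma mpolys_1_as_poly:
  fixes g :: "'a::comm_ring_1 mpoly"
  assumes g: "g \<in> mpolys UNIV 1"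
  obtains r where "r = 0 \<Longrightarrow> g = 0"
    "\<And>(h :: 'a \<Rightarrow> 'b::comm_ring_1) x. comm_ring_hom h \<Longrightarrow> ev h x g = poly (map_poly h r) (x 0)"
proof -
  obtain q where q: "coeffs_in (mpolys UNIV 0) q" "g = poly q (Var 0)"
    using mpolys_Suc_as_poly[of g UNIV 0] g by auto
  have c: "\<exists>c. p = Const c" if "p \<in> mpolys UNIV 0" for p :: "'a mpoly"
    using that subring_set_UNIV
  proof (induction rule: mpolys_induct)
    case (add p q)
    then show ?case by (metis Const.hom_add)
  next
    case (mult p q)
    then show ?case by (metis Const.hom_mult)
  qed auto
  define r where "r = map_poly (\<lambda>p. Poly_Mapping.lookup p 0) q"
  have co: "Polynomial.coeff q k = Const (Polynomial.coeff r k)" for k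
  proof -
    have "Polynomial.coeff q k \<in> mpolys UNIV 0" using q(1) by (simp add: coeffs_in_def)
    from c[OF this] obtain d where "Polynomial.coeff q k = Const d" ..
    then show ?thesis by (simp add: r_def coeff_map_poly) (simp add: Const_def)
  qed
  have ev: "ev h x g = poly (map_poly h r) (x 0)" if "comm_ring_hom h" for h :: "'a \<Rightarrow> 'b" and x
  proof -
    interpret comm_ring_hom h by (rule that)
    interpret e: comm_ring_hom "ev h x" by (rule comm_ring_hom_ev)
    have "map_poly (ev h x) q = map_poly h r"
      by (rule poly_eqI) (simp add: coeff_map_poly co ev_Const ev_0)
    then show ?thesis
      unfolding q(2) by (subst e.poly_map_poly[symmetric]) (simp add: ev_Var)
  qed
  have "g = 0" if "r = 0"
    using co that q(2) by (metis coeff_0 Const.hom_zero poly_0 poly_eqI)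
  then show ?thesis using that ev by blast
qed

text \<open>A double root \<open>u\<close> satisfies \<open>n * b = (n - 1) * u\<close> and
  \<open>n * u^(n - 1) = 1\<close>. Eliminating \<open>u\<close> gives the equality that is
  excluded; the difference of its two sides is, up to sign, the discriminant of
  \<open>X^n - X + b\<close>.\<close>

lemma trinomial_squarefree:
  fixes b :: "'a::idom"
  assumes n: "n \<ge> 2" and b: "of_nat n ^ n * b ^ (n - 1) \<noteq> of_nat (n - 1) ^ (n - 1)"
  shows "\<not> [:- u, 1:] * [:- u, 1:] dvd Polynomial.monom 1 n - [:0, 1:] + [:b:]"
proof
  define f where "f = Polynomial.monom 1 n - [:0, 1:] + [:b:]"
  assume "[:- u, 1:] * [:- u, 1:] dvd Polynomial.monom 1 n - [:0, 1:] + [:b:]"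
  then obtain v where f': "f = [:- u, 1:] * [:- u, 1:] * v" unfolding f_def by (elim dvdE)
  have pow: "u ^ n = u ^ (n - 1) * u" "of_nat n ^ n = of_nat n ^ (n - 1) * (of_nat n :: 'a)"
    using n by (metis Suc_diff_1 power_Suc2 less_le_trans zero_less_numeral)+
  have n1: "of_nat n = 1 + (of_nat (n - 1) :: 'a)" using n by (metis of_nat_Suc Suc_diff_1 less_le_trans zero_less_numeral)
  have "poly f u = 0" unfolding f' by simp
  then have fu: "b = u - u ^ (n - 1) * u" by (simp add: f_def poly_monom pow algebra_simps eq_neg_iff_add_eq_0)
  have "poly (pderiv f) u = 0" unfolding f' by (rule poly_pderiv_square)
  then have d: "of_nat n * u ^ (n - 1) = 1" by (simp add: f_def pderiv_trinomial)
  have "of_nat n * b = of_nat n * u - (of_nat n * u ^ (n - 1)) * u"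
    unfolding fu by (simp add: algebra_simps)
  also have "\<dots> = of_nat (n - 1) * u" unfolding d by (simp add: n1 algebra_simps)
  finally have nb: "of_nat n * b = of_nat (n - 1) * u" .
  have "of_nat n ^ n * b ^ (n - 1) = of_nat n * (of_nat n * b) ^ (n - 1)"
    using n by (simp add: pow power_mult_distrib mult_ac)
  also have "\<dots> = of_nat (n - 1) ^ (n - 1) * (of_nat n * u ^ (n - 1))"
    unfolding nb by (simp add: power_mult_distrib mult_ac)
  finally show False using b unfolding d by simp
qed

lemma distinct_trinomial_roots:
  fixes a b :: "'a::alg_closed_field"
  assumes n: "n \<ge> 2" and root: "a ^ n - a + b = 0"
    and b: "of_nat n ^ n * b ^ (n - 1) \<noteq> of_nat (n - 1) ^ (n - 1)"
  obtains x where "x 0 = a" "inj_on x {..<n}"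
    "(\<Prod>i<n. [:- x i, 1:]) = Polynomial.monom 1 n - [:0, 1:] + [:b:]"
proof -
  define f where "f = Polynomial.monom 1 n - [:0, 1:] + [:b:]"
  note deg = degree_trinomial[OF n, of b, folded f_def]
  note sq = trinomial_squarefree[OF n b, folded f_def]
  obtain x where x: "inj_on x {..<n}" "f = (\<Prod>i<n. [:- x i, 1:])"
    using split_into_distinct_linear_factors[OF deg(2) sq] unfolding deg(1) by blast
  have "poly f a = 0" using root by (simp add: f_def poly_monom)
  then obtain l where l: "l < n" "x l = a" unfolding x(2) by (auto simp: poly_prod)
  have bij: "transpose 0 l permutes {..<n}" using l n by (intro permutes_swap_id) auto
  show ?thesis
  proof (rule that[of "x \<circ> transpose 0 l"])
    show "(x \<circ> transpose 0 l) 0 = a" using l by simp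
    show "inj_on (x \<circ> transpose 0 l) {..<n}"
      using x(1) permutes_inj_on[OF bij] permutes_image[OF bij] by (intro comp_inj_on) auto
    show "(\<Prod>i<n. [:- (x \<circ> transpose 0 l) i, 1:]) = Polynomial.monom 1 n - [:0, 1:] + [:b:]"
      using prod.permute[OF bij, of "\<lambda>i. [:- x i, 1:]"] x(2) unfolding f_def comp_def by simp
  qed
qed

lemma finite_exceptional:
  fixes c d :: "'a::idom"
  assumes "m > 0" "c \<noteq> 0"
  shows "finite {b. c * b ^ m = d}"
proof -
  have "Polynomial.coeff (Polynomial.monom c m - [:d:]) m \<noteq> 0"
    using assms by (cases m) simp_all
  then have "Polynomial.monom c m - [:d:] \<noteq> 0" by (metis coeff_0)
  then have "finite {b. poly (Polynomial.monom c m - [:d:]) b = 0}" by (rule poly_roots_finite)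
  then show ?thesis by (simp add: poly_monom)
qed

text \<open>Repeated roots are allowed, which makes this the full zero set of a system of equations
  (\<open>root_tuples_iff\<close>). Coordinates from \<open>n\<close> on are unconstrained.\<close>

definition root_tuples :: "nat \<Rightarrow> (nat \<Rightarrow> 'a::comm_ring_1) set" where
  "root_tuples n = {x. \<exists>b. (\<Prod>i<n. [:- x i, 1:]) = Polynomial.monom 1 n - [:0, 1:] + [:b:]}"

lemma root_tuples_comp:
  assumes "x \<in> root_tuples n" "p permutes {..<n}"
  shows "x \<circ> p \<in> root_tuples n"
  using assms(1) prod.permute[OF assms(2), of "\<lambda>i. [:- x i, 1:]"]
  by (simp add: root_tuples_def comp_def)

text \<open>Supplies the radicality that a variety over the base field requires. Tuples with
  distinct entries suffice: the discriminant excludes finitely many \<open>b\<close>, so their first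
  coordinate takes infinitely many values, which settles the one-variable case.\<close>

lemma vanishing_on_root_tuples:
  fixes g :: "'a::alg_closed_field mpoly"
  assumes n: "n \<ge> 2" and char: "of_nat n \<noteq> (0::'a)"
    and g: "g \<in> mpolys UNIV n" "\<And>x. x \<in> root_tuples n \<Longrightarrow> ev (\<lambda>c. c) x g = 0"
  shows "g \<in> trinomial_ideal n"
proof -
  let ?P = "{x :: nat \<Rightarrow> 'a. x \<in> root_tuples n \<and> inj_on x {..<n}}"
  have points: "trinomial_points (\<lambda>c::'a. c) n ?P"
  proof (intro trinomial_points.intro trinomial_points_axioms.intro comm_ring_hom_id n)
    fix x and g :: "'a mpoly" assume x: "x \<in> ?P" and g: "g \<in> trinomial_ideal n"
    from x obtain b where "(\<Prod>i<n. [:- x i, 1:]) = Polynomial.monom 1 n - [:0, 1:] + [:b:]"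
      unfolding root_tuples_def by blast
    from ev_trinomial_ideal[OF comm_ring_hom_id this g] show "ev (\<lambda>c::'a. c) x g = 0" .
  next
    fix x :: "nat \<Rightarrow> 'a" assume "x \<in> ?P"
    then show "inj_on x {..<n}" by blast
  next
    fix x :: "nat \<Rightarrow> 'a" and i j assume x: "x \<in> ?P" and ij: "i < n" "j < n"
    have p: "transpose i j permutes {..<n}" using ij by (intro permutes_swap_id) auto
    have "inj_on (x \<circ> transpose i j) {..<n}"
      using x permutes_inj_on[OF p, of "{..<n}"] permutes_image[OF p] by (intro comp_inj_on) simp_all
    then show "x \<circ> transpose i j \<in> ?P" using x root_tuples_comp[OF _ p] by blast
  qed
  let ?bad = "{b::'a. of_nat n ^ n * b ^ (n - 1) = of_nat (n - 1) ^ (n - 1)}"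
  have fin: "finite ?bad" using n char by (intro finite_exceptional) auto
  have "finite {a::'a. a - a ^ n \<in> ?bad}"
  proof -
    have "{a::'a. a - a ^ n \<in> ?bad} \<subseteq> (\<Union>b\<in>?bad. {a. poly (Polynomial.monom 1 n - [:0, 1:] + [:b:]) a = 0})"
      by (auto simp: poly_monom)
    moreover have "finite {a::'a. poly (Polynomial.monom 1 n - [:0, 1:] + [:b:]) a = 0}" for b
      using degree_trinomial[OF n, of b] n by (intro poly_roots_finite) auto
    ultimately show ?thesis using fin by (meson finite_UN_I finite_subset)
  qed
  then have inf: "infinite {a::'a. a - a ^ n \<notin> ?bad}"
  proof -
    have "UNIV = {a::'a. a - a ^ n \<in> ?bad} \<union> {a. a - a ^ n \<notin> ?bad}" by blast
    then show ?thesis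
      using infinite_UNIV_alg_closed[where 'a = 'a] \<open>finite {a::'a. a - a ^ n \<in> ?bad}\<close>
      by (metis (lifting) finite_Un)
  qed
  show ?thesis
  proof (rule trinomial_points.vanishing_imp_in_ideal[OF points _ g(1)])
    fix r :: "'a mpoly" assume r: "r \<in> mpolys UNIV 1" "\<And>x. x \<in> ?P \<Longrightarrow> ev (\<lambda>c. c) x r = 0"
    obtain q where q: "q = 0 \<Longrightarrow> r = 0"
      "\<And>(h :: 'a \<Rightarrow> 'a) x. comm_ring_hom h \<Longrightarrow> ev h x r = poly (map_poly h q) (x 0)"
      using mpolys_1_as_poly[OF r(1)] by blast
    have "poly q a = 0" if a: "a \<in> {a::'a. a - a ^ n \<notin> ?bad}" for a
    proof -
      obtain x where x: "x 0 = a" "inj_on x {..<n}"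
        "(\<Prod>i<n. [:- x i, 1:]) = Polynomial.monom 1 n - [:0, 1:] + [:a - a ^ n:]"
      proof (rule distinct_trinomial_roots[OF n])
        show "a ^ n - a + (a - a ^ n) = 0" by simp
        show "of_nat n ^ n * (a - a ^ n) ^ (n - 1) \<noteq> of_nat (n - 1) ^ (n - 1)" using a by blast
      qed
      then have "ev (\<lambda>c. c) x r = 0" by (intro r(2)) (unfold root_tuples_def, blast)
      then show ?thesis using q(2)[OF comm_ring_hom_id, of x] x(1) by (simp add: map_poly_idI)
    qed
    then have "{a::'a. a - a ^ n \<notin> ?bad} \<subseteq> {a. poly q a = 0}" by blast
    then have "q = 0" using inf poly_roots_finite[of q] finite_subset by blast
    then show "r = 0" using q(1) by simp
  qed (use g in auto)
qed

text \<open>Over an algebraically closed field \<open>q\<close> splits into linear factors, and none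
  of the \<open>v - fps_const a\<close> is zero in the domain of power series.\<close>

lemma fps_transcendental:
  fixes v :: "'a::alg_closed_field fps"
  assumes v: "\<And>a. v \<noteq> fps_const a" and "poly (map_poly fps_const q) v = 0"
  shows "q = 0"
  using assms(2)
proof (induction "Polynomial.degree q" arbitrary: q rule: less_induct)
  case less
  interpret comm_ring_hom "fps_const :: 'a \<Rightarrow> _" by (rule comm_ring_hom_fps_const)
  interpret m: map_poly_comm_ring_hom "fps_const :: 'a \<Rightarrow> _" ..
  show ?case
  proof (cases "Polynomial.degree q = 0")
    case True
    then obtain d where "q = [:d:]" by (metis degree_0_id)
    then show ?thesis using less.prems by (simp add: map_poly_pCons_hom)
  next
    case False
    then obtain a where "poly q a = 0" using alg_closed_imp_poly_has_root[of q] by auto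
    then obtain s where s: "q = [:- a, 1:] * s" by (metis poly_eq_0_iff_dvd dvdE)
    have s0: "s \<noteq> 0" using False s by auto
    have "Polynomial.degree s < Polynomial.degree q"
      unfolding s using s0 by (subst degree_mult_eq) auto
    moreover have "poly (map_poly fps_const s) v = 0"
    proof -
      have eq: "poly (map_poly fps_const [:- a, 1:]) v = v - fps_const a"
        by (simp add: map_poly_pCons_hom flip: fps_const_neg)
      have "(v - fps_const a) * poly (map_poly fps_const s) v = 0"
        using less.prems unfolding s m.hom_mult poly_mult eq .
      then show ?thesis using v[of a] by simp
    qed
    ultimately have "s = 0" by (rule less.hyps)
    then show ?thesis using s0 by simp
  qed
qed

section \<open>Irreducibility of the curve of root tuples\<close>

text \<open>\<open>y\<close> will turn out to be a generic point of the whole curve.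
  \<open>unit\<close> keeps ratios of roots inside the power series, the collision
  \<open>y01\<close> of two distinct roots makes their ratio non-constant, and composition with
  \<open>c\<close> is the one symmetry known at the start.\<close>

locale generic_roots =
  fixes n :: nat and y :: "nat \<Rightarrow> 'a::alg_closed_field fps" and T c :: "'a fps"
  assumes n: "n \<ge> 2" and char: "of_nat n \<noteq> (0::'a)" "of_nat (n - 1) \<noteq> (0::'a)"
    and prod: "(\<Prod>i<n. [:- y i, 1:]) = Polynomial.monom 1 n - [:0, 1:] + [:T:]"
    and inj: "inj_on y {..<n}" and y01: "fps_nth (y 0) 0 = fps_nth (y 1) 0"
    and unit: "\<And>i. i < n \<Longrightarrow> fps_nth (y i) 0 \<noteq> 0"
    and transc: "\<And>a. y 0 \<noteq> fps_const a"
    and c0: "fps_nth c 0 = 0" and c: "y 0 oo c = y 1" "y 1 oo c = y 0"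
      "\<And>i. i \<in> {2..<n} \<Longrightarrow> y i oo c = y i"
begin

sublocale fc: comm_ring_hom "fps_const :: 'a \<Rightarrow> 'a fps"
  by (rule comm_ring_hom_fps_const)

text \<open>The visible symmetries of the curve: since \<open>\<omega>^n = \<omega>\<close>,
  multiplying all roots by \<open>\<omega>\<close> turns the parameter \<open>b\<close> into
  \<open>\<omega> * b\<close>.\<close>

definition symm :: "((nat \<Rightarrow> nat) \<times> 'a) set" where
  "symm = {\<pi>. \<pi> permutes {..<n}} \<times> {\<omega>. \<omega> ^ (n - 1) = 1}"

definition pt :: "(nat \<Rightarrow> nat) \<times> 'a \<Rightarrow> nat \<Rightarrow> 'a fps" where
  "pt a = (\<lambda>i. fps_const (snd a) * y (fst a i))"

definition comp_symm :: "(nat \<Rightarrow> nat) \<times> 'a \<Rightarrow> (nat \<Rightarrow> nat) \<times> 'a \<Rightarrow> (nat \<Rightarrow> nat) \<times> 'a" where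
  "comp_symm a b = (fst a \<circ> fst b, snd a * snd b)"

definition act :: "(nat \<Rightarrow> nat) \<times> 'a \<Rightarrow> 'a mpoly \<Rightarrow> 'a mpoly" where
  "act a g = msubst (\<lambda>i. Const (snd a) * Var (fst a i)) g"

text \<open>The substitute for the Galois group: the symmetries that keep the component of the curve
  through \<open>y\<close>. One inclusion of ideals is enough, since inverses come from finiteness
  (\<open>stab_inverse\<close>).\<close>

definition stab :: "((nat \<Rightarrow> nat) \<times> 'a) set" where
  "stab = {a\<in>symm. \<forall>g\<in>mpolys UNIV n. ev fps_const y g = 0 \<longrightarrow> ev fps_const (pt a) g = 0}"

lemma pt_id [simp]: "pt (id, 1) = y"
  by (simp add: pt_def)

lemma snd_symm_ne_0: "a \<in> symm \<Longrightarrow> snd a \<noteq> 0"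
  using n by (auto simp: symm_def power_0_left)

lemma id_in_symm: "(id, 1) \<in> symm"
  by (simp add: symm_def permutes_id)

lemma comp_in_symm: "a \<in> symm \<Longrightarrow> b \<in> symm \<Longrightarrow> comp_symm a b \<in> symm"
  by (auto simp: symm_def comp_symm_def permutes_compose power_mult_distrib)

lemma comp_symm_assoc: "comp_symm (comp_symm a b) d = comp_symm a (comp_symm b d)"
  by (simp add: comp_symm_def comp_assoc mult.assoc)

lemma comp_symm_id [simp]: "comp_symm (id, 1) a = a" "comp_symm a (id, 1) = a"
  by (simp_all add: comp_symm_def)

lemma comp_symm_inj:
  assumes "a \<in> symm"
  shows "inj (comp_symm a)"
proof (rule injI)
  fix b d assume eq: "comp_symm a b = comp_symm a d"
  have "inj (fst a)" using assms by (auto simp: symm_def permutes_inj)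
  then have "fst b = fst d"
    using eq by (auto simp: comp_symm_def fun_eq_iff dest: injD)
  moreover have "snd b = snd d" using eq snd_symm_ne_0[OF assms] by (simp add: comp_symm_def)
  ultimately show "b = d" by (rule prod_eqI)
qed

lemma finite_symm: "finite symm"
proof -
  have "finite {\<omega>::'a. 1 * \<omega> ^ (n - 1) = 1}" using n by (intro finite_exceptional) auto
  then show ?thesis unfolding symm_def by (simp add: finite_permutations)
qed

lemma act_in_mpolys: "a \<in> symm \<Longrightarrow> g \<in> mpolys UNIV n \<Longrightarrow> act a g \<in> mpolys UNIV n"
  unfolding act_def
proof (rule msubst_in_mpolys)
  fix i assume "a \<in> symm" "i < n"
  then have "fst a i < n" by (auto simp: symm_def dest: permutes_in_image[of _ _ i])
  then show "Const (snd a) * Var (fst a i) \<in> mpolys UNIV n"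
    by (intro subring_setD(4)[OF subring_set_mpolys[OF subring_set_UNIV]])
      (simp_all add: Const_in_mpolys Var_in_mpolys)
qed

lemma ev_act:
  assumes "g \<in> mpolys UNIV n"
  shows "ev fps_const (pt b) (act a g) = ev fps_const (pt (comp_symm b a)) g"
proof -
  have "ev fps_const (pt b) (Const (snd a) * Var (fst a i)) = pt (comp_symm b a) i" for i
    by (simp add: fc.ev_mult fc.ev_Const fc.ev_Var pt_def comp_symm_def mult_ac flip: fps_const_mult)
  then show ?thesis
    unfolding act_def by (subst ev_msubst[OF comm_ring_hom_fps_const assms]) simp
qed

lemma root_equation: "i < n \<Longrightarrow> y i ^ n - y i + T = 0"
proof -
  assume "i < n"
  then have "poly (\<Prod>i<n. [:- y i, 1:]) (y i) = 0" by (auto simp: poly_prod)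
  then show ?thesis unfolding prod by (simp add: poly_monom)
qed

lemma inj_pt: "a \<in> symm \<Longrightarrow> inj_on (pt a) {..<n}"
proof (rule inj_onI)
  fix i j assume a: "a \<in> symm" and ij: "i \<in> {..<n}" "j \<in> {..<n}" "pt a i = pt a j"
  have p: "fst a permutes {..<n}" using a by (auto simp: symm_def)
  have "y (fst a i) = y (fst a j)" using ij snd_symm_ne_0[OF a] by (simp add: pt_def)
  then have "fst a i = fst a j"
    using inj permutes_in_image[OF p] ij(1,2) by (auto dest: inj_onD)
  then show "i = j" using permutes_inj[OF p] by (auto dest: injD)
qed

lemma pt_root_equation:
  assumes "a \<in> symm" "i < n"
  shows "pt a i ^ n - pt a i + fps_const (snd a ^ n) * T = 0"
proof -
  have p: "fst a i < n" using assms by (auto simp: symm_def dest: permutes_in_image[of _ _ i])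
  have "snd a ^ n = snd a ^ (n - 1) * snd a"
    using n by (metis Suc_diff_1 power_Suc2 less_le_trans zero_less_numeral)
  then have w: "snd a ^ n = snd a" using assms by (auto simp: symm_def)
  have "pt a i ^ n - pt a i + fps_const (snd a ^ n) * T =
      fps_const (snd a) * (y (fst a i) ^ n - y (fst a i) + T)"
    by (simp add: pt_def power_mult_distrib fps_const_power w algebra_simps)
  then show ?thesis using root_equation[OF p] by simp
qed

text \<open>Both sides agree at the \<open>n\<close> distinct entries of \<open>pt a\<close> and in
  the coefficient of \<open>X^n\<close>, so no product has to be expanded.\<close>

lemma pt_relation:
  assumes "a \<in> symm"
  shows "(\<Prod>i<n. [:- pt a i, 1:]) = Polynomial.monom 1 n - [:0, 1:] + [:fps_const (snd a ^ n) * T:]"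
proof (rule poly_eqI_degree_lead_coeff[where A = "pt a ` {..<n}" and n = n])
  note L = linear_prod[of "{..<n}" "pt a", simplified]
  note R = degree_trinomial[OF n, of "fps_const (snd a ^ n) * T"]
  show "card (pt a ` {..<n}) \<ge> n" using inj_pt[OF assms] by (simp add: card_image)
  show "Polynomial.degree (\<Prod>i<n. [:- pt a i, 1:]) \<le> n" using L by simp
  show "Polynomial.degree (Polynomial.monom 1 n - [:0, 1:] + [:fps_const (snd a ^ n) * T:]) \<le> n"
    using R by simp
  show "Polynomial.coeff (\<Prod>i<n. [:- pt a i, 1:]) n =
      Polynomial.coeff (Polynomial.monom 1 n - [:0, 1:] + [:fps_const (snd a ^ n) * T:]) n"
    using L R by metis
  fix z assume "z \<in> pt a ` {..<n}"
  then obtain i where i: "i < n" "z = pt a i" by auto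
  have "poly (\<Prod>i<n. [:- pt a i, 1:]) z = 0" using i by (auto simp: poly_prod)
  moreover have "poly (Polynomial.monom 1 n - [:0, 1:] + [:fps_const (snd a ^ n) * T:]) z = 0"
    unfolding i(2) trinomial_poly by (rule pt_root_equation[OF assms i(1)])
  ultimately show "poly (\<Prod>i<n. [:- pt a i, 1:]) z =
      poly (Polynomial.monom 1 n - [:0, 1:] + [:fps_const (snd a ^ n) * T:]) z" by simp
qed

lemma trinomial_points_pt:
  assumes "A \<subseteq> symm" and "\<And>a i j. a \<in> A \<Longrightarrow> i < n \<Longrightarrow> j < n \<Longrightarrow> comp_symm a (transpose i j, 1) \<in> A"
  shows "trinomial_points fps_const n (pt ` A)"
proof (intro trinomial_points.intro trinomial_points_axioms.intro comm_ring_hom_fps_const n)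
  fix x and g :: "'a mpoly" assume x: "x \<in> pt ` A" and g: "g \<in> trinomial_ideal n"
  then obtain a where a: "a \<in> symm" "x = pt a" using assms(1) by blast
  from ev_trinomial_ideal[OF comm_ring_hom_fps_const pt_relation[OF a(1)] g]
  show "ev fps_const x g = 0" unfolding a(2) .
next
  fix x assume "x \<in> pt ` A"
  then show "inj_on x {..<n}" using assms(1) inj_pt by blast
next
  fix x i j assume x: "x \<in> pt ` A" and ij: "i < n" "j < n"
  then obtain a where a: "a \<in> A" "x = pt a" by blast
  have "x \<circ> transpose i j = pt (comp_symm a (transpose i j, 1))"
    by (rule ext) (simp add: a pt_def comp_symm_def)
  then show "x \<circ> transpose i j \<in> pt ` A" using assms(2)[OF a(1) ij] by blast
qed

lemma transpose_in_symm: "i < n \<Longrightarrow> j < n \<Longrightarrow> (transpose i j, 1) \<in> symm"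
  by (simp add: symm_def permutes_swap_id)

lemma stab_comp:
  assumes a: "a \<in> stab" and b: "b \<in> stab"
  shows "comp_symm b a \<in> stab"
proof -
  have symm: "a \<in> symm" "b \<in> symm" using a b by (auto simp: stab_def)
  have "ev fps_const (pt (comp_symm b a)) g = 0" if g: "g \<in> mpolys UNIV n" "ev fps_const y g = 0" for g
  proof -
    have "ev fps_const y (act a g) = ev fps_const (pt a) g" using ev_act[OF g(1), of "(id, 1)" a] by simp
    also have "\<dots> = 0" using a g by (simp add: stab_def)
    finally have "ev fps_const (pt b) (act a g) = 0"
      using b act_in_mpolys[OF symm(1) g(1)] by (simp add: stab_def)
    then show ?thesis using ev_act[OF g(1)] by simp
  qed
  then show ?thesis using comp_in_symm symm by (simp add: stab_def)
qed

lemma id_in_stab: "(id, 1) \<in> stab"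
  by (simp add: stab_def id_in_symm)

lemma stab_inverse:
  assumes "a \<in> stab"
  shows "\<exists>b\<in>stab. comp_symm a b = (id, 1)"
proof -
  have "finite stab" using finite_symm by (simp add: stab_def)
  moreover have "comp_symm a ` stab \<subseteq> stab" using stab_comp assms by blast
  moreover have "inj_on (comp_symm a) stab"
    using comp_symm_inj[of a] assms by (auto simp: stab_def intro: inj_on_subset)
  ultimately have "comp_symm a ` stab = stab" by (rule endo_inj_surj)
  then show ?thesis using id_in_stab by (metis imageE)
qed

text \<open>Composition with \<open>c\<close> is a ring homomorphism fixing the constants, so it
  carries relations satisfied by \<open>y\<close> to relations satisfied by \<open>y\<close> with
  indices 0 and 1 exchanged.\<close>

lemma swap01_in_stab: "(transpose 0 1, 1) \<in> stab"
proof -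
  have "ev fps_const (pt (transpose 0 1, 1)) g = 0" if g: "g \<in> mpolys UNIV n" "ev fps_const y g = 0" for g
  proof -
    have "0 = (ev fps_const y g) oo c" by (simp add: g)
    also have "\<dots> = ev (\<lambda>a. fps_const a oo c) (\<lambda>i. y i oo c) g"
      by (rule hom_ev[OF comm_ring_hom_fps_const comm_ring_hom_fps_compose[OF c0] g(1)])
    also have "\<dots> = ev fps_const (\<lambda>i. y i oo c) g" by simp
    also have "\<dots> = ev fps_const (pt (transpose 0 1, 1)) g"
    proof (rule ev_cong[OF comm_ring_hom_fps_const g(1)])
      fix i assume "i < n"
      then show "y i oo c = pt (transpose 0 1, 1) i"
        using c(1,2) c(3)[of i] by (cases "i = 0 \<or> i = 1") (auto simp: pt_def transpose_apply_other)
    qed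
    finally show ?thesis by simp
  qed
  then show ?thesis using transpose_in_symm[of 0 1] n by (simp add: stab_def)
qed

text \<open>Prime avoidance by a generic combination: each symmetry in question excludes at most one
  \<open>t\<close> from \<open>g + t * h\<close>, and the field is infinite.\<close>

lemma separate_from_stab:
  assumes "finite B" "\<And>b. b \<in> B \<Longrightarrow> b \<in> symm \<and> b \<notin> stab"
  shows "\<exists>g\<in>mpolys UNIV n. ev fps_const y g = 0 \<and> (\<forall>b\<in>B. ev fps_const (pt b) g \<noteq> 0)"
  using assms
proof (induction B rule: finite_induct)
  case empty
  have "0 \<in> mpolys UNIV n" by (simp add: subring_setD subring_set_mpolys)
  then show ?case using fc.ev_0 by auto
next
  case (insert a B)
  note ring = subring_setD[OF subring_set_mpolys[OF subring_set_UNIV, of n, where 'a = 'a]]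
  obtain g where g: "g \<in> mpolys UNIV n" "ev fps_const y g = 0" "\<And>b. b \<in> B \<Longrightarrow> ev fps_const (pt b) g \<noteq> 0"
    using insert by auto
  obtain h where h: "h \<in> mpolys UNIV n" "ev fps_const y h = 0" "ev fps_const (pt a) h \<noteq> 0"
    using insert.prems[of a] by (auto simp: stab_def)
  let ?bad = "\<lambda>b. {t. ev fps_const (pt b) g + fps_const t * ev fps_const (pt b) h = 0}"
  have "finite (?bad b)" if b: "b \<in> insert a B" for b
  proof (cases "ev fps_const (pt b) h = 0")
    case True
    then have "b \<in> B" using b h(3) by blast
    then have "ev fps_const (pt b) g \<noteq> 0" by (rule g(3))
    then show ?thesis using True by simp
  next
    case False
    have "t = s" if "t \<in> ?bad b" "s \<in> ?bad b" for t s
    proof -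
      have "u = v" if "w + u = 0" "w + v = 0" for u v w :: "'a fps"
        using that by (metis add_left_cancel)
      from this[of "ev fps_const (pt b) g"] that
      have "fps_const t * ev fps_const (pt b) h = fps_const s * ev fps_const (pt b) h" by blast
      then show ?thesis using False by simp
    qed
    then have "\<exists>t0. ?bad b \<subseteq> {t0}" by blast
    then show ?thesis by (meson finite.emptyI finite_insert finite_subset)
  qed
  then have "finite (\<Union>b\<in>insert a B. ?bad b)" using insert.hyps(1) by blast
  then obtain t where t: "t \<notin> (\<Union>b\<in>insert a B. ?bad b)"
    using ex_new_if_finite[OF infinite_UNIV_alg_closed] by blast
  have "g + Const t * h \<in> mpolys UNIV n"
    by (intro ring g h Const_in_mpolys) simp_all
  moreover have "ev fps_const x (g + Const t * h) = ev fps_const x g + fps_const t * ev fps_const x h" for x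
    by (simp add: fc.ev_add fc.ev_mult fc.ev_Const)
  ultimately show ?case using t g(2) h(2) by (intro bexI[of _ "g + Const t * h"]) auto
qed

lemma ev_prod: "ev fps_const x (\<Prod>i\<in>A. (f i :: 'a mpoly)) = (\<Prod>i\<in>A. ev fps_const x (f i))"
proof -
  interpret e: comm_ring_hom "ev fps_const x" by (rule fc.comm_ring_hom_ev)
  show ?thesis by (rule e.hom_prod)
qed

end

section \<open>Scaling-invariant functions of a pair of roots\<close>

text \<open>On a pair of distinct roots the form \<open>\<Sum>k<n. x0^k * x1^(n-1-k)\<close> equals 1, which
  lets one replace a polynomial in the two roots all of whose monomials have degree divisible
  by \<open>n - 1\<close> by a polynomial in the ratio of the roots.\<close>

lemma complete_form_eq_1:
  fixes a b :: "'a::idom"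
  assumes "a \<noteq> b" "a ^ n - a = b ^ n - b" "b * u = 1"
  shows "(\<Sum>k<n. (a * u) ^ k) * b ^ (n - 1) = 1"
proof -
  have "a ^ n - b ^ n = a - b" using assms(2) by (simp add: algebra_simps)
  then have "(a - b) * (\<Sum>i<n. b ^ (n - Suc i) * a ^ i) = (a - b) * 1"
    by (simp add: power_diff_sumr2)
  then have "(\<Sum>i<n. b ^ (n - Suc i) * a ^ i) = 1" using assms(1) by simp
  moreover have "b ^ (n - Suc i) * a ^ i = (a * u) ^ i * b ^ (n - 1)" if "i < n" for i
  proof -
    have "n - 1 = (n - Suc i) + i" using that by simp
    then have "(a * u) ^ i * b ^ (n - 1) = a ^ i * (b * u) ^ i * b ^ (n - Suc i)"
      by (simp add: power_mult_distrib power_add mult_ac)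
    then show ?thesis using assms(3) by (simp add: mult.commute)
  qed
  ultimately show ?thesis by (simp add: sum_distrib_right)
qed

text \<open>Averaging over scalings with this sum singles out the monomials of degree divisible by
  \<open>m\<close>. As \<open>m\<close> is invertible, \<open>X^m - 1\<close> is squarefree and
  there are exactly \<open>m\<close> roots of unity.\<close>

lemma sum_over_roots_of_unity:
  assumes m: "m > 0" "of_nat m \<noteq> (0::'a::alg_closed_field)"
  shows "(\<Sum>\<omega>\<in>{\<omega>::'a. \<omega> ^ m = 1}. \<omega> ^ d) = (if m dvd d then of_nat m else 0)"
proof -
  let ?M = "{\<omega>::'a. \<omega> ^ m = 1}"
  define f where "f = Polynomial.monom 1 m - [:1::'a:]"
  have df: "Polynomial.degree f = m"
    using m(1) unfolding f_def diff_conv_add_uminus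
    by (subst degree_add_eq_left) (auto simp: degree_monom_eq)
  have cm: "Polynomial.coeff f m = 1" using m(1) by (cases m) (simp_all add: f_def)
  then have lf: "lead_coeff f = 1" using df by simp
  have sq: "\<not> [:- u, 1:] * [:- u, 1:] dvd f" for u
  proof
    assume "[:- u, 1:] * [:- u, 1:] dvd f"
    then obtain v where f': "f = [:- u, 1:] * [:- u, 1:] * v" by (elim dvdE)
    have "poly f u = 0" unfolding f' by simp
    then have u: "u ^ m = 1" by (simp add: f_def poly_monom)
    have "poly (pderiv f) u = 0" unfolding f' by (rule poly_pderiv_square)
    then have "of_nat m * u ^ (m - 1) = 0" by (simp add: f_def pderiv_diff pderiv_monom poly_monom pderiv_pCons)
    then have "u = 0" using m by simp
    then show False using u m(1) by (simp add: power_0_left)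
  qed
  obtain x where x: "inj_on x {..<m}" "f = (\<Prod>i<m. [:- x i, 1:])"
    using split_into_distinct_linear_factors[OF lf sq] unfolding df by blast
  have M: "?M = x ` {..<m}"
  proof -
    have "poly f w = 0 \<longleftrightarrow> w \<in> x ` {..<m}" for w unfolding x(2) by (auto simp: poly_prod)
    then show ?thesis by (auto simp: f_def poly_monom)
  qed
  have card: "card ?M = m" unfolding M using x(1) by (simp add: card_image)
  have fin: "finite ?M" unfolding M by simp
  show ?thesis
  proof (cases "m dvd d")
    case True
    then obtain k where "d = m * k" by (elim dvdE)
    then have "\<omega> ^ d = 1" if "\<omega> \<in> ?M" for \<omega> using that by (simp add: power_mult)
    then have "(\<Sum>\<omega>\<in>?M. \<omega> ^ d) = (\<Sum>\<omega>\<in>?M. 1)" by (intro sum.cong) auto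
    then show ?thesis using True card by simp
  next
    case False
    define r where "r = d mod m"
    have r: "0 < r" "r < m" using False m(1) by (auto simp: r_def mod_greater_zero_iff_not_dvd)
    \<comment> \<open>Otherwise all \<open>m\<close> roots of unity would be roots of
      \<open>X^r - 1\<close>, whose degree \<open>r = d mod m\<close> is smaller than
      \<open>m\<close>.\<close>
    have "\<exists>z\<in>?M. z ^ d \<noteq> 1"
    proof (rule ccontr)
      assume "\<not> ?thesis"
      then have all: "z ^ d = 1" if "z \<in> ?M" for z using that by blast
      have "z ^ r = 1" if "z \<in> ?M" for z
      proof -
        have "z ^ d = (z ^ m) ^ (d div m) * z ^ r"
          unfolding r_def by (simp flip: power_mult power_add)
        then show ?thesis using all[OF that] that by simp
      qed
      then have sub: "?M \<subseteq> {z. poly (Polynomial.monom 1 r - [:1:]) z = 0}" by (auto simp: poly_monom)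
      have ne: "Polynomial.monom 1 r - [:1::'a:] \<noteq> 0"
      proof
        assume "Polynomial.monom 1 r - [:1::'a:] = 0"
        then have "Polynomial.coeff (Polynomial.monom 1 r - [:1::'a:]) r = 0" by simp
        then show False using r(1) by (cases r) simp_all
      qed
      have "m \<le> card {z. poly (Polynomial.monom 1 r - [:1::'a:]) z = 0}"
        using card_mono[OF poly_roots_finite[OF ne] sub] unfolding card .
      also have "\<dots> \<le> Polynomial.degree (Polynomial.monom 1 r - [:1::'a:])"
        by (rule card_poly_roots_bound[OF ne])
      also have "\<dots> \<le> r" by (intro degree_diff_le) (simp_all add: degree_monom_le)
      finally show False using r by simp
    qed
    then obtain z :: 'a where z: "z ^ m = 1" "z ^ d \<noteq> 1" by blast
    have z0: "z \<noteq> 0" using z(1) m(1) by (auto simp: power_0_left)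
    have "bij_betw ((*) z) ?M ?M"
      by (rule bij_betw_byWitness[where f' = "(*) (inverse z)"])
        (use z(1) z0 in \<open>auto simp: power_mult_distrib power_inverse\<close>)
    then have "(\<Sum>\<omega>\<in>?M. \<omega> ^ d) = (\<Sum>\<omega>\<in>?M. (z * \<omega>) ^ d)"
      by (rule sum.reindex_bij_betw[symmetric])
    also have "\<dots> = z ^ d * (\<Sum>\<omega>\<in>?M. \<omega> ^ d)" by (simp add: power_mult_distrib sum_distrib_left)
    finally have "(z ^ d - 1) * (\<Sum>\<omega>\<in>?M. \<omega> ^ d) = 0" by (simp add: algebra_simps)
    then show ?thesis using z(2) False by simp
  qed
qed

lemma mono_eval_two:
  assumes "Poly_Mapping.keys e \<subseteq> {..<2}"
  shows "mono_eval x e = x 0 ^ Poly_Mapping.lookup e 0 * x 1 ^ Poly_Mapping.lookup e 1"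
proof -
  have "{..<2::nat} = {0, 1}" by auto
  then show ?thesis using mono_eval_superset[of "{0, 1}" e x] assms by simp
qed

text \<open>With \<open>v = a * u\<close> the ratio and \<open>\<eta>\<close> the sum of its powers,
  the relation \<open>\<eta> * b^m = 1\<close> turns a monomial of degree \<open>m * k\<close> into
  \<open>v^e0 / \<eta>^k\<close>, where \<open>e0\<close> is the exponent of \<open>a\<close>. The
  factor \<open>\<eta>^D\<close> clears the denominators. As \<open>Q\<close> and \<open>D\<close>
  depend on \<open>q\<close> and \<open>m\<close> alone, one \<open>Q\<close> serves all pairs of
  roots.\<close>

lemma polynomial_in_ratio:
  fixes q :: "'a::comm_ring_1 mpoly"
  assumes q: "q \<in> mpolys UNIV 2" and m: "m > 0"
  shows "\<exists>(Q :: 'a poly) D. \<forall>(h :: 'a \<Rightarrow> 'b::comm_ring_1) a b u.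
    comm_ring_hom h \<longrightarrow> b * u = 1 \<longrightarrow> (\<Sum>k<Suc m. (a * u) ^ k) * b ^ m = 1 \<longrightarrow>
    (\<Sum>k<Suc m. (a * u) ^ k) ^ D *
      (\<Sum>e | e \<in> Poly_Mapping.keys q \<and> m dvd Poly_Mapping.lookup e 0 + Poly_Mapping.lookup e 1.
        h (Poly_Mapping.lookup q e) * (a ^ Poly_Mapping.lookup e 0 * b ^ Poly_Mapping.lookup e 1)) =
    poly (map_poly h Q) (a * u)"
proof -
  define S where "S = {e \<in> Poly_Mapping.keys q. m dvd Poly_Mapping.lookup e 0 + Poly_Mapping.lookup e 1}"
  define k where "k e = (Poly_Mapping.lookup e 0 + Poly_Mapping.lookup e 1) div m" for e :: "nat \<Rightarrow>\<^sub>0 nat"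
  \<comment> \<open>The sum of the exponents bounds each of them.\<close>
  define D where "D = (\<Sum>e\<in>S. k e)"
  define \<eta> where "\<eta> = (\<Sum>k<Suc m. [:0, 1::'a:] ^ k)"
  define Q where "Q = (\<Sum>e\<in>S. [:Poly_Mapping.lookup q e:] * ([:0, 1:] ^ Poly_Mapping.lookup e 0 * \<eta> ^ (D - k e)))"
  have fin: "finite S" by (simp add: S_def)
  show ?thesis
  proof (rule exI[of _ Q], rule exI[of _ D], intro allI impI)
    fix h :: "'a \<Rightarrow> 'b" and a b u :: 'b
    assume h: "comm_ring_hom h" and u: "b * u = 1" and \<eta>b: "(\<Sum>k<Suc m. (a * u) ^ k) * b ^ m = 1"
    interpret comm_ring_hom h by (rule h)
    interpret mh: map_poly_comm_ring_hom h ..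
    let ?v = "a * u" and ?\<eta> = "\<Sum>k<Suc m. (a * u) ^ k"
    have a: "a = ?v * b" using u by (simp add: mult.assoc mult.commute[of u])
    have \<eta>v: "poly (map_poly h \<eta>) ?v = ?\<eta>"
      by (simp add: \<eta>_def mh.hom_sum mh.hom_power map_poly_pCons_hom poly_sum poly_power del: sum.lessThan_Suc)
    have tm: "?\<eta> ^ D * (h t * (a ^ Poly_Mapping.lookup e 0 * b ^ Poly_Mapping.lookup e 1)) =
        h t * (?v ^ Poly_Mapping.lookup e 0 * ?\<eta> ^ (D - k e))" if e: "e \<in> S" for e t
    proof -
      let ?e0 = "Poly_Mapping.lookup e 0" and ?e1 = "Poly_Mapping.lookup e 1"
      have "k e \<le> D" unfolding D_def using fin e by (intro member_le_sum) auto
      then have D: "?\<eta> ^ D = ?\<eta> ^ (D - k e) * ?\<eta> ^ k e" by (simp flip: power_add)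
      have "?e0 + ?e1 = m * k e" using e by (simp add: S_def k_def)
      then have ab: "a ^ ?e0 * b ^ ?e1 = ?v ^ ?e0 * (b ^ m) ^ k e"
        by (subst a) (simp add: power_mult_distrib mult.assoc flip: power_add power_mult)
      have "?\<eta> ^ D * (h t * (a ^ ?e0 * b ^ ?e1)) =
          h t * (?v ^ ?e0 * ?\<eta> ^ (D - k e)) * (?\<eta> * b ^ m) ^ k e"
        unfolding D ab power_mult_distrib[of ?\<eta> "b ^ m"] by (simp only: mult_ac)
      then show ?thesis using \<eta>b by (simp del: sum.lessThan_Suc)
    qed
    have "poly (map_poly h Q) ?v = (\<Sum>e\<in>S. h (Poly_Mapping.lookup q e) * (?v ^ Poly_Mapping.lookup e 0 * ?\<eta> ^ (D - k e)))"
      by (simp add: Q_def mh.hom_sum mh.hom_mult mh.hom_power map_poly_pCons_hom poly_sum poly_power poly_mult \<eta>v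
          del: sum.lessThan_Suc mult_pCons_left)
    also have "\<dots> = ?\<eta> ^ D * (\<Sum>e\<in>S. h (Poly_Mapping.lookup q e) * (a ^ Poly_Mapping.lookup e 0 * b ^ Poly_Mapping.lookup e 1))"
      unfolding sum_distrib_left by (rule sum.cong[OF refl], rule tm[symmetric])
    finally show "?\<eta> ^ D *
      (\<Sum>e | e \<in> Poly_Mapping.keys q \<and> m dvd Poly_Mapping.lookup e 0 + Poly_Mapping.lookup e 1.
        h (Poly_Mapping.lookup q e) * (a ^ Poly_Mapping.lookup e 0 * b ^ Poly_Mapping.lookup e 1)) =
      poly (map_poly h Q) ?v"
      unfolding S_def by (rule sym)
  qed
qed

context generic_roots
begin

lemma scale_in_symm: "\<omega> ^ (n - 1) = 1 \<Longrightarrow> (id, \<omega>) \<in> symm"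
  by (simp add: symm_def permutes_id)

lemma roots_form_eq_1:
  assumes "i < n" "j < n" "i \<noteq> j"
  shows "(\<Sum>k<Suc (n - 1). (y i * inverse (y j)) ^ k) * y j ^ (n - 1) = 1"
proof -
  have "y i \<noteq> y j" using inj assms by (auto dest: inj_onD)
  moreover have "y i ^ n - y i = y j ^ n - y j"
    using root_equation[OF assms(1)] root_equation[OF assms(2)] by (metis add_right_cancel)
  moreover have "y j * inverse (y j) = 1"
    using unit[OF assms(2)] by (subst mult.commute) (rule inverse_mult_eq_1)
  ultimately have "(\<Sum>k<n. (y i * inverse (y j)) ^ k) * y j ^ (n - 1) = 1"
    by (rule complete_form_eq_1)
  then show ?thesis using n by simp
qed

text \<open>A polynomial in two variables that is invariant under the scalings by \<open>(n - 1)\<close>-th roots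
  of unity only depends on the ratio of the two roots, which is transcendental over the base field.
  So if it vanishes at one pair of roots, it vanishes at all.\<close>

lemma scaling_invariant_vanishes:
  assumes q: "q \<in> mpolys UNIV 2"
    and inv: "\<And>a \<omega>. a \<in> symm \<Longrightarrow> \<omega> ^ (n - 1) = 1 \<Longrightarrow>
      ev fps_const (pt (comp_symm a (id, \<omega>))) q = ev fps_const (pt a) q"
    and zero: "ev fps_const y q = 0" and \<pi>: "\<pi> permutes {..<n}"
  shows "ev fps_const (pt (\<pi>, 1)) q = 0"
proof -
  let ?M = "{\<omega>::'a. \<omega> ^ (n - 1) = 1}"
  let ?S = "{e. e \<in> Poly_Mapping.keys q \<and> (n - 1) dvd Poly_Mapping.lookup e 0 + Poly_Mapping.lookup e 1}"
  have n1: "n - 1 > 0" using n by simp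
  have keys2: "Poly_Mapping.keys e \<subseteq> {..<2}" if "e \<in> Poly_Mapping.keys q" for e
    using q that by (auto simp: mpolys_def)
  \<comment> \<open>Summing the invariance over all scalings cancels the monomials whose degree is
    not divisible by \<open>n - 1\<close>; the number \<open>n - 1\<close> of scalings is invertible
    and can be divided out.\<close>
  have average: "ev fps_const (pt (\<rho>, 1)) q = (\<Sum>e\<in>?S. fps_const (Poly_Mapping.lookup q e) *
      (y (\<rho> 0) ^ Poly_Mapping.lookup e 0 * y (\<rho> 1) ^ Poly_Mapping.lookup e 1))"
    if \<rho>: "\<rho> permutes {..<n}" for \<rho>
  proof -
    have \<rho>s: "(\<rho>, 1) \<in> symm" using \<rho> by (simp add: symm_def)
    define t where "t e = fps_const (Poly_Mapping.lookup q e) *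
      (y (\<rho> 0) ^ Poly_Mapping.lookup e 0 * y (\<rho> 1) ^ Poly_Mapping.lookup e 1)" for e
    have card: "fps_const (\<Sum>\<omega>\<in>?M. (1::'a)) = fps_const (of_nat (n - 1))"
      using sum_over_roots_of_unity[OF n1 char(2), of 0] by simp
    have scaled: "ev fps_const (pt (comp_symm (\<rho>, 1) (id, \<omega>))) q =
        (\<Sum>e\<in>Poly_Mapping.keys q. fps_const (\<omega> ^ (Poly_Mapping.lookup e 0 + Poly_Mapping.lookup e 1)) * t e)" for \<omega>
      unfolding ev_def
      by (rule sum.cong)
        (simp_all add: mono_eval_two[OF keys2] pt_def comp_symm_def t_def power_mult_distrib power_add
          fps_const_power mult_ac flip: fps_const_mult)
    have "fps_const (of_nat (n - 1)) * ev fps_const (pt (\<rho>, 1)) q =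
        (\<Sum>\<omega>\<in>?M. ev fps_const (pt (comp_symm (\<rho>, 1) (id, \<omega>))) q)"
    proof -
      have "(\<Sum>\<omega>\<in>?M. ev fps_const (pt (comp_symm (\<rho>, 1) (id, \<omega>))) q) = (\<Sum>\<omega>\<in>?M. ev fps_const (pt (\<rho>, 1)) q)"
        by (rule sum.cong) (use inv[OF \<rho>s] in auto)
      also have "\<dots> = fps_const (\<Sum>\<omega>\<in>?M. (1::'a)) * ev fps_const (pt (\<rho>, 1)) q"
        by (simp add: fps_of_nat)
      finally show ?thesis unfolding card by (rule sym)
    qed
    also have "\<dots> = (\<Sum>e\<in>Poly_Mapping.keys q.
        fps_const (\<Sum>\<omega>\<in>?M. \<omega> ^ (Poly_Mapping.lookup e 0 + Poly_Mapping.lookup e 1)) * t e)"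
      unfolding scaled by (subst sum.swap) (simp add: fc.hom_sum sum_distrib_right)
    also have "\<dots> = (\<Sum>e\<in>Poly_Mapping.keys q.
        if (n - 1) dvd Poly_Mapping.lookup e 0 + Poly_Mapping.lookup e 1 then fps_const (of_nat (n - 1)) * t e else 0)"
      unfolding sum_over_roots_of_unity[OF n1 char(2)] by (rule sum.cong) auto
    also have "\<dots> = fps_const (of_nat (n - 1)) * (\<Sum>e\<in>?S. t e)"
      by (simp add: sum.inter_filter[symmetric] sum_distrib_left)
    finally have "fps_const (of_nat (n - 1)) * ev fps_const (pt (\<rho>, 1)) q = fps_const (of_nat (n - 1)) * (\<Sum>e\<in>?S. t e)" .
    note eq = this
    have nz: "fps_const (of_nat (n - 1) :: 'a) \<noteq> 0" using char(2) by (simp only: fps_const_eq_0_iff not_False_eq_True)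
    from eq show ?thesis unfolding mult_left_cancel[OF nz] t_def .
  qed
  obtain Q :: "'a poly" and D where Q: "\<forall>(h :: 'a \<Rightarrow> 'a fps) a b u.
    comm_ring_hom h \<longrightarrow> b * u = 1 \<longrightarrow> (\<Sum>k<Suc (n - 1). (a * u) ^ k) * b ^ (n - 1) = 1 \<longrightarrow>
    (\<Sum>k<Suc (n - 1). (a * u) ^ k) ^ D * (\<Sum>e\<in>?S.
        h (Poly_Mapping.lookup q e) * (a ^ Poly_Mapping.lookup e 0 * b ^ Poly_Mapping.lookup e 1)) =
    poly (map_poly h Q) (a * u)"
    using polynomial_in_ratio[OF q n1, where 'b = "'a fps"] by blast
  have ratio: "(\<Sum>k<Suc (n - 1). (y i * inverse (y j)) ^ k) ^ D * (\<Sum>e\<in>?S.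
        fps_const (Poly_Mapping.lookup q e) * (y i ^ Poly_Mapping.lookup e 0 * y j ^ Poly_Mapping.lookup e 1)) =
    poly (map_poly fps_const Q) (y i * inverse (y j))" if ij: "i < n" "j < n" "i \<noteq> j" for i j
  proof (rule Q[rule_format, OF comm_ring_hom_fps_const _ roots_form_eq_1[OF ij]])
    show "y j * inverse (y j) = 1"
      using unit[OF ij(2)] by (subst mult.commute) (rule inverse_mult_eq_1)
  qed
  have "Q = 0"
  proof (rule fps_transcendental)
    have "(\<Sum>e\<in>?S. fps_const (Poly_Mapping.lookup q e) *
        (y 0 ^ Poly_Mapping.lookup e 0 * y 1 ^ Poly_Mapping.lookup e 1)) = 0"
      using average[OF permutes_id] zero by simp
    then show "poly (map_poly fps_const Q) (y 0 * inverse (y 1)) = 0"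
      using ratio[of 0 1] n by simp
    \<comment> \<open>Both roots have the same nonzero constant term, so a constant ratio would have
      to be 1, against their being distinct.\<close>
    fix a show "y 0 * inverse (y 1) \<noteq> fps_const a"
    proof
      assume r: "y 0 * inverse (y 1) = fps_const a"
      have i: "inverse (y 1) * y 1 = 1" using inverse_mult_eq_1[OF unit[of 1]] n by simp
      have "y 0 = y 0 * inverse (y 1) * y 1" by (simp only: mult.assoc i mult_1_right)
      then have eq: "y 0 = fps_const a * y 1" by (simp only: r)
      then have "fps_nth (y 0) 0 = a * fps_nth (y 1) 0" by simp
      then have "a = 1" using y01 unit[of 1] n by simp
      then have "y 0 = y 1" using eq by simp
      then show False using inj n by (auto dest!: inj_onD)
    qed
  qed
  have lt: "\<pi> 0 < n" "\<pi> 1 < n" using permutes_in_image[OF \<pi>, of 0] permutes_in_image[OF \<pi>, of 1] n by auto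
  have ne: "\<pi> 0 \<noteq> \<pi> 1" using permutes_inj[OF \<pi>] by (auto dest: injD)
  let ?\<eta> = "\<Sum>k<Suc (n - 1). (y (\<pi> 0) * inverse (y (\<pi> 1))) ^ k"
  have "?\<eta> \<noteq> 0" using roots_form_eq_1[OF lt ne] by (metis mult_zero_left zero_neq_one)
  moreover have "?\<eta> ^ D * ev fps_const (pt (\<pi>, 1)) q = 0"
    unfolding average[OF \<pi>] ratio[OF lt ne] by (simp add: \<open>Q = 0\<close>)
  ultimately show ?thesis by (metis mult_eq_0_iff power_eq_0_iff)
qed

text \<open>Otherwise some \<open>g\<close> vanishes at \<open>y\<close> but at no symmetry sending
  0 and 1 to \<open>i\<close> and \<open>j\<close>. Its norm \<open>N\<close> over the subgroup
  \<open>B0\<close> fixing 0 and 1, scalings included, agrees with a polynomial in two variables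
  that is invariant under scaling. As this vanishes at \<open>y\<close>, it vanishes at every pair
  of roots, which gives \<open>g\<close> a zero where it was to have none.\<close>

lemma stab_two_transitive:
  assumes ij: "i < n" "j < n" "i \<noteq> j"
  shows "\<exists>a\<in>stab. fst a 0 = i \<and> fst a 1 = j"
proof (rule ccontr)
  assume contra: "\<not> ?thesis"
  \<comment> \<open>\<open>B\<close> is the coset of \<open>B0\<close> formed by the symmetries in
    question.\<close>
  define B where "B = {a\<in>symm. fst a 0 = i \<and> fst a 1 = j}"
  define B0 where "B0 = {a\<in>symm. fst a 0 = 0 \<and> fst a 1 = 1}"
  have fin: "finite B" "finite B0" using finite_symm by (simp_all add: B_def B0_def)
  obtain g where g: "g \<in> mpolys UNIV n" "ev fps_const y g = 0" "\<forall>b\<in>B. ev fps_const (pt b) g \<noteq> 0"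
    using separate_from_stab[OF fin(1)] contra by (force simp: B_def)
  define N where "N = (\<Prod>b\<in>B0. act b g)"
  have N: "N \<in> mpolys UNIV n"
    unfolding N_def
    by (rule subring_set_prod[OF subring_set_mpolys[OF subring_set_UNIV]])
      (use act_in_mpolys g in \<open>auto simp: B0_def\<close>)
  have evN: "ev fps_const (pt a) N = (\<Prod>b\<in>B0. ev fps_const (pt (comp_symm a b)) g)" for a
    unfolding N_def ev_prod by (simp add: ev_act[OF g(1)])
  \<comment> \<open>Multiplication by \<open>s\<close> permutes \<open>B0\<close> and hence the
    factors of the norm.\<close>
  have invN: "ev fps_const (pt (comp_symm a s)) N = ev fps_const (pt a) N" if s: "s \<in> B0" for a s
  proof -
    have sub: "comp_symm s ` B0 \<subseteq> B0"
      using s comp_in_symm by (auto simp: B0_def comp_symm_def)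
    have inj: "inj_on (comp_symm s) B0"
      using comp_symm_inj[of s] s by (auto simp: B0_def intro: inj_on_subset)
    then have "bij_betw (comp_symm s) B0 B0"
      using endo_inj_surj[OF fin(2) sub inj] by (simp add: bij_betw_def)
    then show ?thesis
      unfolding evN comp_symm_assoc
      by (rule prod.reindex_bij_betw[where g = "\<lambda>b. ev fps_const (pt (comp_symm a b)) g"])
  qed
  have pts: "trinomial_points fps_const n (pt ` symm)"
    by (rule trinomial_points_pt) (use comp_in_symm transpose_in_symm in auto)
  have "\<exists>q\<in>mpolys UNIV 2. \<forall>x\<in>pt ` symm. ev fps_const x q = ev fps_const x N"
  proof (rule trinomial_points.invariant_eq_polynomial_in_two[OF pts N])
    fix x i l assume x: "x \<in> pt ` symm" and il: "2 \<le> i" "i < n" "2 \<le> l" "l < n"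
    then obtain a where a: "a \<in> symm" "x = pt a" by blast
    have "x \<circ> transpose i l = pt (comp_symm a (transpose i l, 1))"
      by (rule ext) (simp add: a pt_def comp_symm_def)
    moreover have "(transpose i l, 1) \<in> B0"
      using il transpose_in_symm by (simp add: B0_def transpose_apply_other)
    ultimately show "ev fps_const (x \<circ> transpose i l) N = ev fps_const x N"
      using invN a(2) by simp
  qed
  then obtain q where q: "q \<in> mpolys UNIV 2" "\<And>a. a \<in> symm \<Longrightarrow> ev fps_const (pt a) q = ev fps_const (pt a) N"
    by blast
  have scale: "ev fps_const (pt (comp_symm a (id, \<omega>))) q = ev fps_const (pt a) q"
    if "a \<in> symm" "\<omega> ^ (n - 1) = 1" for a \<omega>
  proof -
    have "(id, \<omega>) \<in> B0" using scale_in_symm[OF that(2)] by (simp add: B0_def)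
    then show ?thesis using q(2) that comp_in_symm[OF that(1) scale_in_symm[OF that(2)]] invN by simp
  qed
  have "(id, 1) \<in> B0" using id_in_symm by (simp add: B0_def)
  then have "ev fps_const (pt (id, 1)) N = 0"
    unfolding evN
    by (intro prod_zero[OF fin(2)] bexI[of _ "(id, 1)"]) (simp_all add: g(2))
  then have zero: "ev fps_const y q = 0" using q(2)[OF id_in_symm] by simp
  \<comment> \<open>The first swap sends 0 to \<open>i\<close>; the second moves the image of 1 to
    \<open>j\<close> and leaves \<open>i\<close> alone.\<close>
  define \<pi> where "\<pi> = transpose (transpose 0 i 1) j \<circ> transpose 0 i"
  have lt: "transpose 0 i 1 < n" using ij n by (auto simp: transpose_def)
  have \<pi>: "\<pi> permutes {..<n}"
    unfolding \<pi>_def by (intro permutes_compose permutes_swap_id) (use ij n lt in auto)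
  have \<pi>01: "\<pi> 0 = i" "\<pi> 1 = j" using ij by (auto simp: \<pi>_def transpose_def)
  have \<pi>s: "(\<pi>, 1) \<in> symm" using \<pi> by (simp add: symm_def)
  have "ev fps_const (pt (\<pi>, 1)) N = 0"
    using scaling_invariant_vanishes[OF q(1) scale zero \<pi>] q(2)[OF \<pi>s] by simp
  then obtain b where b: "b \<in> B0" "ev fps_const (pt (comp_symm (\<pi>, 1) b)) g = 0"
    unfolding evN using fin(2) by (auto simp: prod_zero_iff)
  have "comp_symm (\<pi>, 1) b \<in> B"
    using b(1) comp_in_symm[OF \<pi>s, of b] \<pi>01 by (auto simp: B_def B0_def comp_symm_def)
  then show False using g(3) b(2) by blast
qed

text \<open>Conjugate the swap of 0 and 1 by a symmetry that sends them to \<open>i\<close> and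
  \<open>j\<close>. Its unknown scaling commutes with everything and cancels against that of the
  inverse.\<close>

lemma transpose_in_stab:
  assumes ij: "i < n" "j < n" "i \<noteq> j"
  shows "(transpose i j, 1) \<in> stab"
proof -
  obtain a where a: "a \<in> stab" "fst a 0 = i" "fst a 1 = j" using stab_two_transitive[OF ij] by blast
  obtain b where b: "b \<in> stab" "comp_symm a b = (id, 1)" using stab_inverse[OF a(1)] by blast
  have inj: "inj (fst a)" using a(1) by (auto simp: stab_def symm_def permutes_inj)
  have ab: "fst a (fst b x) = x" for x using b(2) by (auto simp: comp_symm_def fun_eq_iff)
  have "fst a (transpose 0 1 (fst b x)) = transpose i j x" for x
  proof -
    have "fst a (transpose 0 1 u) = transpose i j (fst a u)" for u
      using a(2,3) inj by (auto simp: transpose_def dest: injD)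
    then show ?thesis using ab by simp
  qed
  then have "comp_symm a (comp_symm (transpose 0 1, 1) b) = (transpose i j, 1)"
    using b(2) by (simp add: comp_symm_def fun_eq_iff)
  moreover have "comp_symm a (comp_symm (transpose 0 1, 1) b) \<in> stab"
    by (intro stab_comp a b swap01_in_stab)
  ultimately show ?thesis by simp
qed

lemma permutation_in_stab:
  assumes "\<pi> permutes {..<n}"
  shows "(\<pi>, 1) \<in> stab"
  using assms finite_lessThan
proof (induction rule: permutes_induct)
  case id
  show ?case by (rule id_in_stab)
next
  case (swap i j p)
  have "comp_symm (transpose i j, 1) (p, 1) \<in> stab"
    using swap by (intro stab_comp transpose_in_stab) auto
  then show ?case by (simp add: comp_symm_def comp_def)
qed

text \<open>All permutations preserve the ideal of \<open>y\<close>, so \<open>g\<close> vanishes at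
  every permuted point and the normal form argument applies; its one-variable case is the
  transcendence of \<open>y 0\<close>.\<close>

lemma vanishing_at_generic_point:
  assumes g: "g \<in> mpolys UNIV n" "ev fps_const y g = 0"
  shows "g \<in> trinomial_ideal n"
proof -
  let ?A = "{\<pi>. \<pi> permutes {..<n}} \<times> {1::'a}"
  have pts: "trinomial_points fps_const n (pt ` ?A)"
    by (rule trinomial_points_pt) (auto simp: symm_def comp_symm_def intro!: permutes_compose permutes_swap_id)
  show ?thesis
  proof (rule trinomial_points.vanishing_imp_in_ideal[OF pts _ g(1)])
    fix x assume "x \<in> pt ` ?A"
    then show "ev fps_const x g = 0" using permutation_in_stab g by (auto simp: stab_def)
  next
    fix r :: "'a mpoly" assume r: "r \<in> mpolys UNIV 1" "\<And>x. x \<in> pt ` ?A \<Longrightarrow> ev fps_const x r = 0"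
    obtain p where p: "p = 0 \<Longrightarrow> r = 0"
      "\<And>(h :: 'a \<Rightarrow> 'a fps) x. comm_ring_hom h \<Longrightarrow> ev h x r = poly (map_poly h p) (x 0)"
      using mpolys_1_as_poly[OF r(1)] by blast
    have "ev fps_const (pt (id, 1)) r = 0" by (intro r(2) imageI SigmaI CollectI permutes_id singletonI)
    then have "poly (map_poly fps_const p) (y 0) = 0"
      using p(2)[OF comm_ring_hom_fps_const, of y] by simp
    then have "p = 0" by (rule fps_transcendental[OF transc])
    then show "r = 0" by (rule p(1))
  qed
qed

end

text \<open>The ideal is the kernel of evaluation at the power series point, and power series over a
  field form a domain.\<close>

theorem trinomial_ideal_prime:
  fixes g h :: "'a::alg_closed_field mpoly"
  assumes n: "n \<ge> 2" and char: "of_nat n \<noteq> (0::'a)" "of_nat (n - 1) \<noteq> (0::'a)"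
    and gh: "g \<in> mpolys UNIV n" "h \<in> mpolys UNIV n" "g * h \<in> trinomial_ideal n"
  shows "g \<in> trinomial_ideal n \<or> h \<in> trinomial_ideal n"
proof -
  show ?thesis
  proof (rule fps_root_tuple[OF n char])
    fix y :: "nat \<Rightarrow> 'a fps" and T c
    assume y: "(\<Prod>i<n. [:- y i, 1:]) = Polynomial.monom 1 n - [:0, 1:] + [:T:]"
      "inj_on y {..<n}" "fps_nth (y 0) 0 = fps_nth (y 1) 0" "\<And>i. i < n \<Longrightarrow> fps_nth (y i) 0 \<noteq> 0"
      "\<And>a. y 0 \<noteq> fps_const a" "fps_nth c 0 = 0" "y 0 oo c = y 1" "y 1 oo c = y 0"
      "\<And>i. i \<in> {2..<n} \<Longrightarrow> y i oo c = y i"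
    interpret generic_roots n y T c by (intro generic_roots.intro n char y)
    have "ev fps_const y g * ev fps_const y h = ev fps_const y (g * h)" by (rule fc.ev_mult[symmetric])
    also have "\<dots> = 0" by (rule ev_trinomial_ideal[OF comm_ring_hom_fps_const y(1) gh(3)])
    finally show ?thesis using vanishing_at_generic_point gh by auto
  qed
qed

section \<open>The curve over the base field\<close>

lemma poly_as_sum_lessThan:
  assumes "Polynomial.degree p < n"
  shows "poly p z = (\<Sum>j<n. Polynomial.coeff p j * (z::'a::comm_semiring_1) ^ j)"
  unfolding poly_altdef
  by (rule sum.mono_neutral_left) (use assms in \<open>auto simp: coeff_eq_0\<close>)

text \<open>Column \<open>i\<close> of \<open>U\<close> holds the coefficients of the Lagrange
  polynomial \<open>L i\<close>. The second identity says that \<open>X^l\<close> is the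
  interpolation of its own values.\<close>

lemma vandermonde_inverse:
  fixes x :: "nat \<Rightarrow> 'a::field"
  assumes "inj_on x {..<n}"
  shows "\<exists>U. (\<forall>l<n. \<forall>i<n. (\<Sum>j<n. x l ^ j * U j i) = (if l = i then 1 else 0)) \<and>
    (\<forall>j<n. \<forall>l<n. (\<Sum>i<n. U j i * x i ^ l) = (if j = l then 1 else 0))"
proof -
  define L where "L i = (\<Prod>l\<in>{..<n} - {i}. Polynomial.smult (inverse (x i - x l)) [:- x l, 1:])" for i
  define U where "U j i = Polynomial.coeff (L i) j" for j i
  have ne: "x l \<noteq> x i" if "l < n" "i < n" "l \<noteq> i" for l i
    using assms that by (auto dest: inj_onD)
  have eval: "poly (L i) (x l) = (if l = i then 1 else 0)" if "l < n" "i < n" for l i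
  proof (cases "l = i")
    case True
    have "poly (Polynomial.smult (inverse (x i - x m)) [:- x m, 1:]) (x i) = 1" if "m \<in> {..<n} - {i}" for m
    proof -
      have "x i - x m \<noteq> 0" using ne[of m i] that \<open>i < n\<close> by auto
      moreover have "poly (Polynomial.smult c [:- a, 1:]) z = c * (z - a)" for a c z :: 'a
        by (simp add: algebra_simps)
      ultimately show ?thesis by (simp only: left_inverse not_False_eq_True)
    qed
    then show ?thesis unfolding L_def poly_prod True by (simp del: poly_smult)
  next
    case False
    then show ?thesis using that by (auto simp: L_def poly_prod intro!: prod_zero bexI[of _ l])
  qed
  have deg: "Polynomial.degree (L i) < n" if "i < n" for i
  proof -
    have "Polynomial.degree (L i) \<le> (\<Sum>l\<in>{..<n} - {i}. Polynomial.degree (Polynomial.smult (inverse (x i - x l)) [:- x l, 1:]))"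
      unfolding L_def by (rule degree_prod_sum_le[unfolded comp_def]) simp
    also have "\<dots> \<le> (\<Sum>l\<in>{..<n} - {i}. 1)"
      by (intro sum_mono) simp
    also have "\<dots> = n - 1" using that by simp
    finally show ?thesis using that by simp
  qed
  show ?thesis
  proof (intro exI[of _ U] conjI allI impI)
    show "(\<Sum>j<n. x l ^ j * U j i) = (if l = i then 1 else 0)" if "l < n" "i < n" for l i
      using poly_as_sum_lessThan[OF deg[OF that(2)], of "x l"] eval[OF that]
      by (simp add: U_def mult.commute)
    show "(\<Sum>i<n. U j i * x i ^ l) = (if j = l then 1 else 0)" if "j < n" "l < n" for j l
    proof -
      have eq: "(\<Sum>i<n. Polynomial.smult (x i ^ l) (L i)) = Polynomial.monom 1 l"
      proof (rule poly_eqI_degree[of "x ` {..<n}"])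
        have card: "card (x ` {..<n}) = n" using assms by (simp add: card_image)
        have "Polynomial.coeff (\<Sum>i<n. Polynomial.smult (x i ^ l) (L i)) k = 0" if k: "k \<ge> n" for k
          unfolding coeff_sum
        proof (intro sum.neutral ballI)
          fix i assume "i \<in> {..<n}"
          then have "Polynomial.degree (L i) < k" using deg[of i] k by simp
          then show "Polynomial.coeff (Polynomial.smult (x i ^ l) (L i)) k = 0" by (simp add: coeff_eq_0)
        qed
        then show "card (x ` {..<n}) > Polynomial.degree (\<Sum>i<n. Polynomial.smult (x i ^ l) (L i))"
          unfolding card using that by (intro degree_lessI) auto
        show "card (x ` {..<n}) > Polynomial.degree (Polynomial.monom (1::'a) l)"
          using that unfolding card by (simp add: degree_monom_eq)
        fix z assume "z \<in> x ` {..<n}"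
        then obtain m where m: "m < n" "z = x m" by auto
        have "poly (\<Sum>i<n. Polynomial.smult (x i ^ l) (L i)) z = (\<Sum>i<n. if i = m then x i ^ l else 0)"
          unfolding poly_sum m(2) by (rule sum.cong) (use eval m in auto)
        then show "poly (\<Sum>i<n. Polynomial.smult (x i ^ l) (L i)) z = poly (Polynomial.monom 1 l) z"
          using m by (simp add: poly_monom)
      qed
      have "Polynomial.coeff (\<Sum>i<n. Polynomial.smult (x i ^ l) (L i)) j = (if j = l then 1 else 0)"
        unfolding eq coeff_monom by auto
      then show ?thesis by (simp add: coeff_sum U_def mult.commute)
    qed
  qed
qed

section \<open>Characteristic polynomials over a subring\<close>

lemma det_in_subring:
  assumes "A \<in> carrier_mat n n" "subring_set S" "\<And>i j. i < n \<Longrightarrow> j < n \<Longrightarrow> A $$ (i, j) \<in> S"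
  shows "det A \<in> S"
proof -
  note S = subring_setD[OF assms(2)]
  have sign: "signof p \<in> S" for p :: "nat \<Rightarrow> nat"
    by (simp add: sign_def S)
  have prod: "(\<Prod>i = 0..<n. A $$ (i, p i)) \<in> S" if p: "p permutes {0..<n}" for p
  proof (rule subring_set_prod[OF assms(2)])
    fix i assume "i \<in> {0..<n}"
    then show "A $$ (i, p i) \<in> S" using assms(3) permutes_in_image[OF p, of i] by simp
  qed
  show ?thesis
    unfolding det_def'[OF assms(1)]
    by (rule subring_set_sum[OF assms(2)], rule S(4)[OF sign prod]) simp
qed

lemma char_poly_in_subring:
  assumes "A \<in> carrier_mat n n" "subring_set S" "\<And>i j. i < n \<Longrightarrow> j < n \<Longrightarrow> A $$ (i, j) \<in> S"
  shows "coeffs_in S (char_poly A)"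
proof -
  note S = subring_setD[OF assms(2)]
  have "subring_set {p. coeffs_in S p}"
    unfolding subring_set_def
    using coeffs_in_diff[OF assms(2)] coeffs_in_mult[OF assms(2)] coeffs_in_pCons[OF S(1) coeffs_in_0[OF assms(2)]]
    by (simp add: one_pCons)
  then have "det (char_poly_matrix A) \<in> {p. coeffs_in S p}"
  proof (rule det_in_subring[OF char_poly_matrix_closed[OF assms(1)]])
    fix i j assume ij: "i < n" "j < n"
    have "char_poly_matrix A $$ (i, j) = (if i = j then [:0, 1:] else 0) + [:- A $$ (i, j):]"
      using assms(1) ij by (auto simp: char_poly_matrix_def)
    moreover have "coeffs_in S (if i = j then [:0, 1:] else 0)"
      by (simp add: coeffs_in_pCons coeffs_in_0[OF assms(2)] S)
    moreover have "coeffs_in S [:- A $$ (i, j):]"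
      by (intro coeffs_in_pCons coeffs_in_0 assms S ij)
    ultimately show "char_poly_matrix A $$ (i, j) \<in> {p. coeffs_in S p}"
      using coeffs_in_add[OF assms(2)] by simp
  qed
  then show ?thesis by (simp add: char_poly_def)
qed

lemma char_poly_diagonal:
  fixes d :: "nat \<Rightarrow> 'a::comm_ring_1"
  shows "char_poly (mat n n (\<lambda>(i, j). if i = j then d i else 0)) = (\<Prod>i<n. [:- d i, 1:])"
proof -
  let ?D = "mat n n (\<lambda>(i, j). if i = j then d i else 0)"
  have D: "?D \<in> carrier_mat n n" by simp
  have "upper_triangular ?D" by (auto simp: upper_triangular_def)
  from det_upper_triangular[OF char_poly_matrix_upper_triangular[OF D this] char_poly_matrix_closed[OF D]]
  have "char_poly ?D = prod_list (diag_mat (char_poly_matrix ?D))"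
    unfolding char_poly_def .
  also have "\<dots> = (\<Prod>i = 0..<n. [:- d i, 1:])"
    unfolding prod_list_diag_prod by (rule prod.cong) (auto simp: char_poly_matrix_def)
  finally show ?thesis by (simp add: lessThan_atLeast0)
qed

text \<open>The elements \<open>\<Sum>j. c j * x^j\<close> of the algebra \<open>k[x]/(f)\<close>, with \<open>c\<close> a tuple of variables: the
  characteristic polynomial of multiplication has coefficients over the base field, and over the
  algebraic closure it factors into the conjugates.\<close>

locale base_tuple =
  fixes n :: nat and f :: "'k::field poly" and x :: "nat \<Rightarrow> 'k alg_closure"
  assumes n: "n \<ge> 2" and f0: "f \<noteq> 0" and degf: "Polynomial.degree f = n"
    and injx: "inj_on x {..<n}" and roots: "\<And>i. i < n \<Longrightarrow> poly (map_poly to_ac f) (x i) = 0"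
begin

definition conj_form :: "nat \<Rightarrow> 'k alg_closure mpoly" where
  "conj_form i = (\<Sum>j<n. Const (x i ^ j) * Var j)"

definition norm_poly :: "'k alg_closure mpoly poly" where
  "norm_poly = (\<Prod>i<n. [:- conj_form i, 1:])"

definition curve_eqs :: "'k alg_closure mpoly set" where
  "curve_eqs = Polynomial.coeff (norm_poly - (Polynomial.monom 1 n - [:0, 1:])) ` {1..<n}"

definition conj :: "(nat \<Rightarrow> 'k alg_closure) \<Rightarrow> nat \<Rightarrow> 'k alg_closure" where
  "conj c i = (\<Sum>j<n. x i ^ j * c j)"

lemma comm_ring_hom_to_ac: "comm_ring_hom (to_ac :: 'k \<Rightarrow> 'k alg_closure)"
  by unfold_locales auto

text \<open>The conjugates are not defined over the base field, but the polynomial having them as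
  roots is the characteristic polynomial of multiplication by the generic element in the basis of
  powers of \<open>x\<close>. The matrix \<open>M\<close> of this multiplication has entries over
  the base field, and the Vandermonde matrix \<open>W\<close> diagonalises it.\<close>

lemma coeffs_norm_poly: "coeffs_in (mpolys (range to_ac) n) norm_poly"
proof -
  interpret t: comm_ring_hom "to_ac :: 'k \<Rightarrow> 'k alg_closure" by (rule comm_ring_hom_to_ac)
  interpret mt: map_poly_comm_ring_hom "to_ac :: 'k \<Rightarrow> 'k alg_closure" ..
  from vandermonde_inverse[OF injx] obtain U where
    "(\<forall>l<n. \<forall>i<n. (\<Sum>j<n. x l ^ j * U j i) = (if l = i then 1 else 0)) \<and>
      (\<forall>j<n. \<forall>l<n. (\<Sum>i<n. U j i * x i ^ l) = (if j = l then 1 else 0))" ..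
  then have U: "\<And>l i. l < n \<Longrightarrow> i < n \<Longrightarrow> (\<Sum>j<n. x l ^ j * U j i) = (if l = i then 1 else 0)"
    "\<And>j l. j < n \<Longrightarrow> l < n \<Longrightarrow> (\<Sum>i<n. U j i * x i ^ l) = (if j = l then 1 else 0)" by simp_all
  \<comment> \<open>The structure constants of \<open>k[x]/(f)\<close>: coefficient \<open>j\<close>
    of \<open>x^(l + k)\<close> reduced modulo \<open>f\<close>.\<close>
  define m where "m l k j = Polynomial.coeff (Polynomial.monom 1 (l + k) mod f) j" for l k j
  define M where "M = mat n n (\<lambda>(j, k). \<Sum>l<n. Const (to_ac (m l k j)) * Var l)"
  define W where "W = mat n n (\<lambda>(i, j). Const (x i ^ j))"
  define V where "V = mat n n (\<lambda>(j, i). Const (U j i))"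
  define D where "D = mat n n (\<lambda>(i, j). if i = j then conj_form i else 0)"
  have carrier: "M \<in> carrier_mat n n" "W \<in> carrier_mat n n" "V \<in> carrier_mat n n" "D \<in> carrier_mat n n"
    by (simp_all add: M_def W_def V_def D_def)
  have red: "(\<Sum>j<n. x i ^ j * to_ac (m l k j)) = x i ^ (l + k)" if i: "i < n" for i l k
  proof -
    let ?p = "Polynomial.monom 1 (l + k) :: 'k poly"
    have "Polynomial.degree (?p mod f) < n"
      using degree_mod_less[OF f0, of ?p] degf n by auto
    then have "Polynomial.degree (map_poly to_ac (?p mod f)) < n"
      using degree_map_poly_le[of to_ac "?p mod f"] by simp
    from poly_as_sum_lessThan[OF this, of "x i"]
    have "poly (map_poly to_ac (?p mod f)) (x i) = (\<Sum>j<n. x i ^ j * to_ac (m l k j))"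
      by (simp add: m_def coeff_map_poly mult.commute)
    moreover have "map_poly to_ac ?p = map_poly to_ac (?p div f) * map_poly to_ac f + map_poly to_ac (?p mod f)"
      by (simp flip: mt.hom_mult mt.hom_add)
    then have "poly (map_poly to_ac (?p mod f)) (x i) = poly (map_poly to_ac ?p) (x i)"
      using roots[OF i] by simp
    ultimately show ?thesis by (simp add: map_poly_monom poly_monom)
  qed
  have VW: "V * W = 1\<^sub>m n"
  proof (rule eq_matI)
    fix i j assume "i < dim_row (1\<^sub>m n :: 'k alg_closure mpoly mat)" "j < dim_col (1\<^sub>m n :: 'k alg_closure mpoly mat)"
    then have ij: "i < n" "j < n" by auto
    have "(V * W) $$ (i, j) = (\<Sum>l<n. Const (U i l) * Const (x l ^ j))"
      using ij by (simp add: V_def W_def scalar_prod_def lessThan_atLeast0)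
    also have "\<dots> = Const (\<Sum>l<n. U i l * x l ^ j)" by (simp only: Const.hom_sum Const.hom_mult)
    finally show "(V * W) $$ (i, j) = 1\<^sub>m n $$ (i, j)" using ij U(2) by simp
  qed (simp_all add: V_def W_def)
  have WV: "W * V = 1\<^sub>m n"
  proof (rule eq_matI)
    fix i j assume "i < dim_row (1\<^sub>m n :: 'k alg_closure mpoly mat)" "j < dim_col (1\<^sub>m n :: 'k alg_closure mpoly mat)"
    then have ij: "i < n" "j < n" by auto
    have "(W * V) $$ (i, j) = (\<Sum>l<n. Const (x i ^ l) * Const (U l j))"
      using ij by (simp add: V_def W_def scalar_prod_def lessThan_atLeast0)
    also have "\<dots> = Const (\<Sum>l<n. x i ^ l * U l j)" by (simp only: Const.hom_sum Const.hom_mult)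
    finally show "(W * V) $$ (i, j) = 1\<^sub>m n $$ (i, j)" using ij U(1) by simp
  qed (simp_all add: V_def W_def)
  \<comment> \<open>Row \<open>i\<close> of \<open>W\<close> is evaluation at \<open>x i\<close>.
    Since evaluation is multiplicative and kills \<open>f\<close>, the row is a left eigenvector of
    \<open>M\<close> with eigenvalue \<open>conj_form i\<close>.\<close>
  have WM: "W * M = D * W"
  proof (rule eq_matI)
    fix i k assume "i < dim_row (D * W)" "k < dim_col (D * W)"
    then have ik: "i < n" "k < n" by (auto simp: D_def W_def)
    have "(W * M) $$ (i, k) = (\<Sum>j<n. Const (x i ^ j) * (\<Sum>l<n. Const (to_ac (m l k j)) * Var l))"
      using ik by (simp add: M_def W_def scalar_prod_def lessThan_atLeast0)
    also have "\<dots> = (\<Sum>l<n. (\<Sum>j<n. Const (x i ^ j) * Const (to_ac (m l k j))) * Var l)"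
      by (simp only: sum_distrib_left sum_distrib_right, subst sum.swap, simp only: mult.assoc)
    also have "\<dots> = (\<Sum>l<n. Const (\<Sum>j<n. x i ^ j * to_ac (m l k j)) * Var l)"
      by (simp only: Const.hom_sum Const.hom_mult)
    also have "\<dots> = (\<Sum>l<n. Const (x i ^ l) * Var l * Const (x i ^ k))"
      unfolding red[OF ik(1)] by (simp only: power_add Const.hom_mult mult_ac)
    also have "\<dots> = conj_form i * Const (x i ^ k)" by (simp only: conj_form_def sum_distrib_right)
    also have "\<dots> = (\<Sum>j<n. if j = i then conj_form i * Const (x i ^ k) else 0)"
      using ik by simp
    also have "\<dots> = (\<Sum>j<n. (if i = j then conj_form i else 0) * Const (x j ^ k))"
      by (rule sum.cong) auto
    also have "\<dots> = (D * W) $$ (i, k)"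
      using ik by (simp add: D_def W_def scalar_prod_def lessThan_atLeast0)
    finally show "(W * M) $$ (i, k) = (D * W) $$ (i, k)" .
  qed (simp_all add: M_def W_def D_def)
  have "M = V * D * W"
  proof -
    have "V * D * W = V * (D * W)" using carrier by (simp add: assoc_mult_mat)
    also have "\<dots> = V * (W * M)" by (simp only: WM)
    also have "\<dots> = V * W * M" using carrier by (simp add: assoc_mult_mat)
    finally show ?thesis using VW carrier by simp
  qed
  then have "similar_mat M D"
    by (intro similar_matI[where P = V and Q = W and n = n]) (use carrier VW WV in auto)
  then have "char_poly M = norm_poly"
    unfolding norm_poly_def D_def char_poly_diagonal[symmetric] by (rule char_poly_similar)
  moreover have "coeffs_in (mpolys (range to_ac) n) (char_poly M)"
  proof (rule char_poly_in_subring[OF carrier(1)])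
    have r: "subring_set (range (to_ac :: 'k \<Rightarrow> _))" by (rule subring_set_range[OF comm_ring_hom_to_ac])
    show r': "subring_set (mpolys (range (to_ac :: 'k \<Rightarrow> _)) n)" by (rule subring_set_mpolys[OF r])
    fix i j assume "i < n" "j < n"
    then have "M $$ (i, j) = (\<Sum>l<n. Const (to_ac (m l j i)) * Var l)" by (simp add: M_def)
    also have "\<dots> \<in> mpolys (range to_ac) n"
      by (intro subring_set_sum[OF r'] subring_setD(4)[OF r'] Const_in_mpolys[OF r] Var_in_mpolys[OF r]) auto
    finally show "M $$ (i, j) \<in> mpolys (range to_ac) n" .
  qed
  ultimately show ?thesis by simp
qed

end

section \<open>The curve and its linear change of coordinates\<close>

lemmas ev_id_simps =
  comm_ring_hom.ev_add[OF comm_ring_hom_id] comm_ring_hom.ev_mult[OF comm_ring_hom_id]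
  comm_ring_hom.ev_Const[OF comm_ring_hom_id] comm_ring_hom.ev_Var[OF comm_ring_hom_id]
  comm_ring_hom.ev_sum[OF comm_ring_hom_id] comm_ring_hom.ev_0[OF comm_ring_hom_id]

lemma root_tuples_iff:
  fixes y :: "nat \<Rightarrow> 'a::idom"
  assumes n: "n \<ge> 2"
  shows "y \<in> root_tuples n \<longleftrightarrow>
    (\<forall>k\<in>{1..<n}. Polynomial.coeff ((\<Prod>i<n. [:- y i, 1:]) - (Polynomial.monom 1 n - [:0, 1:])) k = 0)"
    (is "_ \<longleftrightarrow> (\<forall>k\<in>_. Polynomial.coeff ?R k = 0)")
proof
  assume "y \<in> root_tuples n"
  then obtain b where "(\<Prod>i<n. [:- y i, 1:]) = Polynomial.monom 1 n - [:0, 1:] + [:b:]"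
    unfolding root_tuples_def by blast
  then have R: "?R = [:b:]" by simp
  show "\<forall>k\<in>{1..<n}. Polynomial.coeff ?R k = 0"
    unfolding R by (auto simp: coeff_pCons split: nat.split)
next
  assume R: "\<forall>k\<in>{1..<n}. Polynomial.coeff ?R k = 0"
  note P = linear_prod[of "{..<n}" y, simplified]
  have "Polynomial.coeff ?R k = Polynomial.coeff [:Polynomial.coeff ?R 0:] k" for k
  proof -
    consider "k = 0" | "k \<in> {1..<n}" | "k \<ge> n" by fastforce
    then show ?thesis
    proof cases
      case 2
      then have "Polynomial.coeff ?R k = 0" using R by blast
      moreover have "Polynomial.coeff [:Polynomial.coeff ?R 0:] k = 0"
        using 2 by (cases k) simp_all
      ultimately show ?thesis by (simp only:)
    next
      case 3
      have "Polynomial.coeff (\<Prod>i<n. [:- y i, 1:]) k = (if k = n then 1 else 0)"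
        using P 3 by (auto intro: coeff_eq_0)
      then show ?thesis using 3 n by (simp add: coeff_pCons split: nat.split)
    qed simp
  qed
  then have "?R = [:Polynomial.coeff ?R 0:]" by (rule poly_eqI)
  then have "(\<Prod>i<n. [:- y i, 1:]) = Polynomial.monom 1 n - [:0, 1:] + [:Polynomial.coeff ?R 0:]"
    by (metis add_diff_cancel_left' diff_add_cancel add.commute)
  then show "y \<in> root_tuples n" unfolding root_tuples_def by blast
qed

lemma root_tuples_cong:
  assumes "\<And>i. i < n \<Longrightarrow> y i = z i" "y \<in> root_tuples n"
  shows "z \<in> root_tuples n"
proof -
  have "(\<Prod>i<n. [:- y i, 1:]) = (\<Prod>i<n. [:- z i, 1:])"
    by (rule prod.cong) (use assms(1) in auto)
  then show ?thesis using assms(2) by (simp add: root_tuples_def)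
qed

context base_tuple
begin

lemma conj_form_in_mpolys: "conj_form i \<in> mpolys UNIV n"
proof -
  note ring = subring_set_mpolys[OF subring_set_UNIV, where 'a = "'k alg_closure" and n = n]
  show ?thesis unfolding conj_form_def
    by (intro subring_set_sum[OF ring] subring_setD(4)[OF ring] Const_in_mpolys Var_in_mpolys) auto
qed

lemma ev_conj_form: "ev (\<lambda>c. c) c (conj_form i) = conj c i"
  by (simp add: conj_form_def conj_def ev_id_simps)

lemma msubst_trinomial_relation:
  "msubst conj_form (Polynomial.coeff (trinomial_relation n) k) =
    Polynomial.coeff (norm_poly - (Polynomial.monom 1 n - [:0, 1:])) k"
proof -
  interpret e: comm_ring_hom "msubst conj_form" by (rule Const.comm_ring_hom_ev)
  interpret m: map_poly_comm_ring_hom "msubst conj_form" ..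
  have "map_poly (msubst conj_form) (trinomial_relation n) = norm_poly - (Polynomial.monom 1 n - [:0, 1:])"
    unfolding trinomial_relation_def norm_poly_def m.hom_minus m.hom_prod
    by (simp add: e.map_poly_pCons_hom map_poly_monom Const.ev_Var e.hom_uminus)
  from arg_cong[OF this, of "\<lambda>p. Polynomial.coeff p k"] show ?thesis by simp
qed

lemma map_poly_ev_norm_poly: "map_poly (ev (\<lambda>c. c) c) norm_poly = (\<Prod>i<n. [:- conj c i, 1:])"
proof -
  interpret e: comm_ring_hom "ev (\<lambda>c. c) c" by (rule comm_ring_hom.comm_ring_hom_ev[OF comm_ring_hom_id])
  interpret m: map_poly_comm_ring_hom "ev (\<lambda>c. c) c" ..
  show ?thesis unfolding norm_poly_def m.hom_prod
    by (simp add: e.map_poly_pCons_hom ev_conj_form e.hom_uminus)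
qed

lemma ev_curve_eq:
  "ev (\<lambda>c. c) c (Polynomial.coeff (norm_poly - (Polynomial.monom 1 n - [:0, 1:])) k) =
    Polynomial.coeff ((\<Prod>i<n. [:- conj c i, 1:]) - (Polynomial.monom 1 n - [:0, 1:])) k"
proof -
  interpret e: comm_ring_hom "ev (\<lambda>c. c) c" by (rule comm_ring_hom.comm_ring_hom_ev[OF comm_ring_hom_id])
  interpret m: map_poly_comm_ring_hom "ev (\<lambda>c. c) c" ..
  have "map_poly (ev (\<lambda>c. c) c) (norm_poly - (Polynomial.monom 1 n - [:0, 1:])) =
      (\<Prod>i<n. [:- conj c i, 1:]) - (Polynomial.monom 1 n - [:0, 1:])"
    unfolding m.hom_minus map_poly_ev_norm_poly by (simp add: map_poly_monom e.map_poly_pCons_hom)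
  from arg_cong[OF this, of "\<lambda>p. Polynomial.coeff p k"] show ?thesis by simp
qed

definition curve :: "(nat \<Rightarrow> 'k alg_closure) set" where
  "curve = zero_locus n curve_eqs"

lemma curve_iff: "c \<in> curve \<longleftrightarrow> c \<in> affine_space n \<and> conj c \<in> root_tuples n"
  unfolding curve_def zero_locus_def curve_eqs_def eval_mpoly_conv_ev root_tuples_iff[OF n]
    mem_Collect_eq ball_simps(9) ev_curve_eq ..

lemma curve_eqs_over_base: "curve_eqs \<subseteq> mpolys (range to_ac) n"
proof -
  note ring = subring_set_mpolys[OF subring_set_range[OF comm_ring_hom_to_ac], where n = n]
  have "coeffs_in (mpolys (range to_ac) n) (norm_poly - (Polynomial.monom 1 n - [:0, 1:]))"
  proof (intro coeffs_in_diff[OF ring] coeffs_norm_poly coeffs_in_pCons coeffs_in_0[OF ring])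
    show "coeffs_in (mpolys (range to_ac) n) (Polynomial.monom (1 :: 'k alg_closure mpoly) n)"
      unfolding coeffs_in_def coeff_monom using subring_setD(1,2)[OF ring] by simp
  qed (rule subring_setD[OF ring])+
  then show ?thesis unfolding curve_eqs_def coeffs_in_def by blast
qed

text \<open>Passing from \<open>c\<close> to its conjugates is invertible because the Vandermonde
  matrix is. The inverse is needed on points and on polynomials, hence the two forms;
  \<open>undefined\<close> from \<open>n\<close> on puts the preimage into
  \<open>affine_space\<close>.\<close>

lemma conj_surjective:
  obtains U where "\<And>y i. i < n \<Longrightarrow> conj (\<lambda>j. if j < n then \<Sum>i<n. U j i * y i else undefined) i = y i"
    "\<And>j. j < n \<Longrightarrow> msubst conj_form (\<Sum>i<n. Const (U j i) * Var i) = Var j"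
proof -
  from vandermonde_inverse[OF injx] obtain U where
    "(\<forall>l<n. \<forall>i<n. (\<Sum>j<n. x l ^ j * U j i) = (if l = i then 1 else 0)) \<and>
      (\<forall>j<n. \<forall>l<n. (\<Sum>i<n. U j i * x i ^ l) = (if j = l then 1 else 0))" ..
  then have U: "\<And>l i. l < n \<Longrightarrow> i < n \<Longrightarrow> (\<Sum>j<n. x l ^ j * U j i) = (if l = i then 1 else 0)"
    "\<And>j l. j < n \<Longrightarrow> l < n \<Longrightarrow> (\<Sum>i<n. U j i * x i ^ l) = (if j = l then 1 else 0)" by simp_all
  show ?thesis
  proof (rule that[of U])
    fix y :: "nat \<Rightarrow> 'k alg_closure" and i assume i: "i < n"
    have "conj (\<lambda>j. if j < n then \<Sum>i<n. U j i * y i else undefined) i = (\<Sum>j<n. x i ^ j * (\<Sum>l<n. U j l * y l))"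
      unfolding conj_def by (rule sum.cong) auto
    also have "\<dots> = (\<Sum>l<n. (\<Sum>j<n. x i ^ j * U j l) * y l)"
      by (simp only: sum_distrib_left sum_distrib_right, subst sum.swap, simp only: mult.assoc)
    also have "\<dots> = (\<Sum>l<n. (if i = l then 1 else 0) * y l)"
      by (rule sum.cong) (use U(1) i in auto)
    also have "\<dots> = (\<Sum>l<n. if l = i then y l else 0)" by (rule sum.cong) auto
    also have "\<dots> = y i" using i by simp
    finally show "conj (\<lambda>j. if j < n then \<Sum>i<n. U j i * y i else undefined) i = y i" .
  next
    fix j assume j: "j < n"
    have "msubst conj_form (\<Sum>i<n. Const (U j i) * Var i) = (\<Sum>i<n. Const (U j i) * conj_form i)"
      by (simp add: Const.ev_sum Const.ev_mult Const.ev_Const Const.ev_Var)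
    also have "\<dots> = (\<Sum>l<n. (\<Sum>i<n. Const (U j i) * Const (x i ^ l)) * Var l)"
      unfolding conj_form_def
      by (simp only: sum_distrib_left sum_distrib_right, subst sum.swap, simp only: mult.assoc)
    also have "\<dots> = (\<Sum>l<n. Const (\<Sum>i<n. U j i * x i ^ l) * Var l)"
      by (simp only: Const.hom_sum Const.hom_mult)
    also have "\<dots> = (\<Sum>l<n. if l = j then Var l else 0)"
      by (rule sum.cong) (use U(2) j in auto)
    also have "\<dots> = Var j" using j by simp
    finally show "msubst conj_form (\<Sum>i<n. Const (U j i) * Var i) = Var j" .
  qed
qed

text \<open>Substituting the conjugates for the roots turns the universal equations into those of
  the curve, generator by generator.\<close>

lemma msubst_trinomial_ideal:
  assumes "p \<in> trinomial_ideal n"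
  shows "msubst conj_form p \<in> generated_ideal n curve_eqs"
  using assms unfolding trinomial_ideal_def
proof (induction rule: generated_ideal_induct)
  case zero
  then show ?case by (simp add: Const.ev_0 generated_ideal_0)
next
  case (add p q)
  then show ?case by (simp add: Const.ev_add generated_ideal_add)
next
  case (mult a f)
  then obtain k where "k \<in> {1..<n}" "f = Polynomial.coeff (trinomial_relation n) k" by blast
  then have "msubst conj_form f \<in> curve_eqs"
    unfolding curve_eqs_def using msubst_trinomial_relation by blast
  moreover have "msubst conj_form a \<in> mpolys UNIV n"
    using mult(1) conj_form_in_mpolys by (intro msubst_in_mpolys)
  ultimately show ?case
    by (simp add: Const.ev_mult generated_ideal_mult generated_ideal_base)
qed

text \<open>Radicality and primality are carried over from \<open>trinomial_ideal\<close> along the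
  linear substitution \<open>w\<close> inverse to \<open>conj_form\<close>: move to root
  coordinates, apply the result there, substitute back.\<close>

lemma curve_ideals:
  assumes char: "of_nat n \<noteq> (0::'k alg_closure)" "of_nat (n - 1) \<noteq> (0::'k alg_closure)"
  shows "\<And>g. g \<in> mpolys UNIV n \<Longrightarrow> (\<And>c. c \<in> curve \<Longrightarrow> ev (\<lambda>c. c) c g = 0) \<Longrightarrow> g \<in> generated_ideal n curve_eqs"
    and "\<And>g h. g \<in> mpolys UNIV n \<Longrightarrow> h \<in> mpolys UNIV n \<Longrightarrow> (\<And>c. c \<in> curve \<Longrightarrow> ev (\<lambda>c. c) c (g * h) = 0) \<Longrightarrow>
      g \<in> generated_ideal n curve_eqs \<or> h \<in> generated_ideal n curve_eqs"
proof -
  have "\<exists>w. (\<forall>j. w j \<in> mpolys UNIV n) \<and>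
    (\<forall>g\<in>mpolys UNIV n. msubst conj_form (msubst w g) = g \<and>
      ((\<forall>c\<in>curve. ev (\<lambda>c. c) c g = 0) \<longrightarrow> msubst w g \<in> trinomial_ideal n))"
  proof (rule conj_surjective)
    fix U assume U: "\<And>y i. i < n \<Longrightarrow> conj (\<lambda>j. if j < n then \<Sum>i<n. U j i * y i else undefined) i = y i"
      "\<And>j. j < n \<Longrightarrow> msubst conj_form (\<Sum>i<n. Const (U j i) * Var i) = Var j"
    define w where "w = (\<lambda>j. \<Sum>i<n. Const (U j i) * Var i)"
    note ring = subring_set_mpolys[OF subring_set_UNIV, where 'a = "'k alg_closure" and n = n]
    have w: "w j \<in> mpolys UNIV n" for j
      unfolding w_def
      by (intro subring_set_sum[OF ring] subring_setD(4)[OF ring] Const_in_mpolys Var_in_mpolys) auto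
    have inv: "msubst conj_form (msubst w g) = g" if g: "g \<in> mpolys UNIV n" for g
    proof -
      have "msubst conj_form (msubst w g) = msubst (\<lambda>j. msubst conj_form (w j)) g"
        by (rule ev_msubst[OF comm_ring_hom_Const g])
      also have "\<dots> = msubst Var g"
        by (rule ev_cong[OF comm_ring_hom_Const g]) (simp add: w_def U(2))
      also have "\<dots> = g" by (rule msubst_Var[OF g])
      finally show ?thesis .
    qed
    have van: "msubst w g \<in> trinomial_ideal n" if g: "g \<in> mpolys UNIV n" "\<forall>c\<in>curve. ev (\<lambda>c. c) c g = 0" for g
    proof (rule vanishing_on_root_tuples[OF n char(1)])
      show "msubst w g \<in> mpolys UNIV n" by (rule msubst_in_mpolys[OF g(1) w])
      fix y :: "nat \<Rightarrow> 'k alg_closure" assume y: "y \<in> root_tuples n"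
      define c where "c = (\<lambda>j. if j < n then \<Sum>i<n. U j i * y i else undefined)"
      have "conj c \<in> root_tuples n"
        by (rule root_tuples_cong[OF _ y]) (simp add: c_def U(1))
      moreover have "c \<in> affine_space n" by (auto simp: affine_space_def c_def PiE_def extensional_def)
      ultimately have "c \<in> curve" by (simp add: curve_iff)
      then have "ev (\<lambda>c. c) c g = 0" using g(2) by blast
      moreover have "ev (\<lambda>c. c) y (msubst w g) = ev (\<lambda>c. c) (\<lambda>j. ev (\<lambda>c. c) y (w j)) g"
        by (rule ev_msubst[OF comm_ring_hom_id g(1)])
      moreover have "ev (\<lambda>c. c) (\<lambda>j. ev (\<lambda>c. c) y (w j)) g = ev (\<lambda>c. c) c g"
        by (rule ev_cong[OF comm_ring_hom_id g(1)]) (simp add: w_def c_def ev_id_simps)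
      ultimately show "ev (\<lambda>c. c) y (msubst w g) = 0" by (simp only:)
    qed
    show ?thesis using w inv van by blast
  qed
  then obtain w where w: "\<And>j. w j \<in> mpolys UNIV n"
    "\<And>g. g \<in> mpolys UNIV n \<Longrightarrow> msubst conj_form (msubst w g) = g"
    "\<And>g. g \<in> mpolys UNIV n \<Longrightarrow> \<forall>c\<in>curve. ev (\<lambda>c. c) c g = 0 \<Longrightarrow> msubst w g \<in> trinomial_ideal n"
    by blast
  have lift: "g \<in> generated_ideal n curve_eqs" if "g \<in> mpolys UNIV n" "msubst w g \<in> trinomial_ideal n" for g
    using msubst_trinomial_ideal[OF that(2)] w(2)[OF that(1)] by simp
  show "g \<in> generated_ideal n curve_eqs" if "g \<in> mpolys UNIV n" "\<And>c. c \<in> curve \<Longrightarrow> ev (\<lambda>c. c) c g = 0" for g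
    using lift that w(3) by blast
  show "g \<in> generated_ideal n curve_eqs \<or> h \<in> generated_ideal n curve_eqs"
    if g: "g \<in> mpolys UNIV n" and h: "h \<in> mpolys UNIV n" and gh: "\<And>c. c \<in> curve \<Longrightarrow> ev (\<lambda>c. c) c (g * h) = 0" for g h
  proof -
    have "g * h \<in> mpolys UNIV n"
      using g h subring_setD(4)[OF subring_set_mpolys[OF subring_set_UNIV]] by blast
    then have "msubst w (g * h) \<in> trinomial_ideal n" using gh w(3) by blast
    then have "msubst w g * msubst w h \<in> trinomial_ideal n" by (simp add: Const.ev_mult)
    then have "msubst w g \<in> trinomial_ideal n \<or> msubst w h \<in> trinomial_ideal n"
      by (intro trinomial_ideal_prime[OF n char] msubst_in_mpolys[OF g w(1)] msubst_in_mpolys[OF h w(1)])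
    then show ?thesis using lift g h by blast
  qed
qed

end

section \<open>Rational points over a PAC field\<close>

text \<open>The product of two polynomials defines the intersection of their basic open sets, so the
  generating sets already form a basis.\<close>

lemma openin_zariski_basis:
  fixes A :: "'a::idom set"
  assumes A: "subring_set A" and U: "openin (zariski_topology A m) U" "x \<in> U"
  shows "x \<in> affine_space m \<and> (\<exists>p\<in>mpolys A m. eval_mpoly p x \<noteq> 0 \<and>
    {z \<in> affine_space m. eval_mpoly p z \<noteq> 0} \<subseteq> U)"
proof -
  let ?B = "{{x \<in> affine_space m. eval_mpoly p x \<noteq> 0} | p. p \<in> mpolys A m}"
  have "generate_topology_on ?B U"
    using U(1) unfolding zariski_topology_def by (rule openin_topology_generated_by)
  then show ?thesis using U(2)
  proof (induction U)
    case (Int a b)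
    then obtain p q where p: "p \<in> mpolys A m" "eval_mpoly p x \<noteq> 0" "{z \<in> affine_space m. eval_mpoly p z \<noteq> 0} \<subseteq> a"
      and q: "q \<in> mpolys A m" "eval_mpoly q x \<noteq> 0" "{z \<in> affine_space m. eval_mpoly q z \<noteq> 0} \<subseteq> b"
      by blast
    have e: "eval_mpoly (p * q) z = eval_mpoly p z * eval_mpoly q z" for z
      unfolding eval_mpoly_conv_ev by (rule comm_ring_hom.ev_mult[OF comm_ring_hom_id])
    have "p * q \<in> mpolys A m" using subring_setD(4)[OF subring_set_mpolys[OF A]] p q by blast
    moreover have "eval_mpoly (p * q) x \<noteq> 0" using p q e by simp
    moreover have "{z \<in> affine_space m. eval_mpoly (p * q) z \<noteq> 0} \<subseteq> a \<inter> b" using p(3) q(3) e by auto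
    ultimately show ?case using Int by blast
  qed blast+
qed

lemma openin_zariski: "p \<in> mpolys A m \<Longrightarrow> openin (zariski_topology A m) {z \<in> affine_space m. eval_mpoly p z \<noteq> 0}"
  unfolding zariski_topology_def by (rule topology_generated_by_Basis) blast

lemma topspace_zariski:
  assumes "subring_set (A :: 'a::idom set)"
  shows "topspace (zariski_topology A m) = affine_space m"
proof
  show "topspace (zariski_topology A m) \<subseteq> affine_space m"
    unfolding zariski_topology_def topology_generated_by_topspace by blast
  have "1 \<in> mpolys A m" using subring_setD(1)[OF subring_set_mpolys[OF assms]] .
  moreover have "eval_mpoly 1 z = 1" for z :: "nat \<Rightarrow> 'a"
    unfolding eval_mpoly_conv_ev
    using comm_ring_hom.ev_Const[OF comm_ring_hom_id, of z 1] by simp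
  then have "affine_space m = {z \<in> affine_space m. eval_mpoly (1 :: 'a mpoly) z \<noteq> 0}" by simp
  ultimately show "affine_space m \<subseteq> topspace (zariski_topology A m)"
    unfolding zariski_topology_def topology_generated_by_topspace by blast
qed

text \<open>Translates the topological definition into ideals: \<open>radical\<close> yields a
  variety over the base field, \<open>prime\<close> its irreducibility. Density is used through the
  open set where \<open>G\<close> does not vanish, which contains \<open>x0\<close>.\<close>

lemma pac_rational_point:
  fixes F :: "'k::field alg_closure mpoly set"
  assumes pac: "pac_field TYPE('k)" and F: "F \<subseteq> mpolys (range to_ac) m"
    and radical: "\<And>g. g \<in> mpolys UNIV m \<Longrightarrow> (\<And>c. c \<in> zero_locus m F \<Longrightarrow> ev (\<lambda>c. c) c g = 0) \<Longrightarrow> g \<in> generated_ideal m F"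
    and prime: "\<And>g h. g \<in> mpolys UNIV m \<Longrightarrow> h \<in> mpolys UNIV m \<Longrightarrow>
      (\<And>c. c \<in> zero_locus m F \<Longrightarrow> ev (\<lambda>c. c) c (g * h) = 0) \<Longrightarrow> g \<in> generated_ideal m F \<or> h \<in> generated_ideal m F"
    and G: "G \<in> mpolys (range to_ac) m" "x0 \<in> zero_locus m F" "ev (\<lambda>c. c) x0 G \<noteq> 0"
  shows "\<exists>c\<in>zero_locus m F. (\<forall>i<m. c i \<in> range to_ac) \<and> ev (\<lambda>c. c) c G \<noteq> 0"
proof -
  let ?V = "zero_locus m F"
  have toac: "comm_ring_hom (to_ac :: 'k \<Rightarrow> 'k alg_closure)" by unfold_locales auto
  have sub: "F \<subseteq> mpolys UNIV m" using F mpolys_mono[of "range to_ac" UNIV m m] by auto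
  note ring = subring_set_mpolys[OF subring_set_UNIV, where 'a = "'k alg_closure" and n = m]
  have gen_vanish: "ev (\<lambda>c. c) c g = 0" if "g \<in> generated_ideal m F" "c \<in> ?V" for g c
  proof (rule ev_generated_ideal[OF comm_ring_hom_id that(1)])
    fix f assume "f \<in> F"
    then show "ev (\<lambda>c. c) c f = 0" using that(2) unfolding zero_locus_def eval_mpoly_conv_ev by blast
  qed
  have gen_sub: "generated_ideal m F \<subseteq> mpolys UNIV m"
  proof
    fix g assume "g \<in> generated_ideal m F"
    then show "g \<in> mpolys UNIV m"
    proof (induction rule: generated_ideal_induct)
      case zero
      show ?case by (rule subring_setD(2)[OF ring])
    next
      case (add p q)
      then show ?case by (rule subring_setD(6)[OF ring])
    next
      case (mult a f)
      then have "f \<in> mpolys UNIV m" using sub by blast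
      with mult(1) show ?case by (rule subring_setD(4)[OF ring])
    qed
  qed
  have "vanishing_ideal m ?V = generated_ideal m F"
    using radical gen_vanish gen_sub unfolding vanishing_ideal_def eval_mpoly_conv_ev by blast
  then have var: "affine_variety_over_base m ?V"
    using F unfolding affine_variety_over_base_def by blast
  have sep: "\<exists>p\<in>mpolys UNIV m. eval_mpoly p x \<noteq> 0 \<and> (\<forall>z\<in>C. eval_mpoly p z = 0)"
    if C: "closedin (zariski_topology UNIV m) C" and x: "x \<in> ?V" "x \<notin> C" for C x
  proof -
    have top: "topspace (zariski_topology (UNIV :: 'k alg_closure set) m) = affine_space m"
      by (rule topspace_zariski[OF subring_set_UNIV])
    have "openin (zariski_topology UNIV m) (affine_space m - C)"
      using C unfolding closedin_def top by blast
    moreover have "x \<in> affine_space m - C" using x by (auto simp: zero_locus_def)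
    ultimately obtain p where p: "p \<in> mpolys UNIV m" "eval_mpoly p x \<noteq> 0"
      "{z \<in> affine_space m. eval_mpoly p z \<noteq> 0} \<subseteq> affine_space m - C"
      using openin_zariski_basis[OF subring_set_UNIV] by blast
    have "C \<subseteq> affine_space m" using C unfolding closedin_def top by blast
    then have "eval_mpoly p z = 0" if "z \<in> C" for z using p(3) that by blast
    then show ?thesis using p by blast
  qed
  have irr: "geometrically_irreducible m ?V"
    unfolding geometrically_irreducible_def irreducible_subspace_def topspace_zariski[OF subring_set_UNIV]
  proof (intro conjI allI impI)
    show "?V \<subseteq> affine_space m" by (auto simp: zero_locus_def)
    show "?V \<noteq> {}" using G by blast
    fix C D assume CD: "closedin (zariski_topology UNIV m) C \<and> closedin (zariski_topology UNIV m) D \<and> ?V \<subseteq> C \<union> D"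
    show "?V \<subseteq> C \<or> ?V \<subseteq> D"
    proof (rule ccontr)
      assume "\<not> ?thesis"
      then obtain a b where ab: "a \<in> ?V" "a \<notin> C" "b \<in> ?V" "b \<notin> D" by blast
      obtain p where p: "p \<in> mpolys UNIV m" "eval_mpoly p a \<noteq> 0" "\<forall>z\<in>C. eval_mpoly p z = 0"
        using sep[of C a] CD ab by blast
      obtain q where q: "q \<in> mpolys UNIV m" "eval_mpoly q b \<noteq> 0" "\<forall>z\<in>D. eval_mpoly q z = 0"
        using sep[of D b] CD ab by blast
      have "ev (\<lambda>c. c) c (p * q) = 0" if "c \<in> ?V" for c
      proof -
        have "c \<in> C \<or> c \<in> D" using CD that by blast
        then have "ev (\<lambda>c. c) c p = 0 \<or> ev (\<lambda>c. c) c q = 0"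
          using p(3) q(3) unfolding eval_mpoly_conv_ev by blast
        then show ?thesis by (auto simp: ev_id_simps)
      qed
      then have "p \<in> generated_ideal m F \<or> q \<in> generated_ideal m F" by (rule prime[OF p(1) q(1)])
      then show False using gen_vanish ab p(2) q(2) unfolding eval_mpoly_conv_ev by blast
    qed
  qed
  let ?Z = "zariski_topology (range (to_ac :: 'k \<Rightarrow> _)) m"
  let ?U = "{z \<in> affine_space m. eval_mpoly G z \<noteq> 0}"
  have "Abstract_Topology.closure_of ?Z (rational_points m ?V) = ?V"
    using pac var irr G(2) unfolding pac_field_def by blast
  then have "x0 \<in> Abstract_Topology.closure_of ?Z (rational_points m ?V)"
    using G(2) by simp
  then have dense: "\<forall>T. x0 \<in> T \<and> openin ?Z T \<longrightarrow> (\<exists>y. y \<in> rational_points m ?V \<and> y \<in> T)"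
    unfolding in_closure_of by (rule conjunct2)
  have "x0 \<in> affine_space m" using G(2) unfolding zero_locus_def by blast
  then have "x0 \<in> ?U" using G(3) unfolding eval_mpoly_conv_ev by blast
  then obtain c where "c \<in> rational_points m ?V" "c \<in> ?U"
    using dense openin_zariski[OF G(1)] by meson
  then have "c \<in> rational_points m ?V" "eval_mpoly G c \<noteq> 0" by simp_all
  then show ?thesis unfolding rational_points_def eval_mpoly_conv_ev by blast
qed

text \<open>Density on the affine line: over a finite field, \<open>G\<close> would vanish at all
  rational points of the line but not at every point of it.\<close>

lemma pac_infinite:
  assumes pac: "pac_field TYPE('k::field)"
  shows "infinite (UNIV :: 'k set)"
proof
  assume fin: "finite (UNIV :: 'k set)"
  define G :: "'k alg_closure mpoly" where "G = (\<Prod>a\<in>UNIV. Var 0 - Const (to_ac a))"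
  have toac: "comm_ring_hom (to_ac :: 'k \<Rightarrow> 'k alg_closure)" by unfold_locales auto
  note base = subring_set_range[OF toac]
  interpret e: comm_ring_hom "ev (\<lambda>c. c) z" for z :: "nat \<Rightarrow> 'k alg_closure"
    by (rule comm_ring_hom.comm_ring_hom_ev[OF comm_ring_hom_id])
  have evG: "ev (\<lambda>c. c) z G = (\<Prod>a\<in>UNIV. z 0 - to_ac a)" for z
    unfolding G_def e.hom_prod by (simp add: e.hom_minus ev_id_simps)
  have locus: "zero_locus 1 {} = (affine_space 1 :: (nat \<Rightarrow> 'k alg_closure) set)"
    by (simp add: zero_locus_def)
  have pt: "(\<lambda>i. if i < 1 then a else undefined) \<in> affine_space 1" for a :: "'k alg_closure"
    by (auto simp: affine_space_def PiE_def extensional_def)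
  have zero: "g = 0" if g: "g \<in> mpolys UNIV 1" "\<And>c. c \<in> affine_space 1 \<Longrightarrow> ev (\<lambda>c. c) c g = 0"
    for g :: "'k alg_closure mpoly"
  proof (rule mpolys_1_as_poly[OF g(1), where 'b = "'k alg_closure"])
    fix r assume r: "r = 0 \<Longrightarrow> g = 0"
      "\<And>(h :: 'k alg_closure \<Rightarrow> 'k alg_closure) x. comm_ring_hom h \<Longrightarrow> ev h x g = poly (map_poly h r) (x 0)"
    have "poly r a = 0" for a
      using r(2)[OF comm_ring_hom_id, of "\<lambda>i. if i < 1 then a else undefined"] g(2)[OF pt, of a]
      by (simp add: map_poly_idI)
    then have "r = 0" using poly_roots_finite[of r] infinite_UNIV_alg_closed[where 'a = "'k alg_closure"] by auto
    then show "g = 0" by (rule r(1))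
  qed
  have gen: "generated_ideal 1 {} = {0 :: 'k alg_closure mpoly}"
    by (auto simp: generated_ideal_def)
  have "finite (range (to_ac :: 'k \<Rightarrow> _))" using fin by simp
  then obtain a :: "'k alg_closure" where a: "a \<notin> range to_ac"
    using ex_new_if_finite[OF infinite_UNIV_alg_closed] by blast
  let ?x = "\<lambda>i::nat. if i < 1 then a else undefined"
  have "\<exists>c\<in>zero_locus 1 {}. (\<forall>i<1. c i \<in> range (to_ac :: 'k \<Rightarrow> _)) \<and> ev (\<lambda>c. c) c G \<noteq> 0"
  proof (rule pac_rational_point[OF pac])
    show "{} \<subseteq> mpolys (range (to_ac :: 'k \<Rightarrow> _)) 1" by simp
    show "G \<in> mpolys (range to_ac) 1"
      unfolding G_def
      by (intro subring_set_prod[OF subring_set_mpolys[OF base]] subring_setD(3)[OF subring_set_mpolys[OF base]]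
        Var_in_mpolys[OF base] Const_in_mpolys[OF base]) auto
    show "?x \<in> zero_locus 1 {}" unfolding locus by (rule pt)
    show "ev (\<lambda>c. c) ?x G \<noteq> 0" unfolding evG using a fin by auto
    show "g \<in> generated_ideal 1 {}" if "g \<in> mpolys UNIV 1" "\<And>c. c \<in> zero_locus 1 {} \<Longrightarrow> ev (\<lambda>c. c) c g = 0"
      for g :: "'k alg_closure mpoly"
      unfolding gen using zero that unfolding locus by simp
    show "g \<in> generated_ideal 1 {} \<or> h \<in> generated_ideal 1 {}"
      if gh: "g \<in> mpolys UNIV 1" "h \<in> mpolys UNIV 1" "\<And>c. c \<in> zero_locus 1 {} \<Longrightarrow> ev (\<lambda>c. c) c (g * h) = 0"
      for g h :: "'k alg_closure mpoly"
    proof -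
      have "g * h \<in> mpolys UNIV 1"
        using gh(1,2) by (rule subring_setD(4)[OF subring_set_mpolys[OF subring_set_UNIV]])
      then have "g * h = 0" by (rule zero) (rule gh(3)[unfolded locus])
      then show ?thesis unfolding gen by simp
    qed
  qed
  then obtain c b where "c 0 = to_ac (b::'k)" "ev (\<lambda>c. c) c G \<noteq> 0" by auto
  then show False unfolding evG using fin by (auto simp: prod_zero_iff)
qed

lemma of_nat_alg_closure_eq_0: "of_nat m = (0 :: 'k::field alg_closure) \<longleftrightarrow> CHAR('k) dvd m"
  using of_nat_eq_0_iff_char_dvd[where 'a = "'k alg_closure"] by simp

context base_tuple
begin

text \<open>Stated for every squarefree \<open>f\<close>, since the separable closure uses reducible
  ones. The values \<open>g (x i)\<close> are distinct because the rational point is sought where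
  the discriminant does not vanish.\<close>

lemma trinomial_realization:
  assumes pac: "pac_field TYPE('k)" and char: "\<not> CHAR('k) dvd n * (n - 1)"
  shows "\<exists>g b. (\<Prod>i<n. [:- poly (map_poly to_ac g) (x i), 1:]) = map_poly to_ac (trinomial n b) \<and>
    inj_on (\<lambda>i. poly (map_poly to_ac g) (x i)) {..<n}"
proof -
  have ch: "of_nat n \<noteq> (0::'k alg_closure)" "of_nat (n - 1) \<noteq> (0::'k alg_closure)"
    using char unfolding of_nat_alg_closure_eq_0 by (auto intro: dvd_mult dvd_mult2)
  note base = subring_set_range[OF comm_ring_hom_to_ac]
  note ring = subring_set_mpolys[OF base, where n = n]
  \<comment> \<open>The discriminant as a function on the curve, \<open>b\<close> being the constant
    coefficient of \<open>norm_poly\<close>. It is defined over the base field, as density in the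
    topology over the base field requires.\<close>
  define G where "G = Const (of_nat n ^ n) * Polynomial.coeff norm_poly 0 ^ (n - 1) - Const (of_nat (n - 1) ^ (n - 1))"
  have natb: "of_nat m \<in> range (to_ac :: 'k \<Rightarrow> _)" for m by (metis rangeI to_ac_of_nat)
  have G: "G \<in> mpolys (range to_ac) n"
    unfolding G_def using coeffs_norm_poly
    by (intro subring_setD[OF ring] subring_set_power[OF ring] Const_in_mpolys[OF base] subring_set_power[OF base] natb)
      (simp add: coeffs_in_def)
  interpret e: comm_ring_hom "ev (\<lambda>c. c) z" for z :: "nat \<Rightarrow> 'k alg_closure"
    by (rule comm_ring_hom.comm_ring_hom_ev[OF comm_ring_hom_id])
  have evB: "ev (\<lambda>c. c) c (Polynomial.coeff norm_poly 0) = Polynomial.coeff (\<Prod>i<n. [:- conj c i, 1:]) 0" for c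
    unfolding map_poly_ev_norm_poly[symmetric] by (simp add: coeff_map_poly)
  have evG: "ev (\<lambda>c. c) c G = of_nat n ^ n * Polynomial.coeff (\<Prod>i<n. [:- conj c i, 1:]) 0 ^ (n - 1) - of_nat (n - 1) ^ (n - 1)" for c
    unfolding G_def e.hom_minus e.hom_mult e.hom_power evB by (simp add: ev_id_simps)
  \<comment> \<open>A point of the curve outside the zeros of \<open>G\<close> comes from any
    \<open>b0\<close> at which the discriminant is nonzero.\<close>
  have "finite {b::'k alg_closure. of_nat n ^ n * b ^ (n - 1) = of_nat (n - 1) ^ (n - 1)}"
    using n ch by (intro finite_exceptional) auto
  then obtain b0 :: "'k alg_closure" where b0: "of_nat n ^ n * b0 ^ (n - 1) \<noteq> of_nat (n - 1) ^ (n - 1)"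
    using ex_new_if_finite[OF infinite_UNIV_alg_closed] by blast
  have coeff0: "Polynomial.coeff (Polynomial.monom 1 n - [:0, 1:] + [:b:]) 0 = b" for b :: "'k alg_closure"
    using n by simp
  have "\<exists>c\<in>curve. ev (\<lambda>c. c) c G \<noteq> 0"
  proof (rule conj_surjective)
    fix U assume U: "\<And>y i. i < n \<Longrightarrow> conj (\<lambda>j. if j < n then \<Sum>i<n. U j i * y i else undefined) i = y i"
    have "Polynomial.degree (Polynomial.monom 1 n - [:0, 1:] + [:b0:]) > 0"
      using degree_trinomial(1)[OF n, of b0] n by simp
    then obtain a where a: "poly (Polynomial.monom 1 n - [:0, 1:] + [:b0:]) a = 0"
      using alg_closed_imp_poly_has_root by blast
    show ?thesis
    proof (rule distinct_trinomial_roots[OF n a[unfolded trinomial_poly] b0])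
      fix y assume y: "(\<Prod>i<n. [:- y i, 1:]) = Polynomial.monom 1 n - [:0, 1:] + [:b0:]"
      define c where "c = (\<lambda>j. if j < n then \<Sum>i<n. U j i * y i else undefined)"
      have eq: "(\<Prod>i<n. [:- conj c i, 1:]) = Polynomial.monom 1 n - [:0, 1:] + [:b0:]"
        unfolding y[symmetric] by (rule prod.cong) (simp_all add: c_def U)
      have "c \<in> affine_space n" by (auto simp: affine_space_def c_def PiE_def extensional_def)
      then have "c \<in> curve" using eq unfolding curve_iff root_tuples_def by blast
      moreover have "ev (\<lambda>c. c) c G \<noteq> 0" unfolding evG eq coeff0 using b0 by simp
      ultimately show ?thesis by blast
    qed
  qed
  then obtain c0 where c0: "c0 \<in> curve" "ev (\<lambda>c. c) c0 G \<noteq> 0" by blast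
  note ideals = curve_ideals[OF ch, unfolded curve_def]
  have "\<exists>c\<in>curve. (\<forall>i<n. c i \<in> range to_ac) \<and> ev (\<lambda>c. c) c G \<noteq> 0"
    unfolding curve_def
    by (rule pac_rational_point[OF pac curve_eqs_over_base ideals G c0[unfolded curve_def]])
  then obtain c where c: "c \<in> curve" "\<forall>i<n. c i \<in> range to_ac" "ev (\<lambda>c. c) c G \<noteq> 0" by blast
  obtain b where b: "(\<Prod>i<n. [:- conj c i, 1:]) = Polynomial.monom 1 n - [:0, 1:] + [:b:]"
    using c(1) unfolding curve_iff root_tuples_def by blast
  have nb: "of_nat n ^ n * b ^ (n - 1) \<noteq> of_nat (n - 1) ^ (n - 1)"
    using c(3) unfolding evG b coeff0 by simp
  have "Polynomial.coeff norm_poly 0 \<in> mpolys (range to_ac) n" using coeffs_norm_poly by (simp add: coeffs_in_def)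
  then have "ev (\<lambda>c. c) c (Polynomial.coeff norm_poly 0) \<in> range to_ac"
    by (rule ev_in_subring[OF comm_ring_hom_id base base]) (use c(2) in auto)
  then obtain b' where b': "b = to_ac b'" unfolding evB b coeff0 by blast
  \<comment> \<open>The coordinates of the rational point are the coefficients of \<open>g\<close>,
    so that \<open>conj c i\<close> is \<open>g (x i)\<close>.\<close>
  define g where "g = (\<Sum>j<n. Polynomial.monom (of_ac (c j)) j)"
  interpret t: comm_ring_hom "to_ac :: 'k \<Rightarrow> 'k alg_closure" by (rule comm_ring_hom_to_ac)
  interpret mt: map_poly_comm_ring_hom "to_ac :: 'k \<Rightarrow> 'k alg_closure" ..
  have g: "poly (map_poly to_ac g) z = (\<Sum>j<n. z ^ j * c j)" for z
    unfolding g_def mt.hom_sum poly_sum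
    by (rule sum.cong) (use c(2) in \<open>auto simp: map_poly_monom poly_monom to_ac_of_ac\<close>)
  have tri: "map_poly to_ac (trinomial n b') = Polynomial.monom 1 n - [:0, 1:] + [:b:]"
    unfolding trinomial_def b' mt.hom_add mt.hom_minus mt.hom_power
    by (simp add: t.map_poly_pCons_hom monom_altdef)
  have "inj_on (conj c) {..<n}"
  proof (rule inj_onI, rule ccontr)
    fix i j assume ij: "i \<in> {..<n}" "j \<in> {..<n}" "conj c i = conj c j" "i \<noteq> j"
    have "{..<n} = insert i (insert j ({..<n} - {i, j}))" using ij by auto
    then have "(\<Prod>i<n. [:- conj c i, 1:]) =
        [:- conj c i, 1:] * ([:- conj c j, 1:] * (\<Prod>i\<in>{..<n} - {i, j}. [:- conj c i, 1:]))"
      using ij(4) by (metis (no_types, lifting) Diff_iff finite_Diff finite_insert finite_lessThan insert_iff prod.insert)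
    then have "[:- conj c i, 1:] * [:- conj c i, 1:] dvd Polynomial.monom 1 n - [:0, 1:] + [:b:]"
      unfolding b ij(3) by (simp only: mult.assoc[symmetric] dvd_triv_left)
    then show False using trinomial_squarefree[OF n nb] by blast
  qed
  moreover have cg: "conj c = (\<lambda>i. poly (map_poly to_ac g) (x i))" unfolding g conj_def ..
  ultimately have "inj_on (\<lambda>i. poly (map_poly to_ac g) (x i)) {..<n}" by simp
  moreover have "(\<Prod>i<n. [:- poly (map_poly to_ac g) (x i), 1:]) = map_poly to_ac (trinomial n b')"
    using b unfolding tri cg .
  ultimately show ?thesis by (intro exI conjI)
qed

end

section \<open>Simple extensions and common roots\<close>

lemma is_subfieldD:
  assumes "is_subfield S"
  shows "subring_set S" "1 \<in> S" "0 \<in> S" "x \<in> S \<Longrightarrow> y \<in> S \<Longrightarrow> x - y \<in> S" "x \<in> S \<Longrightarrow> y \<in> S \<Longrightarrow> x * y \<in> S"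
    "x \<in> S \<Longrightarrow> y \<in> S \<Longrightarrow> x + y \<in> S" "x \<in> S \<Longrightarrow> - x \<in> S" "x \<in> S \<Longrightarrow> inverse x \<in> S"
    "x \<in> S \<Longrightarrow> y \<in> S \<Longrightarrow> x / y \<in> S"
proof -
  show r: "subring_set S" using assms unfolding is_subfield_def subring_set_def by blast
  note R = subring_setD[OF r]
  show "1 \<in> S" "0 \<in> S" by (fact R)+
  show "x \<in> S \<Longrightarrow> y \<in> S \<Longrightarrow> x - y \<in> S" by (rule R)
  show m: "x * y \<in> S" if "x \<in> S" "y \<in> S" for x y using that by (rule R)
  show "x \<in> S \<Longrightarrow> y \<in> S \<Longrightarrow> x + y \<in> S" by (rule R)
  show "x \<in> S \<Longrightarrow> - x \<in> S" by (rule R)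
  show i: "inverse x \<in> S" if "x \<in> S" for x using that assms unfolding is_subfield_def by blast
  show "x \<in> S \<Longrightarrow> y \<in> S \<Longrightarrow> x / y \<in> S" unfolding divide_inverse by (intro m i)
qed

lemma is_subfield_hull: "is_subfield (is_subfield hull M)"
  by (rule hull_in) (auto simp: is_subfield_def)

lemma subfield_minimal_polynomial:
  fixes w :: "'a::field"
  assumes S: "is_subfield S" and F: "coeffs_in S F" "F \<noteq> 0" "poly F w = 0"
  shows "\<exists>m. coeffs_in S m \<and> lead_coeff m = 1 \<and> poly m w = 0 \<and> Polynomial.degree m > 0 \<and>
    (\<forall>p. coeffs_in S p \<longrightarrow> poly p w = 0 \<longrightarrow> (\<exists>s. coeffs_in S s \<and> p = m * s))"
proof -
  note R = is_subfieldD[OF S]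
  let ?P = "\<lambda>p. coeffs_in S p \<and> p \<noteq> 0 \<and> poly p w = 0"
  obtain q where q: "?P q" "\<And>p. ?P p \<Longrightarrow> Polynomial.degree q \<le> Polynomial.degree p"
    using ex_has_least_nat[of ?P F Polynomial.degree] F by blast
  define m where "m = Polynomial.smult (inverse (lead_coeff q)) q"
  have lq: "lead_coeff q \<noteq> 0" using q(1) by simp
  have m: "coeffs_in S m" "lead_coeff m = 1" "poly m w = 0" "Polynomial.degree m = Polynomial.degree q"
    using q(1) lq coeffs_in_smult[OF R(1), of "inverse (lead_coeff q)" q] R(8)
    by (auto simp: m_def coeffs_in_def)
  have deg: "Polynomial.degree m > 0"
  proof (rule ccontr)
    assume "\<not> ?thesis"
    then have "m = 1" using m(2) monic_degree_0[of m] by simp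
    then show False using m(3) by simp
  qed
  have div: "\<exists>s. coeffs_in S s \<and> p = m * s" if p: "coeffs_in S p" "poly p w = 0" for p
  proof -
    obtain s r where sr: "coeffs_in S s" "coeffs_in S r" "p = m * s + r" "Polynomial.degree r < Polynomial.degree m"
      using monic_division[OF R(1) m(1,2) deg p(1)] by blast
    have "poly r w = 0" using p(2) m(3) unfolding sr(3) by simp
    then have "r = 0" using q(2)[of r] sr(2,4) m(4) by force
    then show ?thesis using sr by auto
  qed
  show ?thesis using m deg div by blast
qed

text \<open>The minimal polynomial of \<open>w\<close> over \<open>S\<close> divides both
  \<open>A\<close> and \<open>B\<close>. Its roots are common roots, so \<open>w\<close> is the only
  one, and it is simple because \<open>A\<close> has no square factor. Hence it is
  \<open>X - w\<close>, with coefficients in \<open>S\<close>.\<close>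

lemma common_root_in_subfield:
  fixes w :: "'a::alg_closed_field"
  assumes S: "is_subfield S" and A: "coeffs_in S A" "A \<noteq> 0" "poly A w = 0"
    and B: "coeffs_in S B" "poly B w = 0"
    and sqfree: "\<And>u. \<not> [:- u, 1:] * [:- u, 1:] dvd A"
    and unique: "\<And>u. poly A u = 0 \<Longrightarrow> poly B u = 0 \<Longrightarrow> u = w"
  shows "w \<in> S"
proof -
  obtain m where m: "coeffs_in S m" "lead_coeff m = 1" "poly m w = 0"
    "\<And>p. coeffs_in S p \<Longrightarrow> poly p w = 0 \<Longrightarrow> \<exists>s. coeffs_in S s \<and> p = m * s"
    using subfield_minimal_polynomial[OF S A] by blast
  obtain s t where st: "A = m * s" "B = m * t" using m(4)[OF A(1,3)] m(4)[OF B] by blast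
  obtain q where q: "m = [:- w, 1:] * q" using m(3) by (metis poly_eq_0_iff_dvd dvdE)
  have "Polynomial.degree q = 0"
  proof (rule ccontr)
    assume "Polynomial.degree q \<noteq> 0"
    then obtain u where u: "poly q u = 0" using alg_closed_imp_poly_has_root[of q] by auto
    then have "u = w" by (intro unique) (simp_all add: st q)
    then have "[:- w, 1:] dvd q" using u by (simp only: poly_eq_0_iff_dvd)
    then have "[:- w, 1:] * [:- w, 1:] dvd A"
      unfolding st q by (intro dvd_mult2 mult_dvd_mono dvd_refl)
    then show False using sqfree by blast
  qed
  moreover have "lead_coeff q = 1" using m(2) unfolding q by (simp add: lead_coeff_mult del: mult_pCons_left)
  ultimately have "q = 1" using monic_degree_0[of q] by simp
  then have "Polynomial.coeff m 0 = - w" unfolding q by simp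
  then have "- w \<in> S" using m(1) unfolding coeffs_in_def by metis
  then show ?thesis using is_subfieldD(7)[OF S, of "- w"] by simp
qed

text \<open>Inverses come from Bezout for \<open>g\<close> and the minimal polynomial
  \<open>m\<close> of \<open>w\<close>, with \<open>d\<close> of least degree among the nonzero
  combinations over \<open>S\<close>.\<close>

lemma simple_extension_is_subfield:
  fixes w :: "'a::field"
  assumes S: "is_subfield S" and F: "coeffs_in S F" "F \<noteq> 0" "poly F w = 0"
  shows "is_subfield {poly g w | g. coeffs_in S g}"
proof -
  note R = is_subfieldD[OF S]
  let ?T = "{poly g w | g. coeffs_in S g}"
  obtain m where m: "coeffs_in S m" "lead_coeff m = 1" "poly m w = 0" "Polynomial.degree m > 0"
    "\<And>p. coeffs_in S p \<Longrightarrow> poly p w = 0 \<Longrightarrow> \<exists>s. coeffs_in S s \<and> p = m * s"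
    using subfield_minimal_polynomial[OF S F] by blast
  have const: "coeffs_in S [:c:]" if "c \<in> S" for c by (intro coeffs_in_pCons coeffs_in_0[OF R(1)] that)
  have one: "1 \<in> ?T" using const[OF R(2)] by (auto intro!: exI[of _ "[:1:]"])
  have sub: "x - y \<in> ?T" "x * y \<in> ?T" if xy: "x \<in> ?T" "y \<in> ?T" for x y
  proof -
    obtain g h where gh: "coeffs_in S g" "x = poly g w" "coeffs_in S h" "y = poly h w" using xy by blast
    show "x - y \<in> ?T"
      using coeffs_in_diff[OF R(1) gh(1,3)] gh(2,4) by (auto intro!: exI[of _ "g - h"])
    show "x * y \<in> ?T"
      using coeffs_in_mult[OF R(1) gh(1,3)] gh(2,4) by (auto intro!: exI[of _ "g * h"])
  qed
  have inv: "inverse x \<in> ?T" if x: "x \<in> ?T" for x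
  proof (cases "x = 0")
    case True
    then show ?thesis using const[OF R(3)] by (auto intro!: exI[of _ "[:0:]"])
  next
    case False
    obtain g where g: "coeffs_in S g" "x = poly g w" using x by blast
    let ?J = "\<lambda>d. d \<noteq> 0 \<and> (\<exists>u v. coeffs_in S u \<and> coeffs_in S v \<and> d = u * g + v * m)"
    have "?J m"
      using m(2) coeffs_in_0[OF R(1)] const[OF R(2)]
      by (intro conjI exI[of _ 0] exI[of _ "[:1:]"]) auto
    then obtain d where d: "?J d" "\<And>e. ?J e \<Longrightarrow> Polynomial.degree d \<le> Polynomial.degree e"
      using ex_has_least_nat[of ?J m Polynomial.degree] by blast
    obtain u v where uv: "coeffs_in S u" "coeffs_in S v" "d = u * g + v * m" using d(1) by blast
    have dS: "coeffs_in S d" unfolding uv(3)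
      by (intro coeffs_in_add[OF R(1)] coeffs_in_mult[OF R(1)] uv g m)
    \<comment> \<open>A non-constant \<open>d\<close> would divide both \<open>g\<close> and
      \<open>m\<close>. It does not vanish at \<open>w\<close>, so its cofactor in \<open>m\<close>
      does, and then \<open>m\<close> would divide its own proper factor.\<close>
    have "Polynomial.degree d = 0"
    proof (rule ccontr)
      assume dd: "Polynomial.degree d \<noteq> 0"
      define c where "c = inverse (lead_coeff d)"
      have c: "c \<in> S" "c \<noteq> 0" using dS R(8) d(1) by (auto simp: c_def coeffs_in_def)
      define d' where "d' = Polynomial.smult c d"
      have d': "coeffs_in S d'" "lead_coeff d' = 1" "Polynomial.degree d' = Polynomial.degree d"
        using coeffs_in_smult[OF R(1) c(1) dS] d(1) by (auto simp: d'_def c_def)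
      have div: "\<exists>e. p = d' * e" if p: "coeffs_in S p" "\<exists>a b. coeffs_in S a \<and> coeffs_in S b \<and> p = a * g + b * m" for p
      proof -
        obtain a b where ab: "coeffs_in S a" "coeffs_in S b" "p = a * g + b * m" using p(2) by blast
        obtain s r where sr: "coeffs_in S s" "coeffs_in S r" "p = d' * s + r" "Polynomial.degree r < Polynomial.degree d'"
          using monic_division[OF R(1) d'(1,2) _ p(1)] d'(3) dd by auto
        have "r = (a - Polynomial.smult c u * s) * g + (b - Polynomial.smult c v * s) * m"
          using sr(3) ab(3) uv(3) by (simp add: d'_def algebra_simps smult_add_right)
        moreover have "coeffs_in S (a - Polynomial.smult c u * s)" "coeffs_in S (b - Polynomial.smult c v * s)"
          by (intro coeffs_in_diff[OF R(1)] coeffs_in_mult[OF R(1)] coeffs_in_smult[OF R(1)] ab uv sr c)+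
        ultimately have "r = 0" using d(2)[of r] sr(4) d'(3) by (metis not_less)
        then show ?thesis using sr(3) by auto
      qed
      have "\<exists>e. g = d' * e" "\<exists>e. m = d' * e"
        using div[OF g(1)] div[OF m(1)] const[OF R(2)] coeffs_in_0[OF R(1)]
        by (metis add_0 add_0_right mult_1 mult_zero_left one_pCons)+
      then obtain e1 e2 where e: "g = d' * e1" "m = d' * e2" by blast
      have "poly d' w \<noteq> 0" using False g(2) e(1) by auto
      then have "poly e2 w = 0" using m(3) e(2) by auto
      \<comment> \<open>Quotients by a monic polynomial are unique, so the cofactor is the one that
        division inside \<open>S\<close> produces.\<close>
      moreover have "coeffs_in S e2"
      proof -
        obtain s r where sr: "coeffs_in S s" "coeffs_in S r" "m = d' * s + r" "Polynomial.degree r < Polynomial.degree d'"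
          using monic_division[OF R(1) d'(1,2) _ m(1)] d'(3) dd by auto
        have rr: "d' * (e2 - s) = r" using sr(3) e(2) by (simp add: right_diff_distrib)
        have "e2 = s"
        proof (rule ccontr)
          assume "e2 \<noteq> s"
          then have "Polynomial.degree (d' * (e2 - s)) \<ge> Polynomial.degree d'"
            using d'(2) by (subst degree_mult_eq) auto
          then show False using rr sr(4) by simp
        qed
        then show ?thesis using sr(1) by simp
      qed
      ultimately obtain s where "e2 = m * s" using m(5) by blast
      then have "m * 1 = m * (d' * s)" using e(2) by (simp add: mult_ac)
      then have "d' * s = 1" using m(2) by (metis mult_left_cancel leading_coeff_0_iff zero_neq_one)
      then have "d' dvd 1" by (metis dvd_triv_left)
      then show False using dd d'(3) by (simp add: poly_dvd_1)
    qed
    then obtain c where c: "d = [:c:]" by (metis degree_0_id)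
    have "Polynomial.coeff d 0 \<in> S" using dS unfolding coeffs_in_def by blast
    then have c0: "c \<noteq> 0" "c \<in> S" using d(1) by (auto simp only: c coeff_pCons_0 pCons_0_0)
    have "poly d w = poly u w * x" using m(3) by (simp add: uv(3) g(2))
    then have "c = poly u w * x" using c by simp
    then have "inverse x = poly (Polynomial.smult (inverse c) u) w"
      using False c0 by (simp add: field_simps)
    then show ?thesis using coeffs_in_smult[OF R(1) R(8)[OF c0(2)] uv(1)] by blast
  qed
  show ?thesis unfolding is_subfield_def using one sub inv by blast
qed

lemma hull_insert_eq_simple_extension:
  fixes w :: "'a::field"
  assumes S: "is_subfield S" and F: "coeffs_in S F" "F \<noteq> 0" "poly F w = 0"
  shows "is_subfield hull (insert w S) = {poly g w | g. coeffs_in S g}"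
proof (rule hull_unique)
  note R = is_subfieldD[OF S]
  let ?T = "{poly g w | g. coeffs_in S g}"
  show "insert w S \<subseteq> ?T"
  proof
    fix z assume "z \<in> insert w S"
    then consider "z = w" | "z \<in> S" by blast
    then show "z \<in> ?T"
    proof cases
      case 1
      have "coeffs_in S [:0, 1:]" by (intro coeffs_in_pCons coeffs_in_0[OF R(1)] R)
      then show ?thesis using 1 by (auto intro!: exI[of _ "[:0, 1:]"])
    next
      case 2
      have "coeffs_in S [:z:]" by (intro coeffs_in_pCons coeffs_in_0[OF R(1)] 2)
      then show ?thesis by (auto intro!: exI[of _ "[:z:]"])
    qed
  qed
  show "is_subfield ?T" by (rule simple_extension_is_subfield[OF S F])
  fix T assume T: "insert w S \<subseteq> T" "is_subfield T"
  show "?T \<subseteq> T"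
    using coeffs_in_poly[OF is_subfieldD(1)[OF T(2)]] coeffs_in_mono[of S T] T(1) by blast
qed

section \<open>The separable closure\<close>

lemma pderiv_0_if_const:
  assumes "Polynomial.degree f = 0"
  shows "pderiv f = 0"
proof -
  obtain c where "f = [:c:]" using assms by (metis degree_0_id)
  then show ?thesis by (simp add: pderiv_pCons)
qed

lemma rsquarefree_iff_no_square:
  "rsquarefree p \<longleftrightarrow> (\<forall>u. \<not> [:- u, 1:] * [:- u, 1:] dvd p)"
proof (cases "p = 0")
  case False
  have "[:- u, 1:] * [:- u, 1:] dvd p \<longleftrightarrow> 2 \<le> order u p" for u
    using False order_divides[of u 2 p] by (simp only: power2_eq_square) simp
  moreover have "order u p = 0 \<or> order u p = 1 \<longleftrightarrow> \<not> 2 \<le> order u p" for u by linarith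
  ultimately show ?thesis using False unfolding rsquarefree_def by metis
qed (auto simp: rsquarefree_def simp del: mult_pCons_left mult_pCons_right)

lemma pderiv_eq_0_imp_CHAR_dvd_degree:
  fixes f :: "'a::field poly"
  assumes "pderiv f = 0" "f \<noteq> 0"
  shows "CHAR('a) dvd Polynomial.degree f"
proof (cases "Polynomial.degree f")
  case (Suc m)
  have "Polynomial.coeff (pderiv f) m = of_nat (Suc m) * Polynomial.coeff f (Suc m)"
    by (simp add: coeff_pderiv)
  then have "of_nat (Suc m) * lead_coeff f = 0" using assms(1) unfolding Suc by simp
  then have "of_nat (Suc m) = (0::'a)" using assms(2) by (simp only: mult_eq_0_iff leading_coeff_0_iff) blast
  then show ?thesis unfolding Suc of_nat_eq_0_iff_char_dvd .
qed simp

section \<open>Minimal polynomials over the image of a field homomorphism\<close>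

context field_hom
begin

interpretation ph: map_poly_inj_idom_hom hom ..

lemma subring_set_range_hom: "subring_set (range hom)"
  by (rule subring_set_range[OF comm_ring_hom_axioms])

lemma is_subfield_range: "is_subfield (range hom)"
proof -
  have "inverse x \<in> range hom" if x: "x \<in> range hom" for x
  proof -
    obtain a where "x = hom a" using x by blast
    then have "inverse x = hom (inverse a)" by (simp only: hom_inverse)
    then show ?thesis by blast
  qed
  then show ?thesis
    using subring_set_range_hom unfolding is_subfield_def subring_set_def by blast
qed

lemma coeffs_in_map_poly_hom: "coeffs_in (range hom) (map_poly hom f)"
  unfolding coeffs_in_def by simp

lemma poly_map_trinomial: "poly (map_poly hom (trinomial n b)) y = y ^ n - y + hom b"
proof -
  have "map_poly hom (trinomial n b) = map_poly hom [:0, 1:] ^ n - map_poly hom [:0, 1:] + map_poly hom [:b:]"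
    unfolding trinomial_def by (simp only: ph.hom_add ph.hom_minus ph.hom_power)
  then show ?thesis by (simp add: map_poly_pCons_hom poly_power)
qed

lemma minimal_polynomial:
  assumes "p \<noteq> 0" "poly (map_poly hom p) u = 0"
  shows "\<exists>m. lead_coeff m = 1 \<and> Factorial_Ring.irreducible m \<and> poly (map_poly hom m) u = 0 \<and>
    (\<forall>q. poly (map_poly hom q) u = 0 \<longrightarrow> m dvd q)"
proof -
  let ?P = "\<lambda>p. p \<noteq> 0 \<and> poly (map_poly hom p) u = 0"
  obtain q where q: "?P q" "\<And>p. ?P p \<Longrightarrow> Polynomial.degree q \<le> Polynomial.degree p"
    using ex_has_least_nat[of ?P p Polynomial.degree] assms by blast
  define m where "m = Polynomial.smult (inverse (lead_coeff q)) q"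
  have m: "lead_coeff m = 1" "poly (map_poly hom m) u = 0" "Polynomial.degree m = Polynomial.degree q"
    using q(1) by (simp_all add: m_def map_poly_hom_smult)
  have div: "m dvd q'" if "poly (map_poly hom q') u = 0" for q'
  proof -
    have "q' = q' div m * m + q' mod m" by simp
    then have "map_poly hom q' = map_poly hom (q' div m) * map_poly hom m + map_poly hom (q' mod m)"
      by (metis ph.hom_add ph.hom_mult)
    then have "poly (map_poly hom (q' mod m)) u = 0" using that m(2) by simp
    then have "q' mod m = 0"
      using q(2)[of "q' mod m"] degree_mod_less[of m q'] m(1,3) by force
    then show ?thesis by (simp add: mod_eq_0_iff_dvd)
  qed
  have "Factorial_Ring.irreducible m"
  proof (rule irreducibleI)
    show "m \<noteq> 0" using m(1) by auto
    show "\<not> m dvd 1"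
    proof
      assume "m dvd 1"
      then obtain s where "1 = m * s" ..
      then have "1 = poly (map_poly hom m * map_poly hom s) u"
        by (metis ph.hom_mult ph.hom_one poly_1)
      then show False using m(2) by simp
    qed
    fix a b assume ab: "m = a * b"
    have step: "d dvd 1" if "poly (map_poly hom c) u = 0" "m = c * d" for c d
    proof -
      have "c * d dvd c * 1" using div[OF that(1)] that(2) by simp
      moreover have "c \<noteq> 0" using m(1) that(2) by auto
      ultimately show ?thesis by (simp only: dvd_mult_cancel_left) blast
    qed
    have "poly (map_poly hom a) u = 0 \<or> poly (map_poly hom b) u = 0"
      using m(2) unfolding ab by (simp add: ph.hom_mult)
    then show "a dvd 1 \<or> b dvd 1" using step[of a b] step[of b a] ab by (auto simp: mult.commute)
  qed
  then show ?thesis using m div by blast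
qed

lemma irreducible_dvd_of_root:
  assumes "Factorial_Ring.irreducible f" "poly (map_poly hom f) u = 0" "poly (map_poly hom q) u = 0"
  shows "f dvd q"
proof -
  have "f \<noteq> 0" using assms(1) by auto
  then obtain m where m: "Factorial_Ring.irreducible m" "\<And>q. poly (map_poly hom q) u = 0 \<Longrightarrow> m dvd q"
    using minimal_polynomial[OF _ assms(2)] by blast
  have "f dvd m \<or> m dvd 1" using irreducibleD'[OF assms(1) m(2)[OF assms(2)]] .
  then have "f dvd m" using m(1) by (auto simp: irreducible_def)
  then show ?thesis using m(2)[OF assms(3)] dvd_trans by blast
qed

text \<open>A multiple root is shared with the derivative, which \<open>f\<close> would then divide
  although the derivative has smaller degree.\<close>

lemma irreducible_no_square:
  assumes "Factorial_Ring.irreducible f" "pderiv f \<noteq> 0"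
  shows "\<not> [:- u, 1:] * [:- u, 1:] dvd map_poly hom f"
proof
  assume "[:- u, 1:] * [:- u, 1:] dvd map_poly hom f"
  then obtain s where s: "map_poly hom f = [:- u, 1:] * [:- u, 1:] * s" ..
  have "poly (map_poly hom f) u = 0" unfolding s by simp
  moreover have "poly (map_poly hom (pderiv f)) u = 0"
    by (simp only: map_poly_pderiv s poly_pderiv_square)
  ultimately have "f dvd pderiv f" by (rule irreducible_dvd_of_root[OF assms(1)])
  then have "Polynomial.degree f \<le> Polynomial.degree (pderiv f)" using assms(2) by (rule dvd_imp_degree_le)
  moreover have "Polynomial.degree f \<noteq> 0" using assms(2) pderiv_0_if_const by blast
  ultimately show False using degree_pderiv_le[of f] by linarith
qed

end

lemma field_hom_to_ac: "field_hom (to_ac :: 'k::field \<Rightarrow> 'k alg_closure)"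
proof -
  interpret comm_ring_hom "to_ac :: 'k \<Rightarrow> 'k alg_closure" by unfold_locales auto
  show ?thesis ..
qed

text \<open>Divisors of a squarefree polynomial are squarefree, so any squarefree annihilator can
  stand in for the minimal polynomial.\<close>

lemma in_separable_closure_iff:
  fixes x :: "'k::field alg_closure"
  shows "x \<in> separable_closure \<longleftrightarrow>
    (\<exists>p :: 'k poly. poly (map_poly to_ac p) x = 0 \<and> rsquarefree (map_poly to_ac p))"
proof
  assume "\<exists>p :: 'k poly. poly (map_poly to_ac p) x = 0 \<and> rsquarefree (map_poly to_ac p)"
  then obtain p :: "'k poly" where p: "poly (map_poly to_ac p) x = 0" "rsquarefree (map_poly to_ac p)" by blast
  interpret field_hom "to_ac :: 'k \<Rightarrow> 'k alg_closure" by (rule field_hom_to_ac)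
  interpret ph: map_poly_inj_idom_hom "to_ac :: 'k \<Rightarrow> 'k alg_closure" ..
  have "p \<noteq> 0" using p(2) by (auto simp: rsquarefree_def)
  then obtain m where m: "lead_coeff m = 1" "Factorial_Ring.irreducible m" "poly (map_poly to_ac m) x = 0" "m dvd p"
    using minimal_polynomial[OF _ p(1)] p(1) by blast
  have "map_poly to_ac m dvd (map_poly to_ac p :: 'k alg_closure poly)" using m(4) by (rule ph.hom_dvd)
  then have "rsquarefree (map_poly to_ac m :: 'k alg_closure poly)"
    using p(2) unfolding rsquarefree_iff_no_square by (meson dvd_trans)
  then show "x \<in> separable_closure"
    using m unfolding separable_closure_def irreducible_polynomial_of_def by blast
qed (auto simp: separable_closure_def irreducible_polynomial_of_def)

lemma poly_eq_0_of_many_roots: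
  fixes r :: "'a::idom poly"
  assumes "inj_on x {..<n}" "\<And>i. i < n \<Longrightarrow> poly r (x i) = 0" "Polynomial.degree r < n"
  shows "r = 0"
proof (rule ccontr)
  assume r: "r \<noteq> 0"
  have "card (x ` {..<n}) \<le> card {u. poly r u = 0}"
    using assms(2) by (intro card_mono poly_roots_finite[OF r]) auto
  also have "\<dots> \<le> Polynomial.degree r" by (rule card_poly_roots_bound[OF r])
  finally show False using assms(3) card_image[OF assms(1)] by simp
qed

lemma prime_CHAR_alg_closure:
  assumes "CHAR('k::field) \<noteq> 0"
  shows "prime CHAR('k alg_closure)"
  by (rule prime_CHAR_semidom) (use assms in simp)

text \<open>The rule for sums is applied to \<open>(x - y) + y\<close>, which avoids the sign of
  \<open>(- 1)^p\<close>.\<close>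

lemma frobenius_diff:
  fixes x y :: "'k::field alg_closure"
  assumes "CHAR('k) \<noteq> 0"
  shows "(x - y) ^ CHAR('k) = x ^ CHAR('k) - y ^ CHAR('k)"
proof -
  have "((x - y) + y) ^ CHAR('k alg_closure) = (x - y) ^ CHAR('k alg_closure) + y ^ CHAR('k alg_closure)"
    by (rule freshmans_dream[OF prime_CHAR_alg_closure[OF assms] refl])
  then show ?thesis by simp
qed

lemma frobenius_inj:
  fixes x y :: "'k::field alg_closure"
  assumes "CHAR('k) \<noteq> 0" "x ^ CHAR('k) = y ^ CHAR('k)"
  shows "x = y"
  using frobenius_diff[OF assms(1), of x y] assms by simp

lemma separable_closure_char_0:
  assumes "CHAR('k::field) = 0"
  shows "(separable_closure :: 'k alg_closure set) = UNIV"
proof -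
  interpret field_hom "to_ac :: 'k \<Rightarrow> 'k alg_closure" by (rule field_hom_to_ac)
  have "x \<in> separable_closure" for x :: "'k alg_closure"
  proof -
    obtain p :: "'k poly" where p: "p \<noteq> 0" "poly (map_poly to_ac p) x = 0"
      by (rule alg_closure_algebraic)
    obtain m :: "'k poly" where m: "lead_coeff m = 1" "Factorial_Ring.irreducible m" "poly (map_poly to_ac m) x = 0"
      using minimal_polynomial[OF p] by blast
    have "m \<noteq> 0" using m(1) by auto
    have "pderiv m \<noteq> 0"
    proof
      assume "pderiv m = 0"
      then have "Polynomial.degree m = 0"
        using pderiv_eq_0_imp_CHAR_dvd_degree[of m] \<open>m \<noteq> 0\<close> assms by simp
      then have "m = 1" using monic_degree_0[OF m(1)] by blast
      then show False using m(2) by simp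
    qed
    then have "rsquarefree (map_poly to_ac m :: 'k alg_closure poly)"
      unfolding rsquarefree_iff_no_square using irreducible_no_square[OF m(2)] by blast
    then show ?thesis unfolding in_separable_closure_iff using m(3) by blast
  qed
  then show ?thesis by blast
qed

lemma range_to_ac_subset_separable_closure: "range (to_ac :: 'k::field \<Rightarrow> _) \<subseteq> separable_closure"
proof
  fix z :: "'k alg_closure" assume "z \<in> range to_ac"
  then obtain c :: 'k where c: "z = to_ac c" by blast
  have e: "map_poly to_ac [:- c, 1:] = [:- z, 1:]" by (simp add: c map_poly_pCons)
  have "\<not> [:- u, 1:] * [:- u, 1:] dvd [:- z, 1:]" for u
  proof
    assume "[:- u, 1:] * [:- u, 1:] dvd [:- z, 1:]"
    then have "Polynomial.degree ([:- u, 1:] * [:- u, 1:]) \<le> Polynomial.degree [:- z, 1:]"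
      by (rule dvd_imp_degree_le) simp
    then show False by (simp add: degree_mult_eq del: mult_pCons_left mult_pCons_right)
  qed
  then show "z \<in> separable_closure"
    unfolding in_separable_closure_iff rsquarefree_iff_no_square
    by (intro exI[of _ "[:- c, 1:]"]) (simp add: e del: mult_pCons_left mult_pCons_right)
qed

section \<open>Closure properties of separable elements in positive characteristic\<close>

context
  assumes char: "CHAR('k::field) \<noteq> 0"
begin

text \<open>As an element of \<open>S(x)\<close>, \<open>z\<close> is separable over
  \<open>S\<close>, while \<open>z^p \<in> S\<close> makes it purely inseparable. Concretely, write
  \<open>z = r(x)\<close> with \<open>r\<close> of smaller degree than the minimal polynomial
  \<open>f\<close> of \<open>x\<close>. Then \<open>f\<close> divides \<open>r^p - z^p\<close>; as
  Frobenius is injective, \<open>r - z\<close> vanishes at all the distinct roots of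
  \<open>f\<close> and so is zero.\<close>

lemma in_subfield_if_power_in_subfield:
  fixes x z :: "'k alg_closure"
  assumes S: "is_subfield S" "range to_ac \<subseteq> S" and x: "x \<in> separable_closure"
    and g: "coeffs_in S g" "z = poly g x" and z: "z ^ CHAR('k) \<in> S"
  shows "z \<in> S"
proof -
  note R = is_subfieldD[OF S(1)]
  obtain q :: "'k poly" where q: "poly (map_poly to_ac q) x = 0" "rsquarefree (map_poly to_ac q)"
    using x unfolding in_separable_closure_iff by blast
  have qS: "coeffs_in S (map_poly to_ac q)" using S(2) by (auto simp: coeffs_in_def coeff_map_poly)
  have q0: "map_poly to_ac q \<noteq> 0" using q(2) by (simp add: rsquarefree_def)
  obtain f where f: "coeffs_in S f" "lead_coeff f = 1" "Polynomial.degree f > 0"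
    "\<And>p. coeffs_in S p \<Longrightarrow> poly p x = 0 \<Longrightarrow> \<exists>s. coeffs_in S s \<and> p = f * s"  "poly f x = 0"
    using subfield_minimal_polynomial[OF S(1) qS q0 q(1)] by blast
  have "f dvd map_poly to_ac q" using f(4)[OF qS q(1)] by auto
  then have sq: "\<not> [:- u, 1:] * [:- u, 1:] dvd f" for u
    using q(2) unfolding rsquarefree_iff_no_square by (meson dvd_trans)
  obtain y where y: "inj_on y {..<Polynomial.degree f}" "f = (\<Prod>i<Polynomial.degree f. [:- y i, 1:])"
    using split_into_distinct_linear_factors[OF f(2) sq] by blast
  obtain s r where sr: "coeffs_in S s" "coeffs_in S r" "g = f * s + r" "Polynomial.degree r < Polynomial.degree f"
    using monic_division[OF R(1) f(1-3) g(1)] by blast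
  have zr: "poly r x = z" using g(2) f(5) unfolding sr(3) by simp
  have rp: "coeffs_in S (r ^ k)" for k
    by (induction k) (auto simp: one_pCons intro!: coeffs_in_mult[OF R(1)] sr coeffs_in_pCons coeffs_in_0[OF R(1)] R)
  have "coeffs_in S (r ^ CHAR('k) - [:z ^ CHAR('k):])"
    by (intro coeffs_in_diff[OF R(1)] rp coeffs_in_pCons coeffs_in_0[OF R(1)] z)
  moreover have "poly (r ^ CHAR('k) - [:z ^ CHAR('k):]) x = 0" by (simp add: zr poly_power)
  ultimately obtain t where t: "r ^ CHAR('k) - [:z ^ CHAR('k):] = f * t" using f(4) by blast
  have root: "poly (r - [:z:]) (y i) = 0" if i: "i < Polynomial.degree f" for i
  proof -
    have "poly f (y i) = 0"
      by (subst y(2)) (use i in \<open>auto simp: poly_prod intro!: prod_zero bexI[of _ i]\<close>)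
    then have "poly (r ^ CHAR('k) - [:z ^ CHAR('k):]) (y i) = 0" unfolding t by simp
    then have "poly r (y i) ^ CHAR('k) = z ^ CHAR('k)" by (simp add: poly_power)
    then show ?thesis using frobenius_inj[OF char] by simp
  qed
  have "Polynomial.degree (r - [:z:]) < Polynomial.degree f"
    using sr(4) f(3) by (intro degree_diff_less) auto
  then have "r - [:z:] = 0" using poly_eq_0_of_many_roots[OF y(1) root] by blast
  then have "Polynomial.coeff r 0 = z" by simp
  then show ?thesis using sr(2) unfolding coeffs_in_def by metis
qed

text \<open>If \<open>z = g(z^p)\<close>, then \<open>z\<close> is a root of
  \<open>g(X^p) - X\<close>, whose derivative is the constant -1.\<close>

lemma separable_if_in_hull_power:
  fixes z :: "'k alg_closure"
  assumes "z \<in> is_subfield hull (insert (z ^ CHAR('k)) (range to_ac))"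
  shows "z \<in> separable_closure"
proof -
  interpret field_hom "to_ac :: 'k \<Rightarrow> 'k alg_closure" by (rule field_hom_to_ac)
  interpret ph: map_poly_inj_idom_hom "to_ac :: 'k \<Rightarrow> 'k alg_closure" ..
  obtain q :: "'k poly" where q: "q \<noteq> 0" "poly (map_poly to_ac q) (z ^ CHAR('k)) = 0"
    by (rule alg_closure_algebraic)
  have "map_poly to_ac q \<noteq> (0 :: 'k alg_closure poly)" using q(1) by simp
  then obtain g where g: "coeffs_in (range to_ac) g" "z = poly g (z ^ CHAR('k))"
    using hull_insert_eq_simple_extension[OF is_subfield_range coeffs_in_map_poly_hom[of q] _ q(2)] assms by blast
  define g0 where "g0 = map_poly (of_ac :: _ \<Rightarrow> 'k) g"
  have g0: "map_poly to_ac g0 = g"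
  proof (rule poly_eqI)
    fix i
    have "of_ac (0 :: 'k alg_closure) = (0 :: 'k)" by (rule of_ac_eqI) simp
    then show "Polynomial.coeff (map_poly to_ac g0) i = Polynomial.coeff g i"
      using g(1) unfolding coeffs_in_def g0_def by (auto simp: coeff_map_poly) (metis of_ac_to_ac rangeE)
  qed
  define P where "P = pcompose g0 (Polynomial.monom 1 CHAR('k)) - [:0, 1:]"
  have mP: "map_poly to_ac P = pcompose g (Polynomial.monom 1 CHAR('k)) - [:0, 1:]"
    unfolding P_def by (simp add: hom_distribs g0)
  have P: "poly (map_poly to_ac P) z = 0"
    unfolding mP using g(2) by (simp add: poly_pcompose poly_monom)
  have "pderiv (Polynomial.monom (1::'k) CHAR('k)) = 0" by (simp add: pderiv_monom)
  then have "pderiv P = - 1" by (simp add: P_def pderiv_diff pderiv_pcompose pderiv_pCons one_pCons)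
  then have "poly (pderiv (map_poly to_ac P)) u = - 1" for u :: "'k alg_closure"
    by (simp add: map_poly_pderiv[symmetric] ph.hom_uminus)
  moreover have "poly (pderiv (map_poly to_ac P)) u = 0" if "[:- u, 1:] * [:- u, 1:] dvd map_poly to_ac P" for u
  proof -
    obtain s where "map_poly to_ac P = [:- u, 1:] * [:- u, 1:] * s" using \<open>_ dvd _\<close> ..
    then show ?thesis by (simp only: poly_pderiv_square)
  qed
  ultimately have "rsquarefree (map_poly to_ac P :: 'k alg_closure poly)"
    unfolding rsquarefree_iff_no_square by (metis neg_equal_0_iff_equal one_neq_zero)
  then show ?thesis using P unfolding in_separable_closure_iff by blast
qed

text \<open>Handles differences, products and inverses at once. Put \<open>S = k(z^p)\<close>. By
  \<open>yp\<close>, \<open>S(x)\<close> contains \<open>y^p\<close>, hence also \<open>y\<close>,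
  which is separable and the only root of \<open>X^p - y^p\<close>. So \<open>z\<close> lies in
  \<open>S(x)\<close>, and since \<open>z^p\<close> is in \<open>S\<close> and \<open>x\<close> is
  separable, \<open>z\<close> lies in \<open>S\<close>.\<close>

lemma separable_closure_closed:
  fixes x y z :: "'k alg_closure"
  assumes x: "x \<in> separable_closure" and y: "y \<in> separable_closure"
    and yp: "\<And>T. is_subfield T \<Longrightarrow> range to_ac \<subseteq> T \<Longrightarrow> x \<in> T \<Longrightarrow> z ^ CHAR('k) \<in> T \<Longrightarrow> y ^ CHAR('k) \<in> T"
    and z: "\<And>T. is_subfield T \<Longrightarrow> range to_ac \<subseteq> T \<Longrightarrow> x \<in> T \<Longrightarrow> y \<in> T \<Longrightarrow> z \<in> T"
  shows "z \<in> separable_closure"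
proof (rule separable_if_in_hull_power)
  define S where "S = is_subfield hull (insert (z ^ CHAR('k)) (range to_ac))"
  have S: "is_subfield S" unfolding S_def by (rule is_subfield_hull)
  have SS: "range to_ac \<subseteq> S" "z ^ CHAR('k) \<in> S"
    using hull_subset[of "insert (z ^ CHAR('k)) (range to_ac)" is_subfield] unfolding S_def by auto
  obtain p :: "'k poly" where p: "poly (map_poly to_ac p) x = 0" "rsquarefree (map_poly to_ac p)"
    using x unfolding in_separable_closure_iff by blast
  obtain q :: "'k poly" where q: "poly (map_poly to_ac q) y = 0" "rsquarefree (map_poly to_ac q)"
    using y unfolding in_separable_closure_iff by blast
  have co: "coeffs_in S (map_poly to_ac r)" for r using SS(1) by (auto simp: coeffs_in_def coeff_map_poly)
  have nz: "map_poly to_ac p \<noteq> 0" "map_poly to_ac q \<noteq> 0" using p(2) q(2) by (simp_all add: rsquarefree_def)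
  define T where "T = {poly g x | g. coeffs_in S g}"
  have T: "is_subfield T" unfolding T_def by (rule simple_extension_is_subfield[OF S co nz(1) p(1)])
  have "insert x S \<subseteq> T"
    unfolding T_def hull_insert_eq_simple_extension[OF S co nz(1) p(1), symmetric] by (rule hull_subset)
  then have TT: "x \<in> T" "S \<subseteq> T" "range to_ac \<subseteq> T" using SS by auto
  have yT: "y ^ CHAR('k) \<in> T" by (rule yp[OF T TT(3,1)]) (use TT SS in auto)
  note R = is_subfieldD[OF T]
  have "y \<in> T"
  proof (rule common_root_in_subfield[OF T, of "map_poly to_ac q" _ "Polynomial.monom 1 CHAR('k) - [:y ^ CHAR('k):]"])
    show "coeffs_in T (map_poly to_ac q)" using co[of q] TT(2) by (rule coeffs_in_mono[rotated])
    show "map_poly to_ac q \<noteq> 0" "poly (map_poly to_ac q) y = 0" by fact+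
    have "coeffs_in T (Polynomial.monom 1 CHAR('k))" using R(2,3) by (simp add: coeffs_in_def)
    then show "coeffs_in T (Polynomial.monom 1 CHAR('k) - [:y ^ CHAR('k):])"
      by (intro coeffs_in_diff[OF R(1)] coeffs_in_pCons coeffs_in_0[OF R(1)] yT)
    show "poly (Polynomial.monom 1 CHAR('k) - [:y ^ CHAR('k):]) y = 0" by (simp add: poly_monom)
    show "\<not> [:- u, 1:] * [:- u, 1:] dvd map_poly to_ac q" for u
      using q(2) unfolding rsquarefree_iff_no_square by blast
    show "u = y" if "poly (Polynomial.monom 1 CHAR('k) - [:y ^ CHAR('k):]) u = 0" for u
      using that frobenius_inj[OF char] by (simp add: poly_monom)
  qed
  then have "z \<in> T" by (rule z[OF T TT(3,1)])
  then obtain g where "coeffs_in S g" "z = poly g x" unfolding T_def by blast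
  then show "z \<in> is_subfield hull (insert (z ^ CHAR('k)) (range to_ac))"
    using in_subfield_if_power_in_subfield[OF S SS(1) x _ _ SS(2)] unfolding S_def by blast
qed

end

lemma is_subfield_power: "is_subfield T \<Longrightarrow> x \<in> T \<Longrightarrow> x ^ n \<in> T"
  by (induction n) (auto intro: is_subfieldD)

lemma is_subfield_separable_closure: "is_subfield (separable_closure :: 'k::field alg_closure set)"
proof (cases "CHAR('k) = 0")
  case True
  then show ?thesis unfolding separable_closure_char_0[OF True] by (simp add: is_subfield_def)
next
  case False
  let ?L = "separable_closure :: 'k alg_closure set"
  have 1: "1 \<in> ?L" using range_to_ac_subset_separable_closure by (metis rangeI subsetD to_ac_1)
  have 0: "0 \<in> ?L" using range_to_ac_subset_separable_closure by (metis rangeI subsetD to_ac_0)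
  have "x - y \<in> ?L" if x: "x \<in> ?L" and y: "y \<in> ?L" for x y
  proof (rule separable_closure_closed[OF False x y])
    fix T assume T: "is_subfield T" "x \<in> T" "(x - y) ^ CHAR('k) \<in> T"
    have "x ^ CHAR('k) - (x - y) ^ CHAR('k) \<in> T" by (intro is_subfieldD[OF T(1)] is_subfield_power T)
    then show "y ^ CHAR('k) \<in> T" by (simp add: frobenius_diff[OF False])
  qed (rule is_subfieldD)
  moreover have "x * y \<in> ?L" if x: "x \<in> ?L" and y: "y \<in> ?L" for x y
  proof (cases "x = 0")
    case nz: False
    show ?thesis
    proof (rule separable_closure_closed[OF False x y])
      fix T assume T: "is_subfield T" "x \<in> T" "(x * y) ^ CHAR('k) \<in> T"
      have "(x * y) ^ CHAR('k) / x ^ CHAR('k) \<in> T" by (intro is_subfieldD[OF T(1)] is_subfield_power T)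
      then show "y ^ CHAR('k) \<in> T" using nz by (simp add: power_mult_distrib)
    qed (rule is_subfieldD)
  qed (use 0 in simp)
  moreover have "inverse x \<in> ?L" if x: "x \<in> ?L" for x
    by (rule separable_closure_closed[OF False x x]) (auto intro: is_subfield_power is_subfieldD)
  ultimately show ?thesis using 1 unfolding is_subfield_def by blast
qed

section \<open>Generation of the separable closure\<close>

lemma rsquarefree_linear_prod:
  fixes z :: "'i \<Rightarrow> 'a::idom"
  assumes "finite I" "inj_on z I"
  shows "rsquarefree (\<Prod>i\<in>I. [:- z i, 1:])"
  unfolding rsquarefree_iff_no_square
proof (intro allI notI)
  fix u assume sq: "[:- u, 1:] * [:- u, 1:] dvd (\<Prod>i\<in>I. [:- z i, 1:])"
  then have "[:- u, 1:] dvd (\<Prod>i\<in>I. [:- z i, 1:])" by (rule dvd_mult_left)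
  then have "poly (\<Prod>i\<in>I. [:- z i, 1:]) u = 0" by (simp only: poly_eq_0_iff_dvd)
  then obtain j where j: "j \<in> I" "u = z j"
    using assms(1) by (auto simp: poly_prod)
  have "[:- u, 1:] * [:- u, 1:] dvd [:- u, 1:] * (\<Prod>i\<in>I - {j}. [:- z i, 1:])"
    using sq prod.remove[OF assms(1) j(1), of "\<lambda>i. [:- z i, 1:]"] j(2) by simp
  then have "[:- u, 1:] dvd (\<Prod>i\<in>I - {j}. [:- z i, 1:])"
    by (simp only: dvd_mult_cancel_left) simp
  then have "poly (\<Prod>i\<in>I - {j}. [:- z i, 1:]) u = 0" by (simp only: poly_eq_0_iff_dvd)
  then obtain i where "i \<in> I - {j}" "u = z i"
    using assms(1) by (auto simp: poly_prod)
  then show False using j assms(2) by (auto dest: inj_onD)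
qed

text \<open>Each added factor \<open>X - c\<close> needs a \<open>c\<close> in the base field that
  differs from the roots so far, which an infinite field provides.\<close>

lemma extend_root_tuple:
  fixes f :: "'k::field poly"
  assumes f: "lead_coeff f = 1" "rsquarefree (map_poly to_ac f :: 'k alg_closure poly)"
    and inf: "infinite (UNIV :: 'k set)" and N: "Polynomial.degree f \<le> N"
  shows "\<exists>(F :: 'k poly) x. F \<noteq> 0 \<and> Polynomial.degree F = N \<and> inj_on x {..<N} \<and>
    (\<forall>i<N. poly (map_poly to_ac F) (x i) = 0) \<and>
    (\<forall>u. poly (map_poly to_ac f) u = 0 \<longrightarrow> (\<exists>i<N. u = x i))"
  using N
proof (induction N rule: dec_induct)
  case base
  interpret field_hom "to_ac :: 'k \<Rightarrow> 'k alg_closure" by (rule field_hom_to_ac)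
  let ?f = "map_poly to_ac f :: 'k alg_closure poly"
  have l: "lead_coeff ?f = 1" using f(1) by simp
  have sq: "\<not> [:- u, 1:] * [:- u, 1:] dvd ?f" for u
    using f(2) unfolding rsquarefree_iff_no_square by blast
  obtain x where x: "inj_on x {..<Polynomial.degree f}" "?f = (\<Prod>i<Polynomial.degree f. [:- x i, 1:])"
    using split_into_distinct_linear_factors[OF l sq] by auto
  have "poly ?f u = 0 \<longleftrightarrow> (\<exists>i<Polynomial.degree f. u = x i)" for u
    unfolding x(2) by (auto simp: poly_prod)
  then show ?case using x(1) f(1) by (intro exI[of _ f] exI[of _ x]) auto
next
  case (step N)
  then obtain F x where F: "F \<noteq> 0" "Polynomial.degree F = N" "inj_on x {..<N}"
    "\<And>i. i < N \<Longrightarrow> poly (map_poly to_ac F) (x i) = 0"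
    "\<And>u. poly (map_poly to_ac f) u = 0 \<Longrightarrow> \<exists>i<N. u = x i" by blast
  interpret field_hom "to_ac :: 'k \<Rightarrow> 'k alg_closure" by (rule field_hom_to_ac)
  interpret ph: map_poly_inj_idom_hom "to_ac :: 'k \<Rightarrow> 'k alg_closure" ..
  have "infinite (range (to_ac :: 'k \<Rightarrow> 'k alg_closure))"
    using inf finite_imageD[of to_ac "UNIV :: 'k set"] inj_to_ac by blast
  then obtain c :: 'k where c: "to_ac c \<notin> x ` {..<N}"
    by (metis finite_imageI finite_lessThan finite_subset image_subsetI)
  let ?F = "F * [:- c, 1:]" and ?x = "x(N := to_ac c)"
  have "map_poly to_ac ?F = map_poly to_ac F * [:- to_ac c, 1:]"
    by (simp only: ph.hom_mult) (simp add: map_poly_pCons_hom)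
  then have "\<forall>i<Suc N. poly (map_poly to_ac ?F) (?x i) = 0"
    using F(4) by (simp add: less_Suc_eq del: mult_pCons_right)
  moreover have "?F \<noteq> 0" "Polynomial.degree ?F = Suc N"
    using F(1,2) by (simp_all add: degree_mult_eq del: mult_pCons_right)
  moreover have "inj_on ?x {..<Suc N}"
    unfolding lessThan_Suc inj_on_insert using F(3) c by (auto simp: inj_on_def)
  moreover have "\<exists>i<Suc N. u = ?x i" if "poly (map_poly to_ac f) u = 0" for u
    using F(5)[OF that] by (metis fun_upd_apply less_SucI nat_neq_iff)
  ultimately show ?case by blast
qed

abbreviation trinomial_elements :: "'k::field alg_closure set" where
  "trinomial_elements \<equiv> {y \<in> separable_closure. \<exists>n\<ge>2. y ^ n - y \<in> range to_ac}"

text \<open>As \<open>g\<close> is injective on the roots, \<open>w\<close> is the only common root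
  of \<open>q\<close> and \<open>g - y\<close>, where \<open>y = g w\<close> is a trinomial
  element.\<close>

lemma (in base_tuple) in_hull_trinomial_elements:
  assumes "pac_field TYPE('k)" "\<not> CHAR('k) dvd n * (n - 1)"
    and q: "rsquarefree (map_poly to_ac q :: 'k alg_closure poly)"
    and roots: "\<And>u. poly (map_poly to_ac q) u = 0 \<Longrightarrow> \<exists>i<n. u = x i"
    and w: "poly (map_poly to_ac q) w = 0"
  shows "w \<in> is_subfield hull (range to_ac \<union> trinomial_elements)"
proof -
  interpret t: field_hom "to_ac :: 'k \<Rightarrow> 'k alg_closure" by (rule field_hom_to_ac)
  obtain g b where gb: "(\<Prod>i<n. [:- poly (map_poly to_ac g) (x i), 1:]) = map_poly to_ac (trinomial n b)"
    "inj_on (\<lambda>i. poly (map_poly to_ac g) (x i)) {..<n}"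
    using trinomial_realization[OF assms(1,2)] by blast
  obtain i where i: "i < n" "w = x i" using roots[OF w] by blast
  define y where "y = poly (map_poly to_ac g) w"
  let ?H = "is_subfield hull (range to_ac \<union> trinomial_elements :: 'k alg_closure set)"
  have "poly (\<Prod>i<n. [:- poly (map_poly to_ac g) (x i), 1:]) y = 0"
    using i by (auto simp: poly_prod y_def intro!: prod_zero)
  then have root: "poly (map_poly to_ac (trinomial n b)) y = 0" unfolding gb(1) .
  have "rsquarefree (map_poly to_ac (trinomial n b) :: 'k alg_closure poly)"
    unfolding gb(1)[symmetric] by (rule rsquarefree_linear_prod[OF _ gb(2)]) simp
  then have "y \<in> separable_closure" using root unfolding in_separable_closure_iff by blast
  moreover have "y ^ n - y + to_ac b = 0"
    using root unfolding t.poly_map_trinomial .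
  then have "y ^ n - y = to_ac (- b)" by (simp add: eq_neg_iff_add_eq_0)
  then have "y ^ n - y \<in> range to_ac" by blast
  moreover have "n \<ge> 2" using base_tuple_axioms unfolding base_tuple_def by blast
  ultimately have "y \<in> trinomial_elements" by blast
  then have yH: "y \<in> ?H" and kH: "range to_ac \<subseteq> ?H"
    using hull_subset[of "range to_ac \<union> trinomial_elements :: 'k alg_closure set" is_subfield] by blast+
  have H: "is_subfield ?H" by (rule is_subfield_hull)
  have co: "coeffs_in ?H (map_poly to_ac r)" for r
    using t.coeffs_in_map_poly_hom coeffs_in_mono[OF kH] by blast
  show ?thesis
  proof (rule common_root_in_subfield[OF H co[of q] _ w, of "map_poly to_ac g - [:y:]"])
    show "map_poly to_ac q \<noteq> (0 :: 'k alg_closure poly)" using q by (simp add: rsquarefree_def)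
    show "coeffs_in ?H (map_poly to_ac g - [:y:])"
      by (intro coeffs_in_diff coeffs_in_pCons coeffs_in_0 co yH is_subfieldD(1)[OF H])
    show "poly (map_poly to_ac g - [:y:]) w = 0" by (simp add: y_def)
    show "\<not> [:- u, 1:] * [:- u, 1:] dvd map_poly to_ac q" for u :: "'k alg_closure"
      using q unfolding rsquarefree_iff_no_square by blast
    show "u = w" if u: "poly (map_poly to_ac q) u = 0" "poly (map_poly to_ac g - [:y:]) u = 0" for u
    proof -
      obtain j where j: "j < n" "u = x j" using roots[OF u(1)] by blast
      have "poly (map_poly to_ac g) (x j) = poly (map_poly to_ac g) (x i)"
        using u(2) unfolding y_def i(2) j(2) by simp
      then have "j = i" using gb(2) i(1) j(1) by (auto dest: inj_onD)
      then show ?thesis using i j by simp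
    qed
  qed
qed

theorem separable_closure_generated_by_trinomial_elements:
  assumes pac: "pac_field TYPE('k::field)" and two: "CHAR('k) \<noteq> 2"
  shows "is_subfield hull (range (to_ac :: 'k \<Rightarrow> _) \<union> trinomial_elements) = separable_closure"
proof
  show "is_subfield hull (range (to_ac :: 'k \<Rightarrow> _) \<union> trinomial_elements) \<subseteq> separable_closure"
    using range_to_ac_subset_separable_closure by (intro hull_minimal is_subfield_separable_closure) auto
  show "separable_closure \<subseteq> is_subfield hull (range (to_ac :: 'k \<Rightarrow> _) \<union> trinomial_elements)"
  proof
    fix w :: "'k alg_closure" assume "w \<in> separable_closure"
    then obtain f :: "'k poly" where f: "lead_coeff f = 1" "poly (map_poly to_ac f) w = 0"
      "rsquarefree (map_poly to_ac f :: 'k alg_closure poly)"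
      unfolding separable_closure_def irreducible_polynomial_of_def by blast
    define p where "p = CHAR('k)"
    \<comment> \<open>For \<open>p > 0\<close>, \<open>N\<close> and hence also
      \<open>N * (N - 1)\<close> is 2 modulo \<open>p\<close>, which is nonzero as
      \<open>p \<noteq> 2\<close>; the multiple of \<open>p\<close> ensures that \<open>N\<close> is
      not below the degree of \<open>f\<close>. In characteristic 0 only the size matters.\<close>
    define N where "N = (if p = 0 then Polynomial.degree f else p * Polynomial.degree f) + 2"
    have "Polynomial.degree f \<le> p * Polynomial.degree f" if "p \<noteq> 0"
      using that by simp
    then have N: "Polynomial.degree f \<le> N" "N \<ge> 2"
      unfolding N_def by (simp_all only: split: if_split) linarith+
    have char: "\<not> p dvd N * (N - 1)"
    proof (cases "p = 0")
      case False
      then have p: "prime p" using prime_CHAR_semidom[where 'a = 'k] unfolding p_def by simp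
      show ?thesis
      proof
        assume "p dvd N * (N - 1)"
        then have "p dvd N \<or> p dvd N - 1" using prime_dvd_mult_iff[OF p] by blast
        moreover have "N = p * Polynomial.degree f + 2" "N - 1 = p * Polynomial.degree f + 1"
          using False by (simp_all add: N_def)
        ultimately have "p dvd p * Polynomial.degree f + 2 \<or> p dvd p * Polynomial.degree f + 1" by metis
        then have "p dvd 2 \<or> p dvd 1" by (metis dvd_add_right_iff dvd_triv_left)
        then have "p dvd 2" by auto
        then have "p = 2" using p by (simp add: primes_dvd_imp_eq)
        then show False using two unfolding p_def by simp
      qed
    qed (simp add: N_def)
    obtain F :: "'k poly" and x where F: "F \<noteq> 0" "Polynomial.degree F = N" "inj_on x {..<N}"
      "\<forall>i<N. poly (map_poly to_ac F) (x i) = 0"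
      "\<And>u. poly (map_poly to_ac f) u = 0 \<Longrightarrow> \<exists>i<N. u = x i"
      using extend_root_tuple[OF f(1,3) pac_infinite[OF pac] N(1)] by blast
    interpret base_tuple N F x using N F by unfold_locales auto
    show "w \<in> is_subfield hull (range to_ac \<union> trinomial_elements)"
      using in_hull_trinomial_elements[OF pac _ f(3) F(5) f(2)] char unfolding p_def by blast
  qed
qed

section \<open>Finite extensions\<close>

locale finite_extension = field_hom h for h :: "'k::field \<Rightarrow> 'e::field" +
  fixes B :: "'e set"
  assumes finite_B: "finite B"
    and independent_B: "\<not> module.dependent (\<lambda>c x. h c * x) B"
    and span_B: "module.span (\<lambda>c x. h c * x) B = UNIV"
begin

interpretation ph: map_poly_inj_idom_hom h ..

sublocale vs: vector_space "\<lambda>c x. h c * x"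
  by unfold_locales (auto simp: algebra_simps hom_add hom_mult)

sublocale vs: finite_dimensional_vector_space "\<lambda>c x. h c * x" B
  by unfold_locales (fact finite_B independent_B span_B)+

section \<open>Dimensions of simple subextensions\<close>

definition generated :: "'e \<Rightarrow> 'e set" where
  "generated \<beta> = range (\<lambda>g. poly (map_poly h g) \<beta>)"

definition min_poly_of :: "'e \<Rightarrow> 'k poly \<Rightarrow> bool" where
  "min_poly_of \<beta> m \<longleftrightarrow> lead_coeff m = 1 \<and> Factorial_Ring.irreducible m \<and> poly (map_poly h m) \<beta> = 0"

lemma min_poly_of_dvd:
  "min_poly_of \<beta> m \<Longrightarrow> poly (map_poly h q) \<beta> = 0 \<Longrightarrow> m dvd q"
  unfolding min_poly_of_def using irreducible_dvd_of_root by blast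

lemma algebraic: "\<exists>p. p \<noteq> 0 \<and> poly (map_poly h p) \<beta> = 0"
proof (cases "inj_on (\<lambda>i. \<beta> ^ i) {..vs.dimension}")
  \<comment> \<open>Coinciding powers are treated apart, since they would form a set too small for
    the dimension count.\<close>
  case False
  then obtain i j where ij: "i \<noteq> j" "\<beta> ^ i = \<beta> ^ j" by (auto simp: inj_on_def)
  let ?p = "Polynomial.monom (1::'k) i - Polynomial.monom 1 j"
  have "Polynomial.coeff ?p i = 1" using ij(1) by simp
  then have "?p \<noteq> 0" by (metis coeff_0 zero_neq_one)
  moreover have "poly (map_poly h ?p) \<beta> = 0" using ij(2) by (simp add: ph.hom_minus poly_monom)
  ultimately show ?thesis by blast
next
  case True
  let ?S = "(\<lambda>i. \<beta> ^ i) ` {..vs.dimension}"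
  have "card ?S = Suc vs.dimension" using card_image[OF True] by simp
  then have "vs.dependent ?S"
    using vs.independent_card_le_dim[of ?S UNIV] vs.dim_UNIV unfolding vs.dimension_def by auto
  then obtain u where u: "\<exists>v\<in>?S. u v \<noteq> 0" "(\<Sum>v\<in>?S. h (u v) * v) = 0"
    using vs.dependent_finite[of ?S] by auto
  define p where "p = (\<Sum>i\<le>vs.dimension. Polynomial.monom (u (\<beta> ^ i)) i)"
  have co: "Polynomial.coeff p i = (if i \<le> vs.dimension then u (\<beta> ^ i) else 0)" for i
    unfolding p_def by (simp add: coeff_sum)
  obtain i where "i \<le> vs.dimension" "u (\<beta> ^ i) \<noteq> 0" using u(1) by auto
  then have "p \<noteq> 0" using co[of i] by auto
  moreover have "poly (map_poly h p) \<beta> = (\<Sum>i\<le>vs.dimension. h (u (\<beta> ^ i)) * \<beta> ^ i)"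
    unfolding p_def by (simp add: ph.hom_sum poly_sum poly_monom)
  then have "poly (map_poly h p) \<beta> = 0" using u(2) by (simp add: sum.reindex[OF True])
  ultimately show ?thesis by blast
qed

lemma min_poly_of_exists: "\<exists>m. min_poly_of \<beta> m"
  using algebraic minimal_polynomial unfolding min_poly_of_def by blast

lemma generated_conv: "generated \<beta> = {poly g \<beta> | g. coeffs_in (range h) g}"
proof (intro equalityI subsetI)
  fix x assume "x \<in> generated \<beta>"
  then show "x \<in> {poly g \<beta> | g. coeffs_in (range h) g}"
    unfolding generated_def using coeffs_in_map_poly_hom by blast
next
  fix x assume "x \<in> {poly g \<beta> | g. coeffs_in (range h) g}"
  then obtain g where g: "x = poly g \<beta>" "coeffs_in (range h) g" by blast
  have "\<exists>g0. map_poly h g0 = g" using g(2)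
  proof (induction g)
    case 0
    then show ?case by (intro exI[of _ 0]) simp
  next
    case (pCons a g)
    obtain g0 a0 where "map_poly h g0 = g" "h a0 = a"
      using coeffs_in_pConsD[OF pCons.prems] pCons.IH by blast
    then show ?case by (intro exI[of _ "pCons a0 g0"]) (simp add: map_poly_pCons_hom)
  qed
  then show "x \<in> generated \<beta>" unfolding generated_def g(1) by blast
qed

lemma is_subfield_generated: "is_subfield (generated \<beta>)"
proof -
  obtain p where "p \<noteq> 0" "poly (map_poly h p) \<beta> = 0" using algebraic by blast
  then show ?thesis
    unfolding generated_conv
    using simple_extension_is_subfield[OF is_subfield_range coeffs_in_map_poly_hom] by auto
qed

lemma range_subset_generated: "range h \<subseteq> generated \<beta>"
proof
  fix x assume "x \<in> range h"
  then obtain c where "x = h c" by blast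
  then have "x = poly (map_poly h [:c:]) \<beta>" by (simp add: map_poly_pCons_hom)
  then show "x \<in> generated \<beta>" unfolding generated_def by blast
qed

lemma base_in_generated: "\<beta> \<in> generated \<beta>"
proof -
  have "\<beta> = poly (map_poly h [:0, 1:]) \<beta>" by (simp add: map_poly_pCons_hom)
  then show ?thesis unfolding generated_def by blast
qed

lemma generated_subset:
  assumes "is_subfield S" "range h \<subseteq> S" "\<beta> \<in> S"
  shows "generated \<beta> \<subseteq> S"
  unfolding generated_conv
  using coeffs_in_poly[OF is_subfieldD(1)[OF assms(1)] coeffs_in_mono[OF assms(2)] assms(3)] by blast

lemma subspace_generated: "vs.subspace (generated \<beta>)"
proof (rule vs.subspaceI)
  note R = is_subfieldD[OF is_subfield_generated]
  show "0 \<in> generated \<beta>" by (rule R)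
  show "x + y \<in> generated \<beta>" if "x \<in> generated \<beta>" "y \<in> generated \<beta>" for x y using that by (rule R)
  show "h c * x \<in> generated \<beta>" if "x \<in> generated \<beta>" for c x
    by (rule R(5)[OF subsetD[OF range_subset_generated rangeI] that])
qed

text \<open>For a subspace \<open>U\<close> this is the span of \<open>U\<close> and
  \<open>b\<close>, \<open>\<beta> * b\<close>, ..., \<open>\<beta>^(j - 1) * b\<close>.\<close>

definition adjoin_powers :: "'e set \<Rightarrow> 'e \<Rightarrow> 'e \<Rightarrow> nat \<Rightarrow> 'e set" where
  "adjoin_powers U \<beta> b j =
     {u + poly (map_poly h q) \<beta> * b | u q. u \<in> U \<and> (\<forall>i\<ge>j. Polynomial.coeff q i = 0)}"

lemma adjoin_powersI:
  "u \<in> U \<Longrightarrow> (\<And>i. i \<ge> j \<Longrightarrow> Polynomial.coeff q i = 0) \<Longrightarrow> x = u + poly (map_poly h q) \<beta> * b \<Longrightarrow>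
    x \<in> adjoin_powers U \<beta> b j"
  unfolding adjoin_powers_def by blast

lemma subspace_adjoin_powers:
  assumes "vs.subspace U"
  shows "vs.subspace (adjoin_powers U \<beta> b j)"
proof (rule vs.subspaceI)
  show "0 \<in> adjoin_powers U \<beta> b j"
    by (rule adjoin_powersI[of 0 _ _ 0]) (auto intro: vs.subspace_0 assms)
next
  fix x y assume "x \<in> adjoin_powers U \<beta> b j" "y \<in> adjoin_powers U \<beta> b j"
  then obtain u p v q where "u \<in> U" "\<forall>i\<ge>j. Polynomial.coeff p i = 0" "x = u + poly (map_poly h p) \<beta> * b"
    "v \<in> U" "\<forall>i\<ge>j. Polynomial.coeff q i = 0" "y = v + poly (map_poly h q) \<beta> * b"
    unfolding adjoin_powers_def by blast
  then show "x + y \<in> adjoin_powers U \<beta> b j"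
    by (intro adjoin_powersI[of "u + v" _ _ "p + q"])
      (auto simp: ph.hom_add algebra_simps intro: vs.subspace_add assms)
next
  fix c x assume "x \<in> adjoin_powers U \<beta> b j"
  then obtain u p where "u \<in> U" "\<forall>i\<ge>j. Polynomial.coeff p i = 0" "x = u + poly (map_poly h p) \<beta> * b"
    unfolding adjoin_powers_def by blast
  then show "h c * x \<in> adjoin_powers U \<beta> b j"
    by (intro adjoin_powersI[of "h c * u" _ _ "Polynomial.smult c p"])
      (auto simp: map_poly_hom_smult distrib_left mult.assoc intro: vs.subspace_scale assms)
qed

lemma stable_poly:
  assumes "vs.subspace U" "\<And>u. u \<in> U \<Longrightarrow> \<beta> * u \<in> U" "u \<in> U"
  shows "poly (map_poly h s) \<beta> * u \<in> U"
proof (induction s)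
  case 0
  then show ?case using vs.subspace_0[OF assms(1)] by simp
next
  case (pCons a s)
  have "poly (map_poly h (pCons a s)) \<beta> * u = h a * u + \<beta> * (poly (map_poly h s) \<beta> * u)"
    by (simp add: map_poly_pCons_hom algebra_simps)
  then show ?case
    using vs.subspace_add[OF assms(1) vs.subspace_scale[OF assms(1,3)] assms(2)[OF pCons.IH]] by metis
qed

text \<open>Each power adds one dimension. Otherwise \<open>r(\<beta>) * b\<close> would lie in
  \<open>U\<close> for some nonzero \<open>r\<close> of degree below that of \<open>m\<close>. Then
  \<open>r(\<beta>)\<close> has an inverse of the form \<open>s(\<beta>)\<close>, and as
  \<open>U\<close> is stable under \<open>\<beta>\<close>, it would contain
  \<open>b\<close>.\<close>

lemma dim_adjoin_powers:
  assumes U: "vs.subspace U" "\<And>u. u \<in> U \<Longrightarrow> \<beta> * u \<in> U" and b: "b \<notin> U"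
    and m: "min_poly_of \<beta> m" and j: "j \<le> Polynomial.degree m"
  shows "vs.dim (adjoin_powers U \<beta> b j) = vs.dim U + j"
  using j
proof (induction j)
  case 0
  have "adjoin_powers U \<beta> b 0 = U"
  proof (intro equalityI subsetI)
    fix x assume "x \<in> adjoin_powers U \<beta> b 0"
    then obtain u q where "u \<in> U" "\<forall>i. Polynomial.coeff q i = 0" "x = u + poly (map_poly h q) \<beta> * b"
      unfolding adjoin_powers_def by auto
    moreover from this have "q = 0" by (intro poly_eqI) simp
    ultimately show "x \<in> U" by simp
  next
    fix x assume "x \<in> U"
    then show "x \<in> adjoin_powers U \<beta> b 0" by (intro adjoin_powersI[of x _ _ 0]) auto
  qed
  then show ?case by simp
next
  case (Suc j)
  let ?T = "adjoin_powers U \<beta> b"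
  define x where "x = \<beta> ^ j * b"
  have x: "x \<notin> ?T j"
  proof
    assume "x \<in> ?T j"
    then obtain u q where uq: "u \<in> U" "\<forall>i\<ge>j. Polynomial.coeff q i = 0" "x = u + poly (map_poly h q) \<beta> * b"
      unfolding adjoin_powers_def by blast
    define r where "r = Polynomial.monom 1 j - q"
    have rj: "Polynomial.coeff r j = 1" using uq(2) by (simp add: r_def)
    have dr: "Polynomial.degree r \<le> j" unfolding r_def using uq(2) by (intro degree_le) auto
    have rb: "poly (map_poly h r) \<beta> * b = u"
      using uq(3) unfolding x_def r_def by (simp add: ph.hom_minus poly_monom algebra_simps)
    have "poly (map_poly h r) \<beta> \<noteq> 0"
    proof
      assume "poly (map_poly h r) \<beta> = 0"
      then have "m dvd r" by (rule min_poly_of_dvd[OF m])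
      moreover have "r \<noteq> 0" using rj by auto
      ultimately have "Polynomial.degree m \<le> Polynomial.degree r" by (rule dvd_imp_degree_le)
      then show False using dr Suc.prems by simp
    qed
    moreover have "inverse (poly (map_poly h r) \<beta>) \<in> generated \<beta>"
      by (rule is_subfieldD(8)[OF is_subfield_generated]) (auto simp: generated_def)
    then obtain s where "inverse (poly (map_poly h r) \<beta>) = poly (map_poly h s) \<beta>"
      unfolding generated_def by blast
    ultimately have "b = poly (map_poly h s) \<beta> * u"
      using rb by (metis left_inverse mult.assoc mult_1)
    then show False using stable_poly[OF U uq(1)] b by metis
  qed
  have "?T (Suc j) = vs.span (insert x (?T j))"
  proof (rule vs.span_unique[symmetric])
    show "insert x (?T j) \<subseteq> ?T (Suc j)"
    proof
      fix z assume "z \<in> insert x (?T j)"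
      then show "z \<in> ?T (Suc j)"
      proof
        assume "z = x"
        then show ?thesis
          by (intro adjoin_powersI[of 0 _ _ "Polynomial.monom 1 j"])
            (auto simp: x_def poly_monom vs.subspace_0[OF U(1)])
      next
        assume "z \<in> ?T j"
        then show ?thesis unfolding adjoin_powers_def using Suc_leD by blast
      qed
    qed
    show "vs.subspace (?T (Suc j))" by (rule subspace_adjoin_powers[OF U(1)])
    fix V assume V: "insert x (?T j) \<subseteq> V" "vs.subspace V"
    show "?T (Suc j) \<subseteq> V"
    proof
      fix z assume "z \<in> ?T (Suc j)"
      then obtain u q where uq: "u \<in> U" "\<forall>i\<ge>Suc j. Polynomial.coeff q i = 0" "z = u + poly (map_poly h q) \<beta> * b"
        unfolding adjoin_powers_def by blast
      define c where "c = Polynomial.coeff q j"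
      define r where "r = q - Polynomial.monom c j"
      have "Polynomial.coeff r i = 0" if "i \<ge> j" for i
        using uq(2) that by (cases "i = j") (auto simp: r_def c_def)
      then have "u + poly (map_poly h r) \<beta> * b \<in> ?T j" by (rule adjoin_powersI[OF uq(1) _ refl])
      moreover have "z = (u + poly (map_poly h r) \<beta> * b) + h c * x"
        unfolding uq(3) x_def r_def by (simp add: ph.hom_minus poly_monom algebra_simps)
      ultimately show "z \<in> V"
        using V vs.subspace_add[OF V(2)] vs.subspace_scale[OF V(2)] by (metis insert_subset subsetD)
    qed
  qed
  then have "vs.dim (?T (Suc j)) = vs.dim (insert x (?T j))" by simp
  also have "\<dots> = vs.dim (?T j) + 1"
    using x by (simp only: vs.dim_insert vs.span_eq_iff[THEN iffD2, OF subspace_adjoin_powers[OF U(1)]] if_False)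
  finally show ?case using Suc by simp
qed

lemma reduce_mod_min_poly:
  assumes m: "min_poly_of \<beta> m"
  shows "\<exists>r. (\<forall>i\<ge>Polynomial.degree m. Polynomial.coeff r i = 0) \<and>
    poly (map_poly h r) \<beta> = poly (map_poly h q) \<beta>"
proof (intro exI[of _ "q mod m"] conjI)
  have "m \<noteq> 0" using m by (auto simp: min_poly_of_def)
  then show "\<forall>i\<ge>Polynomial.degree m. Polynomial.coeff (q mod m) i = 0"
    using degree_mod_less[of m q] by (auto intro: coeff_eq_0)
  have "q = q div m * m + q mod m" by simp
  then have "map_poly h q = map_poly h (q div m) * map_poly h m + map_poly h (q mod m)"
    by (metis ph.hom_add ph.hom_mult)
  then show "poly (map_poly h (q mod m)) \<beta> = poly (map_poly h q) \<beta>"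
    using m by (simp add: min_poly_of_def)
qed

text \<open>The case \<open>U = {0}\<close>, \<open>b = 1\<close> of
  \<open>dim_adjoin_powers\<close>.\<close>

lemma dim_generated:
  assumes m: "min_poly_of \<beta> m"
  shows "vs.dim (generated \<beta>) = Polynomial.degree m"
proof -
  have "generated \<beta> = adjoin_powers {0} \<beta> 1 (Polynomial.degree m)"
  proof (intro equalityI subsetI)
    fix x assume "x \<in> generated \<beta>"
    then obtain q where "x = poly (map_poly h q) \<beta>" unfolding generated_def by blast
    moreover obtain r where "\<forall>i\<ge>Polynomial.degree m. Polynomial.coeff r i = 0"
      "poly (map_poly h r) \<beta> = poly (map_poly h q) \<beta>"
      using reduce_mod_min_poly[OF m] by blast
    ultimately show "x \<in> adjoin_powers {0} \<beta> 1 (Polynomial.degree m)"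
      by (intro adjoin_powersI[of 0 _ _ r]) simp_all
  qed (auto simp: adjoin_powers_def generated_def)
  moreover have "vs.dim (adjoin_powers {0} \<beta> 1 (Polynomial.degree m)) = vs.dim {0} + Polynomial.degree m"
    by (rule dim_adjoin_powers[OF _ _ _ m]) (auto simp: vs.subspace_def)
  ultimately show ?thesis by simp
qed

text \<open>The tower law without a basis over \<open>k(\<beta>)\<close>: take a subspace stable
  under \<open>\<beta>\<close>, of largest dimension among those whose dimension is a multiple of
  the degree. If it missed some \<open>b\<close>, adjoining the multiples of \<open>b\<close> by
  powers of \<open>\<beta>\<close> would give a larger one.\<close>

lemma degree_min_poly_dvd:
  assumes m: "min_poly_of \<beta> m"
  shows "Polynomial.degree m dvd vs.dimension"
proof -
  let ?d = "Polynomial.degree m"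
  define P where "P k \<longleftrightarrow> (\<exists>U. vs.subspace U \<and> (\<forall>u\<in>U. \<beta> * u \<in> U) \<and> vs.dim U = k * ?d)" for k
  have d: "?d > 0"
  proof (rule ccontr)
    assume "\<not> ?thesis"
    then have "m = 1" using m monic_degree_0[of m] by (simp add: min_poly_of_def)
    then show False using m by (simp add: min_poly_of_def)
  qed
  have P0: "P 0" unfolding P_def by (intro exI[of _ "{0}"]) (simp add: vs.subspace_def)
  have bound: "k \<le> vs.dimension" if "P k" for k
  proof -
    obtain U where "vs.dim U = k * ?d" using \<open>P k\<close> unfolding P_def by blast
    then have "k * ?d \<le> vs.dimension" using vs.dim_subset_UNIV[of U] by simp
    moreover have "k * 1 \<le> k * ?d" using d by (intro mult_le_mono2) simp
    ultimately show ?thesis by linarith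
  qed
  obtain k where k: "P k" "\<And>l. P l \<Longrightarrow> l \<le> k"
    using GreatestI_nat[of P 0, OF P0 bound] Greatest_le_nat[of P, OF _ bound] by blast
  obtain U where U: "vs.subspace U" "\<And>u. u \<in> U \<Longrightarrow> \<beta> * u \<in> U" "vs.dim U = k * ?d" using k(1) unfolding P_def by blast
  have "U = UNIV"
  proof (rule ccontr)
    assume "U \<noteq> UNIV"
    then obtain b where b: "b \<notin> U" by blast
    let ?T = "adjoin_powers U \<beta> b ?d"
    have "vs.dim ?T = Suc k * ?d" using dim_adjoin_powers[OF U(1,2) b m le_refl] U(3) by simp
    moreover have "vs.subspace ?T" by (rule subspace_adjoin_powers[OF U(1)])
    moreover have "\<beta> * z \<in> ?T" if z: "z \<in> ?T" for z
    proof -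
      obtain u q where uq: "u \<in> U" "z = u + poly (map_poly h q) \<beta> * b"
        using z unfolding adjoin_powers_def by blast
      obtain r where r: "\<forall>i\<ge>?d. Polynomial.coeff r i = 0"
        "poly (map_poly h r) \<beta> = poly (map_poly h (pCons 0 q)) \<beta>"
        using reduce_mod_min_poly[OF m] by blast
      show ?thesis
        by (rule adjoin_powersI[OF U(2)[OF uq(1)], of _ r])
          (use r in \<open>simp_all add: uq(2) map_poly_pCons_hom algebra_simps\<close>)
    qed
    ultimately have "P (Suc k)" unfolding P_def by blast
    then show False using k(2)[of "Suc k"] by simp
  qed
  then show ?thesis using U(3) vs.dim_UNIV unfolding vs.dimension_def by simp
qed

end

section \<open>Primitive elements and realization by a trinomial\<close>

lemma (in field_hom) is_subfield_image:
  assumes "is_subfield S"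
  shows "is_subfield (hom ` S)"
  unfolding is_subfield_def
proof (intro conjI ballI)
  note R = is_subfieldD[OF assms]
  show "1 \<in> hom ` S" by (rule image_eqI[of _ _ 1]) (simp_all add: R)
  fix x assume "x \<in> hom ` S"
  then obtain a where a: "a \<in> S" "x = hom a" by blast
  show "inverse x \<in> hom ` S" by (rule image_eqI[of _ _ "inverse a"]) (simp_all add: a R hom_inverse)
  fix y assume "y \<in> hom ` S"
  then obtain b where b: "b \<in> S" "y = hom b" by blast
  show "x - y \<in> hom ` S" by (rule image_eqI[of _ _ "a - b"]) (simp_all add: a b R hom_minus)
  show "x * y \<in> hom ` S" by (rule image_eqI[of _ _ "a * b"]) (simp_all add: a b R hom_mult)
qed

lemma field_hom_comp:
  assumes "field_hom g" "field_hom f"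
  shows "field_hom (f \<circ> g)"
proof -
  interpret g: field_hom g by fact
  interpret f: field_hom f by fact
  interpret comm_ring_hom "f \<circ> g"
    by unfold_locales (auto simp: g.hom_add g.hom_mult f.hom_add f.hom_mult)
  show ?thesis ..
qed

context finite_extension
begin

interpretation ph: map_poly_inj_idom_hom h ..

text \<open>The classical choice \<open>\<gamma> = \<theta> + h c * \<beta>\<close>. For all but
  finitely many \<open>c\<close>, \<open>\<beta>\<close> is the only common root of its minimal
  polynomial and of \<open>F(\<gamma> - h c * X)\<close>, where \<open>F\<close> is the minimal
  polynomial of \<open>\<theta>\<close>; so \<open>\<beta>\<close> lies in the field generated by
  \<open>\<gamma>\<close>.\<close>

lemma exists_common_generator:
  assumes inf: "infinite (UNIV :: 'k set)" and sep: "\<And>m. min_poly_of \<beta> m \<Longrightarrow> pderiv m \<noteq> 0"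
  shows "\<exists>\<gamma>. \<theta> \<in> generated \<gamma> \<and> \<beta> \<in> generated \<gamma>"
proof -
  interpret t: field_hom "to_ac :: 'e \<Rightarrow> 'e alg_closure" by (rule field_hom_to_ac)
  interpret H: field_hom "to_ac \<circ> h"
    by (rule field_hom_comp[OF field_hom_axioms t.field_hom_axioms])
  interpret Hp: map_poly_inj_idom_hom "to_ac \<circ> h" ..
  have conv: "map_poly (to_ac \<circ> h) p = map_poly to_ac (map_poly h p)" for p
    by (simp add: map_poly_map_poly)
  obtain f q where fq: "min_poly_of \<theta> f" "min_poly_of \<beta> q" using min_poly_of_exists by blast
  let ?F = "map_poly (to_ac \<circ> h) f :: 'e alg_closure poly" and ?Q = "map_poly (to_ac \<circ> h) q :: 'e alg_closure poly"
  have nz: "?F \<noteq> 0" "?Q \<noteq> 0" using fq by (auto simp: min_poly_of_def)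
  have F0: "poly ?F (to_ac \<theta>) = 0" using fq(1) by (simp add: conv min_poly_of_def)
  have Q0: "poly ?Q (to_ac \<beta>) = 0" using fq(2) by (simp add: conv min_poly_of_def)
  \<comment> \<open>The values of \<open>c\<close> for which conjugates \<open>a\<close> of
    \<open>\<theta>\<close> and \<open>b \<noteq> \<beta>\<close> of \<open>\<beta>\<close> give
    \<open>a + c * b = \<gamma>\<close>. Pairs with \<open>b = \<beta>\<close> contribute just the
    value 0, by division by zero.\<close>
  let ?bad = "(\<lambda>(a, b). (a - to_ac \<theta>) / (to_ac \<beta> - b)) ` ({a. poly ?F a = 0} \<times> {b. poly ?Q b = 0})"
  have "finite ?bad" by (intro finite_imageI finite_cartesian_product poly_roots_finite nz)
  moreover have "infinite (range (to_ac \<circ> h))"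
    using inf finite_imageD[of "to_ac \<circ> h" "UNIV :: 'k set"] H.inj_f by blast
  ultimately have "\<not> range (to_ac \<circ> h) \<subseteq> ?bad" using finite_subset by blast
  then obtain c where c: "to_ac (h c) \<notin> ?bad" by auto
  define \<gamma> where "\<gamma> = \<theta> + h c * \<beta>"
  let ?S = "to_ac ` generated \<gamma> :: 'e alg_closure set"
  have G: "is_subfield (generated \<gamma>)" by (rule is_subfield_generated)
  have S: "is_subfield ?S" by (rule t.is_subfield_image[OF G])
  note R = is_subfieldD[OF S]
  have co: "coeffs_in ?S (map_poly (to_ac \<circ> h) p)" for p
    unfolding coeffs_in_def using subsetD[OF range_subset_generated rangeI] by simp
  have "to_ac (h c) \<in> ?S" "to_ac \<gamma> \<in> ?S"
    using range_subset_generated base_in_generated by blast+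
  then have lin: "coeffs_in ?S [:to_ac \<gamma>, - to_ac (h c):]"
    by (intro coeffs_in_pCons coeffs_in_0[OF R(1)] R(7))
  have comp: "coeffs_in ?S (pcompose p [:to_ac \<gamma>, - to_ac (h c):])" if "coeffs_in ?S p" for p
    using that
  proof (induction p)
    case (pCons a p)
    then show ?case
      using coeffs_in_pConsD[OF pCons.prems]
      by (simp only: pcompose_pCons)
        (intro coeffs_in_add[OF R(1)] coeffs_in_mult[OF R(1)] coeffs_in_pCons coeffs_in_0[OF R(1)] lin; blast)
  qed (simp add: coeffs_in_0[OF R(1)])
  have "to_ac \<beta> \<in> ?S"
  proof (rule common_root_in_subfield[OF S co[of q] nz(2) Q0 comp[OF co[of f]]])
    show "poly (pcompose ?F [:to_ac \<gamma>, - to_ac (h c):]) (to_ac \<beta>) = 0"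
      using F0 by (simp add: poly_pcompose \<gamma>_def algebra_simps)
    show "\<not> [:- u, 1:] * [:- u, 1:] dvd ?Q" for u
      using fq(2) sep[OF fq(2)] unfolding min_poly_of_def by (intro H.irreducible_no_square) blast+
    show "u = to_ac \<beta>" if u: "poly ?Q u = 0" "poly (pcompose ?F [:to_ac \<gamma>, - to_ac (h c):]) u = 0" for u
    proof (rule ccontr)
      assume ne: "u \<noteq> to_ac \<beta>"
      define a where "a = to_ac \<gamma> - to_ac (h c) * u"
      have "poly ?F a = 0" using u(2) by (simp add: poly_pcompose a_def algebra_simps)
      moreover have "to_ac (h c) = (a - to_ac \<theta>) / (to_ac \<beta> - u)"
        using ne by (simp add: a_def \<gamma>_def field_simps)
      ultimately show False using c u(1) by auto
    qed
  qed
  then have \<beta>: "\<beta> \<in> generated \<gamma>" by auto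
  have "\<gamma> - h c * \<beta> \<in> generated \<gamma>"
    using range_subset_generated base_in_generated \<beta> by (intro is_subfieldD[OF G]) blast+
  then have "\<theta> \<in> generated \<gamma>" unfolding \<gamma>_def by simp
  then show ?thesis using \<beta> by blast
qed

lemma generated_eq_UNIV:
  assumes "min_poly_of \<theta> m" "Polynomial.degree m = vs.dimension"
  shows "generated \<theta> = UNIV"
proof (rule vs.subspace_dim_equal[OF subspace_generated vs.subspace_UNIV])
  show "vs.dim UNIV \<le> vs.dim (generated \<theta>)"
    unfolding dim_generated[OF assms(1)] assms(2) by (rule vs.dim_subset_UNIV)
qed simp

text \<open>A simple subextension of largest dimension absorbs every \<open>\<beta>\<close>: the
  field of a common generator contains it and cannot be larger.\<close>

lemma exists_primitive_element:
  assumes inf: "infinite (UNIV :: 'k set)" and sep: "\<And>\<beta> m. min_poly_of \<beta> m \<Longrightarrow> pderiv m \<noteq> 0"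
  shows "\<exists>\<theta>. generated \<theta> = UNIV"
proof -
  have "\<forall>\<theta>. vs.dim (generated \<theta>) \<le> vs.dimension" using vs.dim_subset_UNIV by blast
  then obtain \<theta> where \<theta>: "\<And>\<gamma>. vs.dim (generated \<gamma>) \<le> vs.dim (generated \<theta>)"
    using ex_has_greatest_nat[of "\<lambda>_. True" undefined "\<lambda>\<theta>. vs.dim (generated \<theta>)" "Suc vs.dimension"]
    by (auto simp: less_Suc_eq_le)
  have "\<beta> \<in> generated \<theta>" for \<beta>
  proof -
    obtain \<gamma> where \<gamma>: "\<theta> \<in> generated \<gamma>" "\<beta> \<in> generated \<gamma>"
      using exists_common_generator[OF inf, of \<beta> \<theta>] sep by blast
    have "generated \<theta> \<subseteq> generated \<gamma>"
      by (rule generated_subset[OF is_subfield_generated range_subset_generated \<gamma>(1)])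
    then have "generated \<theta> = generated \<gamma>"
      by (rule vs.subspace_dim_equal[OF subspace_generated subspace_generated]) (rule \<theta>)
    then show ?thesis using \<gamma>(2) by simp
  qed
  then show ?thesis by blast
qed

theorem realized_by_trinomial:
  assumes pac: "pac_field TYPE('k)" and deg: "vs.dimension = n" "n \<ge> 2"
    and char: "\<not> CHAR('k) dvd n * (n - 1)"
  shows "\<exists>b. realized_by h (trinomial n b)"
proof -
  have sep: "pderiv m \<noteq> 0" if m: "min_poly_of \<beta> m" for \<beta> m
  proof
    assume "pderiv m = 0"
    moreover have "m \<noteq> 0" using m by (auto simp: min_poly_of_def)
    ultimately have "CHAR('k) dvd Polynomial.degree m" by (rule pderiv_eq_0_imp_CHAR_dvd_degree)
    also have "\<dots> dvd n" using degree_min_poly_dvd[OF m] deg(1) by simp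
    finally show False using char by simp
  qed
  obtain \<theta> where \<theta>: "generated \<theta> = UNIV" using exists_primitive_element[OF pac_infinite[OF pac]] sep by blast
  obtain f where f: "min_poly_of \<theta> f" using min_poly_of_exists by blast
  have degf: "Polynomial.degree f = n"
    using dim_generated[OF f] unfolding \<theta> using vs.dim_UNIV deg(1) unfolding vs.dimension_def by simp
  note f' = f[unfolded min_poly_of_def]
  interpret t: field_hom "to_ac :: 'k \<Rightarrow> 'k alg_closure" by (rule field_hom_to_ac)
  interpret tp: map_poly_inj_idom_hom "to_ac :: 'k \<Rightarrow> 'k alg_closure" ..
  let ?f = "map_poly to_ac f :: 'k alg_closure poly"
  have "lead_coeff ?f = 1" using f' by simp
  moreover have "\<not> [:- u, 1:] * [:- u, 1:] dvd ?f" for u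
    using f' sep[OF f] by (intro t.irreducible_no_square) blast+
  ultimately obtain x where x: "inj_on x {..<n}" "?f = (\<Prod>i<n. [:- x i, 1:])"
    using split_into_distinct_linear_factors[of ?f] degf by auto
  have root: "poly ?f (x i) = 0" if "i < n" for i
    unfolding x(2) using that by (auto simp: poly_prod intro!: prod_zero)
  interpret base_tuple n f x
    using deg(2) f' degf x(1) root by unfold_locales auto
  obtain g b where gb: "(\<Prod>i<n. [:- poly (map_poly to_ac g) (x i), 1:]) = map_poly to_ac (trinomial n b)"
    "inj_on (\<lambda>i. poly (map_poly to_ac g) (x i)) {..<n}"
    using trinomial_realization[OF pac char] by blast
  let ?Q = "trinomial n b"
  \<comment> \<open>Relations at \<open>g \<theta>\<close> in \<open>E\<close> and at
    \<open>g (x i)\<close> in the algebraic closure of \<open>k\<close> are both governed by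
    divisibility by \<open>f\<close>. This transfers roots between the two fields without choosing
    an embedding of \<open>E\<close>.\<close>
  have dvd: "poly (map_poly h p) (poly (map_poly h g) \<theta>) = 0 \<longleftrightarrow> f dvd pcompose p g" for p
  proof
    assume "poly (map_poly h p) (poly (map_poly h g) \<theta>) = 0"
    then have "poly (map_poly h (pcompose p g)) \<theta> = 0" by (simp add: map_poly_pcompose poly_pcompose)
    then show "f dvd pcompose p g" by (rule min_poly_of_dvd[OF f])
  next
    assume "f dvd pcompose p g"
    then obtain s where "pcompose p g = f * s" ..
    then have "poly (map_poly h (pcompose p g)) \<theta> = 0" using f' by (simp add: ph.hom_mult)
    then show "poly (map_poly h p) (poly (map_poly h g) \<theta>) = 0" by (simp add: map_poly_pcompose poly_pcompose)
  qed
  define y where "y = poly (map_poly h g) \<theta>"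
  have "poly (map_poly to_ac ?Q) (poly (map_poly to_ac g) (x 0)) = 0"
    unfolding gb(1)[symmetric] using deg(2) by (auto simp: poly_prod intro!: prod_zero bexI[of _ 0])
  then have "poly (map_poly to_ac (pcompose ?Q g)) (x 0) = 0"
    by (simp add: t.map_poly_pcompose poly_pcompose)
  then have "f dvd pcompose ?Q g" using f' root[of 0] deg(2) by (intro t.irreducible_dvd_of_root[of f "x 0"]) auto
  then have Qy: "poly (map_poly h ?Q) y = 0" unfolding y_def dvd .
  obtain m where m: "min_poly_of y m" using min_poly_of_exists by blast
  note m' = m[unfolded min_poly_of_def]
  have "f dvd pcompose m g" using m' unfolding y_def dvd by blast
  then have "?f dvd map_poly to_ac (pcompose m g)" by (rule tp.hom_dvd)
  then have m_root: "poly (map_poly to_ac m) (poly (map_poly to_ac g) (x i)) = 0" if "i < n" for i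
    using root[OF that] by (auto simp: dvd_def t.map_poly_pcompose poly_pcompose[symmetric])
  \<comment> \<open>The minimal polynomial of \<open>y\<close> vanishes at the \<open>n\<close>
    distinct conjugates \<open>g (x i)\<close>, so as a divisor of the trinomial it has to be all of
    it.\<close>
  have degm: "Polynomial.degree m \<ge> n"
  proof (rule ccontr)
    assume "\<not> ?thesis"
    then have "map_poly to_ac m = (0 :: 'k alg_closure poly)"
      by (intro poly_eq_0_of_many_roots[OF gb(2)]) (auto simp: m_root)
    then show False using m' by simp
  qed
  have lQ: "Polynomial.degree ?Q = n" "lead_coeff ?Q = 1" 
    unfolding trinomial_def x_as_monom x_pow_n using degree_trinomial[OF deg(2)]
    by (simp_all only: x_as_monom[symmetric])
  obtain s where s: "?Q = m * s" using min_poly_of_dvd[OF m Qy] ..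
  have ms: "m \<noteq> 0" "s \<noteq> 0" using s lQ(2) by auto
  have "Polynomial.degree m + Polynomial.degree s = n" using lQ(1) ms unfolding s by (simp add: degree_mult_eq)
  then have "Polynomial.degree s = 0" "Polynomial.degree m = n" using degm by simp_all
  moreover have "lead_coeff s = 1" using lQ(2) m' unfolding s by (simp add: lead_coeff_mult)
  ultimately have "s = 1" using monic_degree_0[of s] by blast
  then have Qm: "?Q = m" using s by simp
  have "generated y = UNIV" using \<open>Polynomial.degree m = n\<close> deg(1) by (intro generated_eq_UNIV[OF m]) simp
  moreover have "insert y (range h) \<subseteq> is_subfield hull (insert y (range h))" by (rule hull_subset)
  then have "generated y \<subseteq> is_subfield hull (insert y (range h))"
    by (intro generated_subset is_subfield_hull) auto
  ultimately have "primitive_element h y" unfolding primitive_element_def by blast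
  moreover have "irreducible_polynomial_of h y ?Q" unfolding irreducible_polynomial_of_def Qm using m' .
  ultimately show ?thesis unfolding realized_by_def by blast
qed

end

lemma field_extension_field_hom:
  assumes "field_extension h"
  shows "field_hom h"
proof -
  have "h 0 = h 0 + h 0" using assms unfolding field_extension_def by (metis add_0)
  then have "h 0 = 0" by (metis add_cancel_right_right)
  then interpret comm_ring_hom h
    using assms unfolding field_extension_def by unfold_locales blast+
  show ?thesis ..
qed

lemma finite_extension_exists:
  fixes h :: "'k::field \<Rightarrow> 'e::field"
  assumes "field_extension h" "extension_degree h > 0"
  shows "\<exists>B. finite_extension h B \<and> card B = extension_degree h"
proof -
  interpret field_hom h by (rule field_extension_field_hom[OF assms(1)])
  interpret vector_space "\<lambda>c x. h c * x"
    by unfold_locales (auto simp: algebra_simps hom_add hom_mult)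
  obtain B where B: "independent B" "UNIV \<subseteq> span B" "card B = extension_degree h"
    using basis_exists[of UNIV] unfolding extension_degree_def by blast
  \<comment> \<open>An infinite basis would have cardinality 0, which positivity of the degree
    excludes.\<close>
  have "finite B" using B(3) assms(2) by (metis card.infinite less_irrefl)
  then have "finite_extension h B"
    using B(1,2) by unfold_locales auto
  then show ?thesis using B(3) by blast
qed

theorem theorem2:
  assumes "pac_field TYPE('k::field)"
  shows "(\<forall>n\<ge>2. \<not> CHAR('k) dvd n * (n - 1) \<longrightarrow>
            (\<forall>h :: 'k \<Rightarrow> 'e::field. field_extension h \<and> extension_degree h = n \<longrightarrow>
               (\<exists>b. realized_by h (trinomial n b)))) \<and>
         (CHAR('k) \<noteq> 2 \<longrightarrow>
            is_subfield hull
              (range (to_ac :: 'k \<Rightarrow> 'k alg_closure) \<union>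
               {y \<in> separable_closure. \<exists>n\<ge>2. y ^ n - y \<in> range to_ac}) =
            separable_closure)"
proof (intro conjI allI impI)
  fix n :: nat and h :: "'k \<Rightarrow> 'e"
  assume n: "2 \<le> n" "\<not> CHAR('k) dvd n * (n - 1)" and h: "field_extension h \<and> extension_degree h = n"
  then obtain B where B: "finite_extension h B" "card B = n"
    using finite_extension_exists[of h] by auto
  interpret finite_extension h B by (rule B(1))
  show "\<exists>b. realized_by h (trinomial n b)"
    using realized_by_trinomial[OF assms _ n] B(2) unfolding vs.dimension_def by blast
qed (rule separable_closure_generated_by_trinomial_elements[OF assms])

end
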